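(* Let $\boldsymbol u=(u_1,\dots,u_N)\in\mathbb W_N$ and $\xi=\sum_{j=1}^N\delta_{u_j}$, and let $\mathcal M_\xi^u$ be a one-parameter family of maps satisfying (i)--(iii) of the context. Let $M\in\mathbb N$, let $0<t_1<\dots<t_M\le T$ be elements of $\mathcal T$ ($T\in\mathcal T$), and let $\chi_{t_1},\dots,\chi_{t_M}$ be measurable functions on $S$. Then $$\mathrm E_{\boldsymbol u}\Big[\prod_{m=1}^M\prod_{j=1}^N\{1+\chi_{t_m}(V_j(t_m))\}\det_{1\le j,k\le N}\big[\mathcal M_\xi^{u_k}(T,V_j(T))\big]\Big]=\mathop{\mathrm{Det}}_{(s,t)\in\{t_1,\dots,t_M\}^2,\ (x,y)\in S^2}\big[\delta_{st}\delta_x(y)+\mathbb K_\xi(s,x;t,y)\chi_t(y)\big],$$ where $$\mathbb K_\xi(s,x;t,y)=\int_S\xi(dv)\,p(s,x|v)\,\mathcal M_\xi^v(t,y)-\mathbf 1(s>t)\,p(s-t,x|y).$$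
   Context: Time set: $\mathcal T=[0,\infty)$ or $\mathcal T=\mathbb N_0=\{0,1,2,\dots\}$. $V(t)$, $t\in\mathcal T$, is a Markov process with state space $S\subset\mathbb R$, with filtration $\mathcal F(t)=\sigma(V(s): s\in[0,t]\cap\mathcal T)$. If $\mathcal T=[0,\infty)$, $V$ has right-continuous sample paths and $p(t,y|x)=\frac{\partial}{\partial y}\mathrm P(V(t)\le y|V(0)=x)$ is its transition probability density; if $\mathcal T=\mathbb N_0$, $p(t,y|x)=\mathrm P(V(t)=y|V(0)=x)$ is its transition probability (and integrals $d\boldsymbol x$ over the state space are read as sums). $N\in\mathbb N$. For $n\in\mathbb N$, $\mathbb W_n=\{\boldsymbol x\in S^n: x_1<\dots<x_n\}$. Under $\mathrm P_{\boldsymbol u}$ (expectation $\mathrm E_{\boldsymbol u}$), $V_1,\dots,V_N$ are independent copies of $V$ with $V_j(0)=u_j$. $\mathbf 1(\omega)$ equals $1$ if the condition $\omega$ holds and $0$ otherwise. A process $M(t)$, $t\in\mathcal T$, adapted to $\{\mathcal F(t)\}$ is a martingale if $\mathrm E[M(t)|\mathcal F(s)]=M(s)$ a.s. for all $s<t$ in $\mathcal T$; it is a local martingale if there is a nondecreasing sequence of stopping times $T_n$ of $\{\mathcal F(t)\}$ with $\lim_{n\to\infty}T_n=\infty$ almost surely such that $M(t\wedge T_n)$, $t\in\mathcal T$, is a martingale for every $n\in\mathbb N$. Given $\xi=\sum_{j=1}^N\delta_{u_j}$ with $\boldsymbol u\in\mathbb W_N$, it is assumed that there is a one-parameter family of maps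 $\mathcal M_\xi^u(\cdot,\cdot):\mathcal T\times\mathbb R\to\mathbb R$, $u\in\mathbb C$, such that (i) $\mathcal M_\xi^u(\cdot,V(\cdot))$ is a local martingale; (ii) $\mathcal M_\xi^{u_k}(\cdot,x)$, $1\le k\le N$, are linearly independent functions of $x$; (iii) $\mathcal M_\xi^{u_k}(0,u_j)=\delta_{jk}$ for $u_j,u_k\in\operatorname{supp}\xi=\{u_1,\dots,u_N\}$. The Fredholm determinant of a kernel $\mathbf K(s,x;t,y)$, $(s,x),(t,y)\in\mathcal T\times S$, with functions $\chi_{t_1},\dots,\chi_{t_M}$ is defined by $$\mathop{\mathrm{Det}}_{(s,t)\in\{t_1,\dots,t_M\}^2,\ (x,y)\in S^2}\big[\delta_{st}\delta_x(y)+\mathbf K(s,x;t,y)\chi_t(y)\big]=\sum_{\substack{N_m\ge0\\1\le m\le M}}\int_{\prod_{m=1}^M\mathbb W_{N_m}}\prod_{m=1}^M\Big\{d\boldsymbol x^{(m)}_{N_m}\prod_{j=1}^{N_m}\chi_{t_m}(x^{(m)}_j)\Big\}\det_{\substack{1\le j\le N_m,\,1\le k\le N_n\\1\le m,n\le M}}\big[\mathbf K(t_m,x^{(m)}_j;t_n,x^{(n)}_k)\big],$$ where $\boldsymbol x^{(m)}_{N_m}=(x^{(m)}_1,\dots,x^{(m)}_{N_m})$, $d\boldsymbol x^{(m)}_{N_m}=\prod_{j=1}^{N_m}dx^{(m)}_j$, and the term with all $N_m=0$ is $1$.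
   Formalization: Adds that each M^{u_k}(·,V(·)) is a true martingale up to T under each P_{u_j} (local is not enough: 3-d Bessel, M=u_1/x), and that E_u[∏∏(1+|χ_{t_m}(V_j(t_m))|)·|det|] is finite, since for unbounded χ the two sides may be undefined. *)

theory Defs
  imports "HOL-Probability.Probability"
begin

section \<open>Martingales and local martingales over a time set\<close>

text \<open>
  The time set is a set of reals, either \<open>{0..}\<close> or \<open>\<nat>\<close>, so that discrete and continuous time are
  treated together.  A process or filtration is a function of a real time parameter of which only
  the values at times in the time set matter.
\<close>

definition natural_filtration ::
  "real set \<Rightarrow> 'w measure \<Rightarrow> (real \<Rightarrow> 'w \<Rightarrow> real) \<Rightarrow> real \<Rightarrow> 'w measure" where
  "natural_filtration TT Om V t =
     sigma (space Om) {V s -` A \<inter> space Om | s A. s \<in> {0..t} \<inter> TT \<and> A \<in> sets borel}"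

definition martingale ::
  "'w measure \<Rightarrow> (real \<Rightarrow> 'w measure) \<Rightarrow> real set \<Rightarrow> (real \<Rightarrow> 'w \<Rightarrow> real) \<Rightarrow> bool" where
  "martingale Q F TT X \<longleftrightarrow>
     (\<forall>t\<in>TT. X t \<in> borel_measurable (F t)) \<and>
     (\<forall>t\<in>TT. integrable Q (X t)) \<and>
     (\<forall>s\<in>TT. \<forall>t\<in>TT. s < t \<longrightarrow> (AE \<omega> in Q. real_cond_exp Q (F s) (X t) \<omega> = X s \<omega>))"

text \<open>
  The library constant \<open>stopping_time\<close> requires the time and the index of the filtration to have the
  same type; here a stopping time may be infinite, and only times in the time set are tested.
\<close>

definition ext_stopping_time ::
  "'w measure \<Rightarrow> (real \<Rightarrow> 'w measure) \<Rightarrow> real set \<Rightarrow> ('w \<Rightarrow> ereal) \<Rightarrow> bool" where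
  "ext_stopping_time Q F TT \<tau> \<longleftrightarrow>
     (\<forall>\<omega>\<in>space Q. \<tau> \<omega> \<in> insert \<infinity> (ereal ` TT)) \<and>
     (\<forall>t\<in>TT. {\<omega> \<in> space Q. \<tau> \<omega> \<le> ereal t} \<in> sets (F t))"

definition local_martingale ::
  "'w measure \<Rightarrow> (real \<Rightarrow> 'w measure) \<Rightarrow> real set \<Rightarrow> (real \<Rightarrow> 'w \<Rightarrow> real) \<Rightarrow> bool" where
  "local_martingale Q F TT X \<longleftrightarrow>
     (\<forall>t\<in>TT. X t \<in> borel_measurable (F t)) \<and>
     (\<exists>\<tau> :: nat \<Rightarrow> 'w \<Rightarrow> ereal.
        (\<forall>n. ext_stopping_time Q F TT (\<tau> n)) \<and>
        (\<forall>\<omega>\<in>space Q. incseq (\<lambda>n. \<tau> n \<omega>)) \<and>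
        (AE \<omega> in Q. (\<lambda>n. \<tau> n \<omega>) \<longlonglongrightarrow> \<infinity>) \<and>
        (\<forall>n. martingale Q F TT (\<lambda>t \<omega>. X (real_of_ereal (min (ereal t) (\<tau> n \<omega>))) \<omega>)))"


section \<open>Markov processes with transition densities\<close>

text \<open>Reference measure on the state space: Lebesgue measure in continuous time, and counting
  measure in discrete time, where integrals over the state space are sums.\<close>

definition state_measure :: "real set \<Rightarrow> real set \<Rightarrow> real measure" where
  "state_measure TT S = (if TT = \<nat> then count_space S else restrict_space lborel S)"

text \<open>
  \<open>P x\<close> is the law of the process started at \<open>x\<close> and \<open>p t y x\<close> is the transition density (or
  probability) \<open>p(t,y|x)\<close> from \<open>x\<close> to \<open>y\<close>.  The process is time-homogeneous.  In continuous time any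
  nonnegative, jointly measurable version of the density is allowed; by Lebesgue differentiation,
  \<open>p t y x\<close> is the derivative at \<open>y\<close> of the distribution function of \<open>V t\<close> under \<open>P x\<close>, for almost
  every \<open>y\<close>.
\<close>

locale markov_process =
  fixes TT S :: "real set"
    and Om :: "'w measure"
    and P :: "real \<Rightarrow> 'w measure"
    and V :: "real \<Rightarrow> 'w \<Rightarrow> real"
    and p :: "real \<Rightarrow> real \<Rightarrow> real \<Rightarrow> real"
  assumes time_set: "TT = {0..} \<or> TT = \<nat>"
    and prob_space_P: "x \<in> S \<Longrightarrow> prob_space (P x)"
    and sets_P: "x \<in> S \<Longrightarrow> sets (P x) = sets Om"
    and V_measurable: "t \<in> TT \<Longrightarrow> V t \<in> borel_measurable Om"
    and V_in_S: "t \<in> TT \<Longrightarrow> \<omega> \<in> space Om \<Longrightarrow> V t \<omega> \<in> S"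
    and V_start: "x \<in> S \<Longrightarrow> AE \<omega> in P x. V 0 \<omega> = x"
    and markov_property:
      "x \<in> S \<Longrightarrow> s \<in> TT \<Longrightarrow> t \<in> TT \<Longrightarrow> A \<in> sets borel \<Longrightarrow>
       AE \<omega> in P x.
         real_cond_exp (P x) (natural_filtration TT Om V s)
           (indicator {\<omega>' \<in> space Om. V (s + t) \<omega>' \<in> A}) \<omega>
         = measure (P (V s \<omega>)) {\<omega>' \<in> space Om. V t \<omega>' \<in> A}"
    and right_continuous:
      "TT = {0..} \<Longrightarrow> \<omega> \<in> space Om \<Longrightarrow> t \<in> TT \<Longrightarrow> continuous (at_right t) (\<lambda>s. V s \<omega>)"
    and borel_S: "TT = {0..} \<Longrightarrow> S \<in> sets borel"
    and density_nonneg: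
      "TT = {0..} \<Longrightarrow> 0 < t \<Longrightarrow> x \<in> S \<Longrightarrow> y \<in> S \<Longrightarrow> 0 \<le> p t y x"
    and density_measurable:
      "TT = {0..} \<Longrightarrow> 0 < t \<Longrightarrow>
       (\<lambda>(y, x). p t y x) \<in> borel_measurable (restrict_space borel S \<Otimes>\<^sub>M restrict_space borel S)"
    and transition_density:
      "TT = {0..} \<Longrightarrow> 0 < t \<Longrightarrow> x \<in> S \<Longrightarrow>
       distributed (P x) (restrict_space lborel S) (V t) (\<lambda>y. ennreal (p t y x))"
    and countable_S: "TT = \<nat> \<Longrightarrow> countable S"
    and transition_probability:
      "TT = \<nat> \<Longrightarrow> t \<in> TT \<Longrightarrow> x \<in> S \<Longrightarrow> y \<in> S \<Longrightarrow>
       p t y x = measure (P x) {\<omega> \<in> space Om. V t \<omega> = y}"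

text \<open>Sample point \<open>\<omega>\<close> of the product; the \<open>j\<close>-th copy of the process is \<open>\<lambda>t. V t (\<omega> j)\<close>.\<close>

definition indep_copies :: "(real \<Rightarrow> 'w measure) \<Rightarrow> nat \<Rightarrow> (nat \<Rightarrow> real) \<Rightarrow> (nat \<Rightarrow> 'w) measure" where
  "indep_copies P N u = (\<Pi>\<^sub>M j\<in>{1..N}. P (u j))"


section \<open>Configurations, determinants and Fredholm determinants\<close>

definition weyl :: "real set \<Rightarrow> nat \<Rightarrow> (nat \<Rightarrow> real) set" where
  "weyl S n = {x \<in> {1..n} \<rightarrow>\<^sub>E S. strict_mono_on {1..n} x}"

text \<open>The measure \<open>\<Sum>j. \<delta>(u j)\<close>, as push-forward of counting measure.  It is defined on all subsets of
  \<open>S\<close>, so that every function on \<open>S\<close> can be integrated.\<close>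

definition config :: "real set \<Rightarrow> nat \<Rightarrow> (nat \<Rightarrow> real) \<Rightarrow> real measure" where
  "config S N u = distr (count_space {1..N}) (count_space S) u"

text \<open>The library determinant is indexed by a finite type; this is the same Leibniz formula over a
  finite index set (for block matrices, a set of pairs).\<close>

definition det_on :: "'i set \<Rightarrow> ('i \<Rightarrow> 'i \<Rightarrow> real) \<Rightarrow> real" where
  "det_on I A = (\<Sum>\<sigma> | \<sigma> permutes I. of_int (sign \<sigma>) * (\<Prod>i\<in>I. A i (\<sigma> i)))"

definition linearly_independent_family :: "'i set \<Rightarrow> ('i \<Rightarrow> real \<Rightarrow> real) \<Rightarrow> bool" where
  "linearly_independent_family I f \<longleftrightarrow>
     (\<forall>c. (\<forall>x. (\<Sum>i\<in>I. c i * f i x) = 0) \<longrightarrow> (\<forall>i\<in>I. c i = 0))"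

text \<open>
  \<open>fredholm_det \<mu> S M t \<phi> K\<close> is the Fredholm determinant of \<open>\<delta>\<^sub>s\<^sub>t \<delta>\<^sub>x(y) + K(s,x;t,y) \<phi>\<^sub>t(y)\<close> over the
  times \<open>t 1, \<dots>, t M\<close>.  The sum is over all \<open>n = (N\<^sub>1, \<dots>, N\<^sub>M)\<close>, and \<open>x m j\<close> is the \<open>j\<close>-th variable
  belonging to the time \<open>t m\<close>; the test function at time \<open>t m\<close> is \<open>\<phi> (t m)\<close>.
\<close>

definition fredholm_det ::
  "real measure \<Rightarrow> real set \<Rightarrow> nat \<Rightarrow> (nat \<Rightarrow> real) \<Rightarrow> (real \<Rightarrow> real \<Rightarrow> real) \<Rightarrow>
   (real \<Rightarrow> real \<Rightarrow> real \<Rightarrow> real \<Rightarrow> real) \<Rightarrow> real" where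
  "fredholm_det \<mu> S M t \<phi> K =
     (\<Sum>\<^sub>\<infinity>n\<in>({1..M} \<rightarrow>\<^sub>E UNIV).
        set_lebesgue_integral
          (\<Pi>\<^sub>M m\<in>{1..M}. \<Pi>\<^sub>M j\<in>{1..n m}. \<mu>)
          (\<Pi>\<^sub>E m\<in>{1..M}. weyl S (n m))
          (\<lambda>x. (\<Prod>m\<in>{1..M}. \<Prod>j\<in>{1..n m}. \<phi> (t m) (x m j)) *
             det_on (SIGMA m:{1..M}. {1..n m})
               (\<lambda>(m, j) (m', k). K (t m) (x m j) (t m') (x m' k))))"

definition corr_kernel ::
  "(real \<Rightarrow> real \<Rightarrow> real \<Rightarrow> real) \<Rightarrow> real measure \<Rightarrow> (complex \<Rightarrow> real \<Rightarrow> real \<Rightarrow> real) \<Rightarrow>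
   real \<Rightarrow> real \<Rightarrow> real \<Rightarrow> real \<Rightarrow> real" where
  "corr_kernel p \<xi> \<M> s x t y =
     (\<integral>v. p s x v * \<M> (complex_of_real v) t y \<partial>\<xi>) - of_bool (s > t) * p (s - t) x y"

end

theory Submission
  imports Defs
begin

text \<open>
  Bordering the kernel matrix with rows and columns for the starting points \<open>u k\<close> turns the finite-rank
  part of the kernel into a Schur complement.  Expanding the bordered determinant along the points in
  the order of time yields a pointwise identity: \<open>det K\<close> is the sum, over all ways \<open>\<kappa>\<close> of distributing the
  points among the \<open>N\<close> particles, of the product of transition densities along the paths so obtained times
  the determinant of the \<open>\<M>\<close> evaluated at the end points of the paths.  By the Markov property that
  product is the joint density of the observed positions, and by the martingale property the
  determinant at the end points is a conditional expectation of the determinant at time \<open>T\<close>.  This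
  step treats the determinant as a whole, because the test functions times its individual Leibniz
  terms need not be integrable.
  As \<open>det K\<close> is symmetric in, and vanishes on coincidences of, variables of equal time, Weyl chambers can be
  replaced by full products of the state space, and collecting the \<open>\<kappa>\<close> that visit the same particles
  at the same times gives the expansion of \<open>\<Prod>(1 + \<phi>)\<close>.
\<close>

subsection \<open>Determinants over finite index sets\<close>

text \<open>Condition (iii) makes the block of starting points an identity matrix, so the Schur
  complement involves no inverse. The densities in the kernel join strictly earlier to later times.
  Hence the row of the earliest remaining point meets only the N border columns, and expanding along
  it moves the column of that point into one of them. The number of a border column is a particle
  and its content the particle's current position; this is how paths arise from a determinant. The
  probabilistic obstacle is that different paths end at different times, so no single member of the
  filtration separates past from future. Conditioning is therefore done on a product of
  sigma-algebras, one time for each particle. There the determinant at \<open>T\<close> has the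
  determinant at the path ends as its conditional expectation, and the product of test functions is
  pulled out as one factor that need not be integrable by itself: only its product with the
  determinant at \<open>T\<close> must be. The assumption with \<open>1 + \<bar>\<phi>\<bar>\<close>
  provides this for every set of visited pairs at once.\<close>

lemma det_on_cong:
  assumes "\<And>i j. i \<in> I \<Longrightarrow> j \<in> I \<Longrightarrow> A i j = B i j"
  shows "det_on I A = det_on I B"
  unfolding det_on_def
  by (intro sum.cong refl arg_cong2[where f="(*)"] prod.cong)
    (auto intro!: assms simp: permutes_in_image)

lemma det_on_empty [simp]: "det_on {} A = 1"
proof -
  have "{\<sigma>. \<sigma> permutes ({} :: 'a set)} = {id}" by auto
  then show ?thesis by (simp add: det_on_def)
qed

text \<open>Laplace expansion along row \<open>a\<close>, with column \<open>a\<close> put in the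
  place of the removed column \<open>b\<close>. The minors keep the index set \<open>I\<close>, and
  all off-diagonal terms carry the same sign, that of one transposition.\<close>

lemma det_on_insert:
  assumes "finite I" "a \<notin> I"
  shows "det_on (insert a I) A =
    A a a * det_on I A - (\<Sum>b\<in>I. A a b * det_on I (\<lambda>i j. A i (if j = b then a else j)))"
proof -
  \<comment> \<open>Each permutation of \<open>insert a I\<close> is in a unique way a permutation
    \<open>q\<close> of \<open>I\<close> followed by the transposition of \<open>a\<close> and
    \<open>b\<close>, where \<open>b\<close> is the image of \<open>a\<close>. The Leibniz sum is
    grouped by this \<open>b\<close>.\<close>
  have term_b: "(\<Sum>q | q permutes I. of_int (sign (Transposition.transpose a b \<circ> q)) *
        (\<Prod>i\<in>insert a I. A i ((Transposition.transpose a b \<circ> q) i))) =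
      (if b = a then A a a * det_on I A
       else - (A a b * det_on I (\<lambda>i j. A i (if j = b then a else j))))"
    if "b \<in> insert a I" for b
  proof -
    have *: "of_int (sign (Transposition.transpose a b \<circ> q)) *
        (\<Prod>i\<in>insert a I. A i ((Transposition.transpose a b \<circ> q) i)) =
        (if b = a then 1 else -1) * A a b *
        (of_int (sign q) * (\<Prod>i\<in>I. A i (if q i = b then a else q i)))"
      if q: "q permutes I" for q
    proof -
      have qa: "q a = a" using q assms(2) by (simp add: permutes_not_in)
      have "permutation q" using q assms(1) permutation_permutes by blast
      then have s: "sign (Transposition.transpose a b \<circ> q) = (if b = a then 1 else -1) * sign q"
        by (subst sign_compose) (auto simp: sign_swap_id permutation_swap_id)
      have "A i (Transposition.transpose a b (q i)) = A i (if q i = b then a else q i)" if "i \<in> I" for i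
        using permutes_in_image[OF q, of i] assms(2) that by (auto simp: Transposition.transpose_def)
      then have "(\<Prod>i\<in>I. A i (Transposition.transpose a b (q i))) = (\<Prod>i\<in>I. A i (if q i = b then a else q i))"
        by (intro prod.cong) auto
      then show ?thesis
        using assms qa s by (simp add: algebra_simps)
    qed
    have "(\<Sum>q | q permutes I. of_int (sign (Transposition.transpose a b \<circ> q)) *
        (\<Prod>i\<in>insert a I. A i ((Transposition.transpose a b \<circ> q) i))) =
        (if b = a then 1 else -1) * A a b * det_on I (\<lambda>i j. A i (if j = b then a else j))"
      unfolding det_on_def sum_distrib_left by (intro sum.cong refl, subst *) (auto simp: algebra_simps)
    moreover have "det_on I (\<lambda>i j. A i (if j = a then a else j)) = det_on I A"
      by (rule det_on_cong) auto
    ultimately show ?thesis by auto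
  qed
  have "det_on (insert a I) A = (\<Sum>b\<in>insert a I. if b = a then A a a * det_on I A
       else - (A a b * det_on I (\<lambda>i j. A i (if j = b then a else j))))"
    unfolding det_on_def[of "insert a I"] sum_over_permutations_insert[OF assms]
    by (intro sum.cong refl term_b)
  also have "\<dots> = A a a * det_on I A +
      (\<Sum>b\<in>I. - (A a b * det_on I (\<lambda>i j. A i (if j = b then a else j))))"
    by (subst sum.insert[OF assms]) (use assms(2) in \<open>auto intro!: sum.cong arg_cong2[where f="(+)"]\<close>)
  finally show ?thesis unfolding sum_negf by simp
qed

text \<open>Induction through the expansion along a new row avoids conjugating permutations by
  \<open>f\<close>. The matrix stays arbitrary because the minors have a column replaced.\<close>

lemma det_on_reindex:
  assumes "finite I" "inj_on f I"
  shows "det_on (f ` I) A = det_on I (\<lambda>i j. A (f i) (f j))"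
  using assms
proof (induction I arbitrary: A rule: finite_induct)
  case (insert a I)
  have inj: "inj_on f I" and na: "f a \<notin> f ` I"
    using insert.prems insert.hyps by (auto simp: inj_on_def)
  have "det_on (f ` insert a I) A = A (f a) (f a) * det_on (f ` I) A -
      (\<Sum>b\<in>f ` I. A (f a) b * det_on (f ` I) (\<lambda>i j. A i (if j = b then f a else j)))"
    using insert.hyps na by (simp add: det_on_insert)
  also have "\<dots> = A (f a) (f a) * det_on I (\<lambda>i j. A (f i) (f j)) -
      (\<Sum>b\<in>I. A (f a) (f b) * det_on I (\<lambda>i j. A (f i) (if f j = f b then f a else f j)))"
    using inj insert.IH[OF inj] by (simp add: sum.reindex)
  also have "(\<Sum>b\<in>I. A (f a) (f b) * det_on I (\<lambda>i j. A (f i) (if f j = f b then f a else f j))) =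
      (\<Sum>b\<in>I. A (f a) (f b) * det_on I (\<lambda>i j. A (f i) (f (if j = b then a else j))))"
    using inj by (intro sum.cong refl arg_cong2[where f="(*)"] det_on_cong) (auto simp: inj_on_def)
  finally show ?case
    using insert.hyps by (simp add: det_on_insert)
qed simp

lemma det_on_transpose:
  assumes "finite I"
  shows "det_on I (\<lambda>i j. A j i) = det_on I A"
proof -
  have "det_on I (\<lambda>i j. A j i) =
      (\<Sum>\<sigma> | \<sigma> permutes I. of_int (sign (inv \<sigma>)) * (\<Prod>i\<in>I. A (inv \<sigma> i) i))"
    unfolding det_on_def by (rule sum_permutations_inverse)
  also have "\<dots> = det_on I A"
    unfolding det_on_def
  proof (intro sum.cong refl)
    fix \<sigma> assume "\<sigma> \<in> {\<sigma>. \<sigma> permutes I}"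
    then have \<sigma>: "\<sigma> permutes I" by simp
    have "(\<Prod>i\<in>I. A (inv \<sigma> i) i) = (\<Prod>i\<in>I. A (inv \<sigma> (\<sigma> i)) (\<sigma> i))"
      by (rule prod.reindex_bij_betw[symmetric]) (rule permutes_imp_bij[OF \<sigma>])
    then show "of_int (sign (inv \<sigma>)) * (\<Prod>i\<in>I. A (inv \<sigma> i) i) =
        real_of_int (sign \<sigma>) * (\<Prod>i\<in>I. A i (\<sigma> i))"
      using \<sigma> assms sign_inverse[of \<sigma>] permutation_permutes[of \<sigma>]
      by (auto simp: permutes_inverses)
  qed
  finally show ?thesis .
qed

text \<open>Composing with the transposition of the two columns reverses every sign and changes no
  product, so the determinant equals its own negative.\<close>

lemma det_on_identical_columns:
  assumes "finite I" "a \<in> I" "b \<in> I" "a \<noteq> b" "\<And>i. i \<in> I \<Longrightarrow> A i a = A i b"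
  shows "det_on I A = 0"
proof -
  let ?s = "Transposition.transpose a b"
  have s: "?s permutes I" using assms(2,3) by (simp add: permutes_swap_id)
  have "det_on I A = (\<Sum>\<sigma> | \<sigma> permutes I. of_int (sign (?s \<circ> \<sigma>)) * (\<Prod>i\<in>I. A i ((?s \<circ> \<sigma>) i)))"
    unfolding det_on_def 
    by (rule setum_permutations_compose_left[OF s])
  also have "\<dots> = - det_on I A"
    unfolding det_on_def sum_negf[symmetric]
  proof (intro sum.cong refl)
    fix \<sigma> assume "\<sigma> \<in> {\<sigma>. \<sigma> permutes I}"
    then have \<sigma>: "\<sigma> permutes I" by simp
    then have "sign (?s \<circ> \<sigma>) = - sign \<sigma>"
      using assms(1,4) permutation_permutes[of \<sigma>]
      by (subst sign_compose) (auto simp: sign_swap_id permutation_swap_id)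
    moreover have "(\<Prod>i\<in>I. A i ((?s \<circ> \<sigma>) i)) = (\<Prod>i\<in>I. A i (\<sigma> i))"
      using assms by (intro prod.cong) (auto simp: Transposition.transpose_def)
    ultimately show "real_of_int (sign (?s \<circ> \<sigma>)) * (\<Prod>i\<in>I. A i ((?s \<circ> \<sigma>) i)) =
        - (of_int (sign \<sigma>) * (\<Prod>i\<in>I. A i (\<sigma> i)))"
      by simp
  qed
  finally show ?thesis by simp
qed

lemma det_on_identical_rows:
  assumes "finite I" "a \<in> I" "b \<in> I" "a \<noteq> b" "\<And>i. i \<in> I \<Longrightarrow> A a i = A b i"
  shows "det_on I A = 0"
  using det_on_identical_columns[of I a b "\<lambda>i j. A j i"] assms det_on_transpose[of I A] by simp

section \<open>Elimination and the Schur complement\<close>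

lemma det_on_row_add:
  assumes "finite I" "a \<in> I" "b \<in> I" "a \<noteq> b"
  shows "det_on I (\<lambda>i j. if i = a then A a j + c * A b j else A i j) = det_on I A"
proof -
  have split: "(\<Prod>i\<in>I. g i) = g a * (\<Prod>i\<in>I-{a}. g i)" for g :: "_ \<Rightarrow> real"
    using assms by (simp add: prod.remove)
  have "det_on I (\<lambda>i j. if i = a then A a j + c * A b j else A i j) =
      det_on I A + c * det_on I (\<lambda>i j. if i = a then A b j else A i j)"
    unfolding det_on_def sum_distrib_left sum.distrib[symmetric] split
    by (intro sum.cong refl) (simp add: algebra_simps cong: prod.cong_simp)
  also have "det_on I (\<lambda>i j. if i = a then A b j else A i j) = 0"
    using assms by (intro det_on_identical_rows[of I a b]) auto
  finally show ?thesis by simp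
qed

lemma det_on_zero_column:
  assumes "finite I" "b \<in> I" "\<And>i. i \<in> I \<Longrightarrow> A i b = 0"
  shows "det_on I A = 0"
  unfolding det_on_def
proof (intro sum.neutral ballI)
  fix \<sigma> assume "\<sigma> \<in> {\<sigma>. \<sigma> permutes I}"
  then have \<sigma>: "\<sigma> permutes I" by simp
  then obtain i where "i \<in> I" "\<sigma> i = b" using assms(2) by (metis permutes_image imageE)
  then have "(\<Prod>i\<in>I. A i (\<sigma> i)) = 0" using assms by (intro prod_zero) auto
  then show "of_int (sign \<sigma>) * (\<Prod>i\<in>I. A i (\<sigma> i)) = 0" by simp
qed

text \<open>One pivot of Gaussian elimination. Once column \<open>k\<close> is cleared outside row
  \<open>k\<close>, each off-diagonal term in the expansion of that row contains the cleared column,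
  so only the pivot term survives.\<close>

lemma det_on_eliminate:
  assumes "finite J" "k \<notin> J" "A k k = 1"
  shows "det_on (insert k J) A = det_on J (\<lambda>i j. A i j - A i k * A k j)"
proof -
  \<comment> \<open>The rows are cleared one at a time; \<open>R\<close> is the set of rows already
    treated, and row \<open>k\<close> is never among them.\<close>
  have elim: "det_on (insert k J) (\<lambda>i j. if i \<in> R then A i j - A i k * A k j else A i j) =
      det_on (insert k J) A" if "R \<subseteq> J" for R
    using finite_subset[OF that assms(1)] that
  proof (induction R rule: finite_induct)
    case (insert a R)
    let ?B = "\<lambda>i j. if i \<in> R then A i j - A i k * A k j else A i j"
    have k: "k \<notin> R" "a \<noteq> k" using insert.prems assms(2) by auto
    have "det_on (insert k J) (\<lambda>i j. if i \<in> insert a R then A i j - A i k * A k j else A i j) =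
        det_on (insert k J) (\<lambda>i j. if i = a then ?B a j + (- A a k) * ?B k j else ?B i j)"
      using insert.hyps k by (intro det_on_cong) auto
    also have "\<dots> = det_on (insert k J) ?B"
      using insert.prems assms k by (intro det_on_row_add) auto
    finally show ?case using insert by simp
  qed simp
  let ?B = "\<lambda>i j. if i \<in> J then A i j - A i k * A k j else A i j"
  have "det_on (insert k J) A = det_on (insert k J) ?B" using elim[of J] by simp
  also have "\<dots> = det_on J ?B -
      (\<Sum>b\<in>J. ?B k b * det_on J (\<lambda>i j. ?B i (if j = b then k else j)))"
    using assms by (simp add: det_on_insert)
  also have "(\<Sum>b\<in>J. ?B k b * det_on J (\<lambda>i j. ?B i (if j = b then k else j))) = 0"
  proof (intro sum.neutral ballI)
    fix b assume "b \<in> J"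
    then have "det_on J (\<lambda>i j. ?B i (if j = b then k else j)) = 0"
      using assms by (intro det_on_zero_column[of J b]) auto
    then show "?B k b * det_on J (\<lambda>i j. ?B i (if j = b then k else j)) = 0" by simp
  qed
  also have "det_on J ?B - 0 = det_on J (\<lambda>i j. A i j - A i k * A k j)"
    by (simp, intro det_on_cong) auto
  finally show ?thesis .
qed

text \<open>Pivoting on the members of \<open>K\<close> in turn. The rest of the identity block
  survives each pivot, since the correction there contains an off-diagonal entry of the block; for
  the same reason the corrections to the sum over \<open>K\<close> vanish.\<close>

lemma det_on_schur:
  assumes "finite K" "finite J" "K \<inter> J = {}"
    and "\<And>k k'. k \<in> K \<Longrightarrow> k' \<in> K \<Longrightarrow> A k k' = (if k = k' then 1 else 0)"
  shows "det_on (K \<union> J) A = det_on J (\<lambda>i j. A i j - (\<Sum>k\<in>K. A i k * A k j))"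
  using assms(1,3,4)
proof (induction K arbitrary: A rule: finite_induct)
  case (insert k K)
  let ?B = "\<lambda>i j. A i j - A i k * A k j"
  have nk: "k' \<in> K \<Longrightarrow> k' \<noteq> k" for k' using insert.hyps by auto
  have "det_on (insert k K \<union> J) A = det_on (K \<union> J) ?B"
    using insert.hyps insert.prems assms(2) by (simp add: det_on_eliminate)
  also have "\<dots> = det_on J (\<lambda>i j. ?B i j - (\<Sum>k\<in>K. ?B i k * ?B k j))"
    using insert.prems insert.hyps nk by (intro insert.IH) auto
  also have "\<dots> = det_on J (\<lambda>i j. A i j - (\<Sum>k'\<in>insert k K. A i k' * A k' j))"
  proof (intro det_on_cong)
    fix i j
    have "(\<Sum>k'\<in>K. ?B i k' * ?B k' j) = (\<Sum>k'\<in>K. A i k' * A k' j)"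
      using insert.prems(2) nk by (intro sum.cong) auto
    then show "?B i j - (\<Sum>k\<in>K. ?B i k * ?B k j) = A i j - (\<Sum>k'\<in>insert k K. A i k' * A k' j)"
      using insert.hyps by simp
  qed
  finally show ?case .
qed simp

subsection \<open>Path expansion of the determinant of the correlation kernel\<close>

text \<open>
  Points are pairs \<open>(m, j)\<close>: the \<open>j\<close>-th variable at time \<open>t m\<close>; \<open>(0, k)\<close> stands for the \<open>k\<close>-th
  starting point.  A map \<open>\<kappa>\<close> assigns points to particles, and the lists of points are in decreasing
  order of time, so that \<open>path_end \<kappa> ys k\<close> is the last point visited by the \<open>k\<close>-th particle.
\<close>

primrec path_end :: "(nat \<times> nat \<Rightarrow> nat) \<Rightarrow> (nat \<times> nat) list \<Rightarrow> nat \<Rightarrow> nat \<times> nat" where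
  "path_end \<kappa> [] = (\<lambda>k. (0, k))"
| "path_end \<kappa> (a # ys) = (path_end \<kappa> ys)(\<kappa> a := a)"

primrec path_weight ::
  "(nat \<times> nat \<Rightarrow> nat \<times> nat \<Rightarrow> real) \<Rightarrow> (nat \<times> nat \<Rightarrow> nat) \<Rightarrow> (nat \<times> nat) list \<Rightarrow> real" where
  "path_weight L \<kappa> [] = 1"
| "path_weight L \<kappa> (a # ys) = path_weight L \<kappa> ys * L a (path_end \<kappa> ys (\<kappa> a))"

section \<open>Paths and their weights\<close>

lemma path_end_cong:
  "(\<And>a. a \<in> set ys \<Longrightarrow> \<kappa> a = \<kappa>' a) \<Longrightarrow> path_end \<kappa> ys = path_end \<kappa>' ys"
  by (induction ys) auto

lemma path_weight_cong:
  "(\<And>a. a \<in> set ys \<Longrightarrow> \<kappa> a = \<kappa>' a) \<Longrightarrow> path_weight L \<kappa> ys = path_weight L \<kappa>' ys"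
  by (induction ys) (auto cong: path_end_cong)

lemma path_end_cases: "path_end \<kappa> ys k = (0, k) \<or> path_end \<kappa> ys k \<in> set ys \<and> \<kappa> (path_end \<kappa> ys k) = k"
  by (induction ys) auto

text \<open>The list is read from its tail, the earliest point, so each overwriting of a particle's
  slot can only move it to the same or a later time.\<close>

lemma path_end_latest:
  "sorted_wrt (\<lambda>a b. fst b \<le> fst a) ys \<Longrightarrow> a \<in> set ys \<Longrightarrow> fst a \<le> fst (path_end \<kappa> ys (\<kappa> a))"
  by (induction ys) force+

text \<open>A particle cannot visit two points of one level: when the second is added, the last
  point of the particle already has that level or a later one, and such a link is 0.\<close>

lemma path_weight_eq_0:
  assumes "sorted_wrt (\<lambda>a b. fst b \<le> fst a) ys" "distinct ys"
    and "\<And>a b. fst a \<le> fst b \<Longrightarrow> L a b = 0"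
    and "a \<in> set ys" "b \<in> set ys" "a \<noteq> b" "fst a = fst b" "\<kappa> a = \<kappa> b"
  shows "path_weight L \<kappa> ys = 0"
  using assms(1,2,4-)
proof (induction ys arbitrary: a b)
  case (Cons c ys)
  have *: "path_weight L \<kappa> (c # ys) = 0" if "d \<in> set ys" "fst c = fst d" "\<kappa> c = \<kappa> d" for d
    using path_end_latest[of ys d \<kappa>] Cons.prems(1) that assms(3)[of c "path_end \<kappa> ys (\<kappa> c)"] by simp
  show ?case
  proof (cases "a = c \<or> b = c")
    case True
    then show ?thesis using *[of a] *[of b] Cons.prems by auto
  next
    case False
    then show ?thesis using Cons.IH[of a b] Cons.prems by auto
  qed
qed simp

section \<open>Expansion of the bordered determinant\<close>

lemma sum_PiE_insert:
  assumes "a \<notin> A"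
  shows "(\<Sum>\<kappa>\<in>insert a A \<rightarrow>\<^sub>E B. f \<kappa>) = (\<Sum>\<kappa>\<in>A \<rightarrow>\<^sub>E B. \<Sum>k\<in>B. f (\<kappa>(a := k)))"
proof -
  have "(\<Sum>\<kappa>\<in>insert a A \<rightarrow>\<^sub>E B. f \<kappa>) = (\<Sum>(k, \<kappa>)\<in>B \<times> (A \<rightarrow>\<^sub>E B). f (\<kappa>(a := k)))"
    unfolding PiE_insert_eq
    by (subst sum.reindex) (use inj_combinator[OF assms] in \<open>auto simp: case_prod_unfold\<close>)
  also have "\<dots> = (\<Sum>k\<in>B. \<Sum>\<kappa>\<in>A \<rightarrow>\<^sub>E B. f (\<kappa>(a := k)))"
    by (simp add: sum.cartesian_product)
  also have "\<dots> = (\<Sum>\<kappa>\<in>A \<rightarrow>\<^sub>E B. \<Sum>k\<in>B. f (\<kappa>(a := k)))"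
    by (rule sum.swap)
  finally show ?thesis .
qed

text \<open>\<open>e k\<close> is the point sitting in column \<open>(0, k)\<close>.\<close>

definition bordered ::
  "(nat \<Rightarrow> nat \<times> nat \<Rightarrow> real) \<Rightarrow> (nat \<times> nat \<Rightarrow> nat \<times> nat \<Rightarrow> real) \<Rightarrow> (nat \<Rightarrow> nat \<times> nat) \<Rightarrow>
   nat \<times> nat \<Rightarrow> nat \<times> nat \<Rightarrow> real" where
  "bordered C L e i j =
     (let c = if fst j = 0 then e (snd j) else j in if fst i = 0 then C (snd i) c else - L i c)"

text \<open>Row \<open>a\<close> vanishes on the columns of \<open>U\<close>, so only border columns
  contribute. Putting column \<open>a\<close> into column \<open>(0, k)\<close> means that particle
  \<open>k\<close> moves on to \<open>a\<close>. The minus sign of the column exchange cancels the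
  one in \<open>- L\<close>.\<close>

lemma det_on_bordered_step:
  assumes "finite U" "a \<notin> U" "\<And>b. b \<in> insert a U \<Longrightarrow> 0 < fst b \<and> L a b = 0"
  shows "det_on ({0} \<times> {1..N} \<union> insert a U) (bordered C L e) =
    (\<Sum>k\<in>{1..N}. L a (e k) * det_on ({0} \<times> {1..N} \<union> U) (bordered C L (e(k := a))))"
proof -
  let ?K = "{0} \<times> {1..N}" and ?B = "bordered C L e"
  have a: "0 < fst a" "L a a = 0" "a \<notin> ?K \<union> U" using assms(2) assms(3)[of a] by (auto simp: mem_Times_iff)
  have disj: "?K \<inter> U = {}" using assms(3) by (fastforce simp: mem_Times_iff)
  have "det_on (?K \<union> insert a U) ?B =
      - (\<Sum>b\<in>?K \<union> U. ?B a b * det_on (?K \<union> U) (\<lambda>i j. ?B i (if j = b then a else j)))"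
    using det_on_insert[of "?K \<union> U" a ?B] assms(1) a by (simp add: bordered_def)
  also have "(\<Sum>b\<in>?K \<union> U. ?B a b * det_on (?K \<union> U) (\<lambda>i j. ?B i (if j = b then a else j))) =
      (\<Sum>b\<in>?K. ?B a b * det_on (?K \<union> U) (\<lambda>i j. ?B i (if j = b then a else j)))"
  proof (rule sum.mono_neutral_right)
    show "\<forall>b\<in>?K \<union> U - ?K. ?B a b * det_on (?K \<union> U) (\<lambda>i j. ?B i (if j = b then a else j)) = 0"
    proof
      fix b assume "b \<in> ?K \<union> U - ?K"
      then have "0 < fst b" "L a b = 0" using assms(3)[of b] by auto
      then have "?B a b = 0" using a(1) by (simp add: bordered_def)
      then show "?B a b * det_on (?K \<union> U) (\<lambda>i j. ?B i (if j = b then a else j)) = 0" by simp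
    qed
  qed (use assms(1) in auto)
  also have "\<dots> = (\<Sum>k\<in>{1..N}. ?B a (0, k) *
      det_on (?K \<union> U) (\<lambda>i j. ?B i (if j = (0, k) then a else j)))"
    by (rule sum.reindex_bij_witness[of _ "Pair 0" snd]) auto
  also have "\<dots> = (\<Sum>k\<in>{1..N}. - (L a (e k) * det_on (?K \<union> U) (bordered C L (e(k := a)))))"
  proof (intro sum.cong refl)
    fix k assume "k \<in> {1..N}"
    have "det_on (?K \<union> U) (\<lambda>i j. ?B i (if j = (0, k) then a else j)) =
        det_on (?K \<union> U) (bordered C L (e(k := a)))"
      using a by (intro det_on_cong) (auto simp: bordered_def Let_def prod_eq_iff)
    then show "?B a (0, k) * det_on (?K \<union> U) (\<lambda>i j. ?B i (if j = (0, k) then a else j)) =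
        - (L a (e k) * det_on (?K \<union> U) (bordered C L (e(k := a))))"
      using a by (simp add: bordered_def)
  qed
  finally show ?thesis by (simp add: sum_negf)
qed

text \<open>\<open>U\<close> holds the points that are not yet expanded. For \<open>a # ys\<close>
  the induction hypothesis is used with \<open>insert a U\<close>, which expands all of
  \<open>ys\<close> before \<open>a\<close>; so the expansion runs from the tail of the list to its
  head, in agreement with the recursion of \<open>path_end\<close>.\<close>

lemma det_on_bordered_paths:
  assumes "distinct ys" "finite U" "set ys \<inter> U = {}"
    and "sorted_wrt (\<lambda>a b. L b a = 0) ys"
    and "\<And>a b. a \<in> set ys \<Longrightarrow> b \<in> U \<Longrightarrow> L a b = 0"
    and "\<And>a. a \<in> set ys \<union> U \<Longrightarrow> 0 < fst a \<and> L a a = 0"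
  shows "det_on ({0} \<times> {1..N} \<union> (set ys \<union> U)) (bordered C L (Pair 0)) =
    (\<Sum>\<kappa>\<in>set ys \<rightarrow>\<^sub>E {1..N}. path_weight L \<kappa> ys *
       det_on ({0} \<times> {1..N} \<union> U) (bordered C L (path_end \<kappa> ys)))"
  using assms
proof (induction ys arbitrary: U)
  case (Cons a ys)
  let ?D = "\<lambda>e. det_on ({0} \<times> {1..N} \<union> U) (bordered C L e)"
  have "det_on ({0} \<times> {1..N} \<union> (set (a # ys) \<union> U)) (bordered C L (Pair 0)) =
      det_on ({0} \<times> {1..N} \<union> (set ys \<union> insert a U)) (bordered C L (Pair 0))"
    by simp
  also have "\<dots> = (\<Sum>\<kappa>\<in>set ys \<rightarrow>\<^sub>E {1..N}. path_weight L \<kappa> ys *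
       det_on ({0} \<times> {1..N} \<union> insert a U) (bordered C L (path_end \<kappa> ys)))"
    using Cons.prems by (intro Cons.IH) auto
  also have "\<dots> = (\<Sum>\<kappa>\<in>set ys \<rightarrow>\<^sub>E {1..N}. path_weight L \<kappa> ys *
       (\<Sum>k\<in>{1..N}. L a (path_end \<kappa> ys k) * ?D ((path_end \<kappa> ys)(k := a))))"
  proof (intro sum.cong refl arg_cong2[where f="(*)"] det_on_bordered_step)
    show "0 < fst b \<and> L a b = 0" if "b \<in> insert a U" for b
      using that Cons.prems(5)[of a b] Cons.prems(6)[of b] by auto
  qed (use Cons.prems in auto)
  also have "\<dots> = (\<Sum>\<kappa>\<in>set ys \<rightarrow>\<^sub>E {1..N}. \<Sum>k\<in>{1..N}. path_weight L (\<kappa>(a := k)) (a # ys) *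
       ?D (path_end (\<kappa>(a := k)) (a # ys)))"
  proof (intro sum.cong refl)
    fix \<kappa> :: "nat \<times> nat \<Rightarrow> nat"
    have *: "path_end (\<kappa>(a := k)) ys = path_end \<kappa> ys"
        "path_weight L (\<kappa>(a := k)) ys = path_weight L \<kappa> ys" for k
      using Cons.prems(1) by (auto intro!: path_end_cong path_weight_cong)
    show "path_weight L \<kappa> ys *
       (\<Sum>k\<in>{1..N}. L a (path_end \<kappa> ys k) * ?D ((path_end \<kappa> ys)(k := a))) =
       (\<Sum>k\<in>{1..N}. path_weight L (\<kappa>(a := k)) (a # ys) * ?D (path_end (\<kappa>(a := k)) (a # ys)))"
      by (simp add: * sum_distrib_left mult.assoc)
  qed
  also have "\<dots> = (\<Sum>\<kappa>\<in>set (a # ys) \<rightarrow>\<^sub>E {1..N}. path_weight L \<kappa> (a # ys) * ?D (path_end \<kappa> (a # ys)))"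
    using Cons.prems(1) by (simp add: sum_PiE_insert)
  finally show ?case .
qed simp

text \<open>The left-hand matrix is the Schur complement of the identity block in the bordered
  matrix, which is why the lower rows carry \<open>- L\<close>. When all points have been expanded
  only the border remains, its columns evaluated at the ends of the paths.\<close>

proposition det_on_paths:
  assumes "distinct ys" "sorted_wrt (\<lambda>a b. fst b \<le> fst a) ys" "\<And>a. a \<in> set ys \<Longrightarrow> 0 < fst a"
    and L: "\<And>a b. fst a \<le> fst b \<Longrightarrow> L a b = 0"
    and C: "\<And>k k'. k \<in> {1..N} \<Longrightarrow> k' \<in> {1..N} \<Longrightarrow> C k (0, k') = (if k = k' then 1 else 0)"
  shows "det_on (set ys) (\<lambda>i j. (\<Sum>k\<in>{1..N}. L i (0, k) * C k j) - L i j) =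
    (\<Sum>\<kappa>\<in>set ys \<rightarrow>\<^sub>E {1..N}. path_weight L \<kappa> ys * det_on {1..N} (\<lambda>j k. C k (path_end \<kappa> ys j)))"
proof -
  let ?K = "{0 :: nat} \<times> {1..N}" and ?B = "bordered C L (Pair 0)"
  have "det_on (set ys) (\<lambda>i j. (\<Sum>k\<in>{1..N}. L i (0, k) * C k j) - L i j) =
      det_on (set ys) (\<lambda>i j. ?B i j - (\<Sum>k\<in>?K. ?B i k * ?B k j))"
  proof (rule det_on_cong)
    fix i j assume "i \<in> set ys" "j \<in> set ys"
    then have "0 < fst i" "0 < fst j" using assms(3) by auto
    moreover have "(\<Sum>k\<in>?K. ?B i k * ?B k j) = (\<Sum>k\<in>{1..N}. ?B i (0, k) * ?B (0, k) j)"
      by (rule sum.reindex_bij_witness[of _ "Pair 0" snd]) auto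
    ultimately show "(\<Sum>k\<in>{1..N}. L i (0, k) * C k j) - L i j = ?B i j - (\<Sum>k\<in>?K. ?B i k * ?B k j)"
      by (simp add: bordered_def sum_negf)
  qed
  also have "\<dots> = det_on (?K \<union> set ys) ?B"
  proof (rule det_on_schur[symmetric])
    show "?K \<inter> set ys = {}" using assms(3) by fastforce
    show "?B k k' = (if k = k' then 1 else 0)" if "k \<in> ?K" "k' \<in> ?K" for k k'
      using that C[of "snd k" "snd k'"] by (auto simp: bordered_def split: if_splits)
  qed auto
  also have "\<dots> = (\<Sum>\<kappa>\<in>set ys \<rightarrow>\<^sub>E {1..N}. path_weight L \<kappa> ys *
      det_on ?K (bordered C L (path_end \<kappa> ys)))"
    using det_on_bordered_paths[of ys "{}" L N C] assms(1,3) L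
      sorted_wrt_mono_rel[OF _ assms(2), of "\<lambda>a b. L b a = 0"] by simp
  also have "\<dots> = (\<Sum>\<kappa>\<in>set ys \<rightarrow>\<^sub>E {1..N}. path_weight L \<kappa> ys *
      det_on {1..N} (\<lambda>j k. C k (path_end \<kappa> ys j)))"
  proof (intro sum.cong refl arg_cong2[where f="(*)"])
    fix \<kappa>
    have K: "?K = Pair 0 ` {1..N}" by auto
    have "det_on ?K (bordered C L (path_end \<kappa> ys)) =
        det_on {1..N} (\<lambda>j k. C j (path_end \<kappa> ys k))"
      unfolding K by (subst det_on_reindex) (auto simp: inj_on_def bordered_def)
    \<comment> \<open>In the bordered matrix the particles index the columns; the claim has them as
      rows, so that each row belongs to one independent process.\<close>
    also have "\<dots> = det_on {1..N} (\<lambda>j k. C k (path_end \<kappa> ys j))"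
      by (rule det_on_transpose[symmetric]) simp
    finally show "det_on ?K (bordered C L (path_end \<kappa> ys)) =
        det_on {1..N} (\<lambda>j k. C k (path_end \<kappa> ys j))" .
  qed
  finally show ?thesis .
qed

subsection \<open>The transition density as a Markov kernel\<close>

context markov_process
begin

abbreviation "\<mu> \<equiv> state_measure TT S"

abbreviation "\<F> \<equiv> natural_filtration TT Om V"

section \<open>Time set, state space and reference measure\<close>

lemma time_zero: "0 \<in> TT"
  using time_set by auto

lemma time_nonneg: "s \<in> TT \<Longrightarrow> 0 \<le> s"
  using time_set by (auto elim: Nats_cases)

lemma time_diff:
  assumes "s \<in> TT" "r \<in> TT" "s \<le> r"
  shows "r - s \<in> TT"
proof (cases "TT = \<nat>")
  case True
  then show ?thesis using assms by (auto elim!: Nats_cases simp flip: of_nat_diff)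
next
  case False
  then show ?thesis using assms time_set by auto
qed

text \<open>\<open>state_measure\<close> tests whether the time set is the set of natural numbers,
  so continuous time must be known to fail this test.\<close>

lemma nats_not_ray: "(\<nat> :: real set) \<noteq> {0..}"
proof
  assume *: "(\<nat> :: real set) = {0..}"
  have "(1/2 :: real) \<in> \<nat>" unfolding * by simp
  then obtain n where "1/2 = real n" by (auto elim: Nats_cases)
  then have "real (2 * n) = real 1" by simp
  then show False by (metis of_nat_eq_iff dvd_triv_left odd_one)
qed

lemma time_cases:
  obtains "TT = \<nat>" "\<mu> = count_space S" "countable S"
  | "TT = {0..}" "TT \<noteq> \<nat>" "\<mu> = restrict_space lborel S" "S \<in> sets borel"
  using time_set countable_S borel_S nats_not_ray by (auto simp: state_measure_def)

lemma S_borel: "S \<in> sets borel"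
  by (cases rule: time_cases) (auto intro: sets.countable)

lemma space_state: "space \<mu> = S"
  by (cases rule: time_cases) (auto simp: space_restrict_space)

text \<open>In discrete time \<open>S\<close> is countable and all of its subsets are Borel. Hence
  both kinds of reference measure have the same sigma-algebra, and later measurability arguments
  need no distinction of cases.\<close>

lemma sets_state: "sets \<mu> = sets (restrict_space borel S)"
proof (cases rule: time_cases)
  case 1
  have "X \<in> sets borel" if "X \<subseteq> S" for X
    using countable_subset[OF that 1(3)] by (auto intro: sets.countable)
  then have "Pow S = sets (restrict_space borel S)"
    by (auto simp: sets_restrict_space image_iff)
  then show ?thesis using 1 by simp
next
  case 2
  then show ?thesis by (simp add: sets_restrict_space)
qed

lemma sets_state_borel: "E \<in> sets \<mu> \<longleftrightarrow> E \<in> sets borel \<and> E \<subseteq> S"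
  using S_borel by (auto simp: sets_state sets_restrict_space_iff)

lemma measurable_state: "f \<in> measurable (restrict_space borel S) B \<longleftrightarrow> f \<in> measurable \<mu> B"
  by (simp add: measurable_cong_sets[OF sets_state refl])

lemma measurable_id_state [measurable]: "(\<lambda>x. x) \<in> borel_measurable \<mu>"
  unfolding measurable_state[symmetric] by (rule measurable_restrict_space1) simp

sublocale state: sigma_finite_measure \<mu>
proof (cases rule: time_cases)
  case 1
  then show "sigma_finite_measure \<mu>" by (simp add: sigma_finite_measure_count_space_countable)
next
  case 2
  then show "sigma_finite_measure \<mu>"
    by (simp add: sigma_finite_measure_restrict_space lborel.sigma_finite_measure_axioms)
qed

lemma p_nonneg: "r \<in> TT \<Longrightarrow> 0 < r \<Longrightarrow> x \<in> S \<Longrightarrow> y \<in> S \<Longrightarrow> 0 \<le> p r y x"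
  by (cases rule: time_cases) (auto simp: transition_probability density_nonneg)

lemma p_measurable:
  assumes "r \<in> TT" "0 < r"
  shows "(\<lambda>z. p r (fst z) (snd z)) \<in> borel_measurable (\<mu> \<Otimes>\<^sub>M \<mu>)"
proof (cases rule: time_cases)
  case 1
  then show ?thesis by (simp add: pair_measure_countable)
next
  case 2
  have *: "sets (\<mu> \<Otimes>\<^sub>M \<mu>) = sets (restrict_space borel S \<Otimes>\<^sub>M restrict_space borel S)"
    by (intro sets_pair_measure_cong sets_state)
  then show ?thesis
    using density_measurable[OF 2(1) assms(2)]
    unfolding measurable_cong_sets[OF * refl] by (simp add: case_prod_unfold)
qed

lemma measurable_p [measurable (raw)]:
  assumes "r \<in> TT" "0 < r" "f \<in> measurable A \<mu>" "g \<in> measurable A \<mu>"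
  shows "(\<lambda>x. p r (f x) (g x)) \<in> borel_measurable A"
  using measurable_compose[OF measurable_Pair[OF assms(3,4)] p_measurable[OF assms(1,2)]] by simp

lemma V_measurable_state [measurable (raw)]: "s \<in> TT \<Longrightarrow> V s \<in> measurable Om \<mu>"
  unfolding measurable_cong_sets[OF refl sets_state]
  using V_measurable V_in_S by (intro measurable_restrict_space2) auto

lemma space_P: "x \<in> S \<Longrightarrow> space (P x) = space Om"
  by (rule sets_eq_imp_space_eq) (rule sets_P)

text \<open>In discrete time this is countable additivity over the points of \<open>E\<close>; the
  integral form then reads the same for both time sets.\<close>

lemma law_V:
  assumes "x \<in> S" "r \<in> TT" "0 < r" "E \<in> sets \<mu>"
  shows "emeasure (P x) (V r -` E \<inter> space Om) = (\<integral>\<^sup>+y. indicator E y * ennreal (p r y x) \<partial>\<mu>)"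
proof (cases rule: time_cases)
  case 1
  interpret P: prob_space "P x" using assms(1) by (rule prob_space_P)
  have E: "E \<subseteq> S" "countable E"
    using assms(4) 1 by (auto intro: countable_subset)
  have V: "{\<omega> \<in> space Om. V r \<omega> = y} \<in> sets (P x)" for y
    using V_measurable[OF assms(2)] by (simp add: sets_P[OF assms(1)])
  have "V r -` E \<inter> space Om = (\<Union>y\<in>E. {\<omega> \<in> space Om. V r \<omega> = y})" by auto
  also have "emeasure (P x) \<dots> = (\<integral>\<^sup>+y. emeasure (P x) {\<omega> \<in> space Om. V r \<omega> = y} \<partial>count_space E)"
    using E V by (intro emeasure_UN_countable) (auto simp: disjoint_family_on_def)
  also have "\<dots> = (\<integral>\<^sup>+y. ennreal (p r y x) \<partial>count_space E)"
    using E 1 assms by (intro nn_integral_cong)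
      (auto simp: transition_probability P.emeasure_eq_measure)
  also have "\<dots> = (\<integral>\<^sup>+y. ennreal (p r y x) * indicator E y \<partial>count_space S)"
    using E(1) nn_integral_restrict_space[of E "count_space S" "\<lambda>y. ennreal (p r y x)"]
    by (simp add: restrict_count_space Int_absorb2)
  finally show ?thesis using 1 by (simp add: mult.commute)
next
  case 2
  show ?thesis
    using distributed_emeasure[OF transition_density[OF 2(1) assms(3,1)], of E] assms 2
    by (simp add: space_P mult.commute)
qed

section \<open>The filtration and the Markov property\<close>

lemma space_filtration: "space (\<F> s) = space Om"
  unfolding natural_filtration_def by (subst space_measure_of) auto

lemma sets_filtration_subset: "sets (\<F> s) \<subseteq> sets Om"
  unfolding natural_filtration_def
  by (subst sets_measure_of) (auto intro!: sets.sigma_sets_subset measurable_sets V_measurable)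

lemma V_filtration:
  assumes "s \<in> TT" "s \<le> r"
  shows "V s \<in> measurable (\<F> r) \<mu>"
proof -
  have "V s \<in> borel_measurable (\<F> r)"
  proof (rule measurableI)
    fix A :: "real set" assume "A \<in> sets borel"
    then show "V s -` A \<inter> space (\<F> r) \<in> sets (\<F> r)"
      unfolding space_filtration unfolding natural_filtration_def
      using assms time_nonneg by (subst sets_measure_of) (auto intro!: sigma_sets.Basic)
  qed simp
  then show ?thesis
    unfolding measurable_cong_sets[OF refl sets_state]
    using V_in_S assms(1) by (intro measurable_restrict_space2) (auto simp: space_filtration)
qed

lemma finite_measure_subalgebra_P: "x \<in> S \<Longrightarrow> finite_measure_subalgebra (P x) (\<F> s)"
  using prob_space_P[of x] sets_filtration_subset
  by (auto simp: finite_measure_subalgebra_def finite_measure_subalgebra_axioms_def subalgebra_def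
      space_filtration space_P sets_P prob_space.finite_measure)

text \<open>The conditional expectation is integrated over an event of the past and its value
  replaced by an integral of the transition density. The Markov property enters the joint law in
  this form.\<close>

lemma markov_nn_integral:
  assumes "x \<in> S" "s \<in> TT" "r \<in> TT" "0 < r" "A \<in> sets (\<F> s)" "E \<in> sets \<mu>"
  shows "(\<integral>\<^sup>+\<omega>. indicator A \<omega> * indicator E (V (s + r) \<omega>) \<partial>P x) =
    (\<integral>\<^sup>+\<omega>. indicator A \<omega> * (\<integral>\<^sup>+y. indicator E y * ennreal (p r y (V s \<omega>)) \<partial>\<mu>) \<partial>P x)"
proof -
  interpret P: prob_space "P x" using assms(1) by (rule prob_space_P)
  interpret finite_measure_subalgebra "P x" "\<F> s"
    using assms(1) by (rule finite_measure_subalgebra_P)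
  have sr: "s + r \<in> TT"
    using assms(2,3) time_set by (auto intro: Nats_add)
  define B where "B = {\<omega> \<in> space Om. V (s + r) \<omega> \<in> E}"
  define C where "C = real_cond_exp (P x) (\<F> s) (indicator B)"
  have E: "E \<in> sets borel" using assms(6) by (simp add: sets_state_borel)
  have B: "B \<in> sets (P x)"
    using V_measurable[OF sr] E unfolding B_def sets_P[OF assms(1)] by simp
  have A: "A \<in> sets (P x)"
    using assms(5) sets_filtration_subset sets_P[OF assms(1)] by blast
  have int_B: "integrable (P x) (indicator B :: _ \<Rightarrow> real)"
    using B by (simp add: P.emeasure_eq_measure)
  have int_C: "integrable (P x) C"
    unfolding C_def by (rule real_cond_exp_int(1)[OF int_B])
  have AE: "AE \<omega> in P x. C \<omega> = measure (P (V s \<omega>)) {\<omega>' \<in> space Om. V r \<omega>' \<in> E}"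
    unfolding C_def B_def by (rule markov_property[OF assms(1-3) E])
  have kernel: "ennreal (measure (P (V s \<omega>)) {\<omega>' \<in> space Om. V r \<omega>' \<in> E}) =
      (\<integral>\<^sup>+y. indicator E y * ennreal (p r y (V s \<omega>)) \<partial>\<mu>)" if "\<omega> \<in> space Om" for \<omega>
  proof -
    have S: "V s \<omega> \<in> S" using V_in_S assms(2) that by simp
    interpret P': prob_space "P (V s \<omega>)" using S by (rule prob_space_P)
    have "{\<omega>' \<in> space Om. V r \<omega>' \<in> E} = V r -` E \<inter> space Om" by auto
    then show ?thesis
      using law_V[OF S assms(3,4,6)] by (simp add: P'.emeasure_eq_measure)
  qed
  have "(\<integral>\<^sup>+\<omega>. indicator A \<omega> * indicator E (V (s + r) \<omega>) \<partial>P x) =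
      (\<integral>\<^sup>+\<omega>. indicator (A \<inter> B) \<omega> \<partial>P x)"
    by (intro nn_integral_cong) (auto simp: B_def indicator_def space_P[OF assms(1)])
  also have "\<dots> = ennreal (measure (P x) (A \<inter> B))"
    using A B by (simp add: P.emeasure_eq_measure)
  also have "measure (P x) (A \<inter> B) = (\<integral>\<omega>\<in>A. indicator B \<omega> \<partial>P x)"
    using A B by (simp add: set_lebesgue_integral_def indicator_inter_arith[symmetric])
  also have "\<dots> = (\<integral>\<omega>\<in>A. C \<omega> \<partial>P x)"
    unfolding C_def by (rule real_cond_exp_intA[OF int_B assms(5)])
  also have "ennreal \<dots> = (\<integral>\<^sup>+\<omega>. ennreal (indicator A \<omega> * C \<omega>) \<partial>P x)"
    unfolding set_lebesgue_integral_def real_scaleR_def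
  proof (rule nn_integral_eq_integral[symmetric])
    show "integrable (P x) (\<lambda>\<omega>. indicator A \<omega> * C \<omega>)"
      using integrable_mult_indicator[OF A int_C] by simp
    show "AE \<omega> in P x. 0 \<le> indicator A \<omega> * C \<omega>"
      using AE by eventually_elim simp
  qed
  also have "\<dots> = (\<integral>\<^sup>+\<omega>. indicator A \<omega> *
      (\<integral>\<^sup>+y. indicator E y * ennreal (p r y (V s \<omega>)) \<partial>\<mu>) \<partial>P x)"
  proof (rule nn_integral_cong_AE)
    show "AE \<omega> in P x. ennreal (indicator A \<omega> * C \<omega>) =
        indicator A \<omega> * (\<integral>\<^sup>+y. indicator E y * ennreal (p r y (V s \<omega>)) \<partial>\<mu>)"
      using AE AE_space by eventually_elim (auto simp: indicator_def kernel space_P[OF assms(1)])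
  qed
  finally show ?thesis .
qed

end

subsection \<open>Joint law of the observed positions\<close>

locale observed_particles = markov_process TT S Om P V p
  for TT S :: "real set"
    and Om :: "'w measure"
    and P :: "real \<Rightarrow> 'w measure"
    and V :: "real \<Rightarrow> 'w \<Rightarrow> real"
    and p :: "real \<Rightarrow> real \<Rightarrow> real \<Rightarrow> real" +
  fixes N M :: nat
    and u t :: "nat \<Rightarrow> real"
  assumes N_pos: "1 \<le> N"
    and u_in_S: "k \<in> {1..N} \<Longrightarrow> u k \<in> S"
    and t_mono: "strict_mono_on {1..M} t"
    and t_in_TT: "m \<in> {1..M} \<Longrightarrow> t m \<in> TT"
    and t_pos: "m \<in> {1..M} \<Longrightarrow> 0 < t m"
begin

abbreviation "Q \<equiv> indep_copies P N u"

definition time :: "nat \<times> nat \<Rightarrow> real" where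
  "time a = (if fst a = 0 then 0 else t (fst a))"

definition pos :: "(nat \<times> nat \<Rightarrow> real) \<Rightarrow> nat \<times> nat \<Rightarrow> real" where
  "pos z a = (if fst a = 0 then u (snd a) else z a)"

text \<open>One function for both densities in the kernel: from \<open>(0, k)\<close> it is the
  density started at \<open>u k\<close>, between observed points it is the part with
  \<open>s > t\<close>. It is 0 at equal levels as well, which makes it strictly triangular in
  time.\<close>

definition link :: "(nat \<times> nat \<Rightarrow> real) \<Rightarrow> nat \<times> nat \<Rightarrow> nat \<times> nat \<Rightarrow> real" where
  "link z a b = (if fst b < fst a then p (time a - time b) (z a) (pos z b) else 0)"

definition observe :: "(nat \<times> nat \<Rightarrow> nat) \<Rightarrow> (nat \<times> nat) set \<Rightarrow> (nat \<Rightarrow> 'w) \<Rightarrow> nat \<times> nat \<Rightarrow> real" where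
  "observe \<kappa> I \<omega> = (\<lambda>a\<in>I. V (time a) (\<omega> (\<kappa> a)))"

lemma time_in_TT: "fst a \<le> M \<Longrightarrow> time a \<in> TT"
  using t_in_TT[of "fst a"] by (auto simp: time_def time_zero)

lemma time_less:
  assumes "fst a < fst b" "fst b \<le> M"
  shows "time a < time b"
proof (cases "fst a = 0")
  case True
  then show ?thesis using assms t_pos[of "fst b"] by (simp add: time_def)
next
  case False
  then show ?thesis
    using assms strict_mono_onD[OF t_mono, of "fst a" "fst b"] by (simp add: time_def)
qed

lemma time_le:
  assumes "fst a \<le> fst b" "fst b \<le> M"
  shows "time a \<le> time b"
proof (cases "fst a = fst b")
  case True
  then show ?thesis by (simp add: time_def)
next
  case False
  then show ?thesis using assms time_less[of a b] by simp
qed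

lemma time_gap:
  assumes "fst b < fst a" "fst a \<le> M"
  shows "time a - time b \<in> TT" "0 < time a - time b"
proof -
  show "0 < time a - time b" using time_less[OF assms] by simp
  then show "time a - time b \<in> TT" using assms by (intro time_diff time_in_TT) simp_all
qed

text \<open>The library requires the factors of a product of probability spaces to be probability spaces
  for all indices.\<close>

definition Pu :: "nat \<Rightarrow> 'w measure" where
  "Pu k = P (u (if k \<in> {1..N} then k else 1))"

lemma Pu_eq: "k \<in> {1..N} \<Longrightarrow> Pu k = P (u k)"
  unfolding Pu_def by simp

lemma Q_eq: "Q = PiM {1..N} Pu"
  unfolding indep_copies_def Pu_def by (intro PiM_cong) auto

lemma u'_in_S: "u (if k \<in> {1..N} then k else 1) \<in> S"
  using u_in_S N_pos by auto

sublocale copies: finite_product_prob_space Pu "{1..N}"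
proof -
  have pr: "prob_space (Pu k)" for k
    unfolding Pu_def by (intro prob_space_P u'_in_S)
  show "finite_product_prob_space Pu {1..N}"
    unfolding finite_product_prob_space_def finite_product_sigma_finite_def
      finite_product_sigma_finite_axioms_def product_prob_space_def product_prob_space_axioms_def
      product_sigma_finite_def
    by (intro conjI allI pr prob_space_imp_sigma_finite finite_atLeastAtMost)
qed

sublocale Q: prob_space Q
  unfolding Q_eq by (rule copies.P.prob_space_axioms)

section \<open>Independent copies on the product space\<close>

lemma sets_Pu [measurable_cong]: "sets (Pu k) = sets Om"
  unfolding Pu_def by (intro sets_P u'_in_S)

lemma space_Pu: "space (Pu k) = space Om"
  by (rule sets_eq_imp_space_eq) (rule sets_Pu)

lemma space_Q: "space Q = {1..N} \<rightarrow>\<^sub>E space Om"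
  by (simp add: Q_eq space_PiM space_Pu)

lemma measurable_coordinate:
  assumes "k \<in> {1..N}" "f \<in> measurable Om B"
  shows "(\<lambda>\<omega>. f (\<omega> k)) \<in> measurable Q B"
proof -
  have "(\<lambda>\<omega>. \<omega> k) \<in> measurable Q (Pu k)"
    unfolding Q_eq using assms(1) by (rule measurable_component_singleton)
  moreover have "f \<in> measurable (Pu k) B"
    using assms(2) by (simp add: measurable_cong_sets[OF sets_Pu refl])
  ultimately show ?thesis by (rule measurable_compose)
qed

lemma measurable_observe:
  assumes "\<And>a. a \<in> I \<Longrightarrow> \<kappa> a \<in> {1..N} \<and> fst a \<le> M"
  shows "observe \<kappa> I \<in> measurable Q (PiM I (\<lambda>_. \<mu>))"
  unfolding observe_def
  using assms by (intro measurable_restrict measurable_coordinate V_measurable_state time_in_TT) auto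

lemma AE_start: "AE \<omega> in Q. \<forall>k\<in>{1..N}. V 0 (\<omega> k) = u k"
proof -
  have "AE \<omega> in Q. V 0 (\<omega> k) = u k" if k: "k \<in> {1..N}" for k
    unfolding Q_eq
  proof (rule AE_PiM_component[where P="\<lambda>w. V 0 w = u k"])
    show "AE w in Pu k. V 0 w = u k"
      unfolding Pu_eq[OF k] by (rule V_start[OF u_in_S[OF k]])
  qed (use k copies.prob_space in auto)
  then show ?thesis by (simp add: AE_finite_all)
qed

text \<open>By independence both sides are products over the particles and differ in the factor of
  \<open>k\<close> only, so the equality is needed just under the law of that particle.\<close>

lemma nn_integral_replace_factor:
  fixes h :: "nat \<Rightarrow> 'w \<Rightarrow> ennreal"
  assumes "k \<in> {1..N}" "\<And>l. h l \<in> borel_measurable Om"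
    and "g \<in> borel_measurable Om" "g' \<in> borel_measurable Om"
    and "(\<integral>\<^sup>+w. h k w * g w \<partial>P (u k)) = (\<integral>\<^sup>+w. h k w * g' w \<partial>P (u k))"
  shows "(\<integral>\<^sup>+\<omega>. (\<Prod>l\<in>{1..N}. h l (\<omega> l)) * g (\<omega> k) \<partial>Q) =
    (\<integral>\<^sup>+\<omega>. (\<Prod>l\<in>{1..N}. h l (\<omega> l)) * g' (\<omega> k) \<partial>Q)"
proof -
  have *: "(\<integral>\<^sup>+\<omega>. (\<Prod>l\<in>{1..N}. h l (\<omega> l)) * f (\<omega> k) \<partial>Q) =
      (\<Prod>l\<in>{1..N}. \<integral>\<^sup>+w. h l w * (if l = k then f w else 1) \<partial>Pu l)"
    if "f \<in> borel_measurable Om" for f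
  proof -
    have m: "(\<lambda>w. h l w * (if l = k then f w else 1)) \<in> borel_measurable (Pu l)" for l
      using assms(2) that by (simp add: measurable_cong_sets[OF sets_Pu refl])
    have "(\<Prod>l\<in>{1..N}. h l (\<omega> l)) * f (\<omega> k) =
        (\<Prod>l\<in>{1..N}. h l (\<omega> l) * (if l = k then f (\<omega> l) else 1))" for \<omega>
      using assms(1) by (simp add: prod.distrib)
    then show ?thesis
      unfolding Q_eq
      by (simp only:) (rule copies.product_nn_integral_prod; use m in simp)
  qed
  have "(\<integral>\<^sup>+w. h l w * (if l = k then g w else 1) \<partial>Pu l) =
      (\<integral>\<^sup>+w. h l w * (if l = k then g' w else 1) \<partial>Pu l)" if "l \<in> {1..N}" for l
    using assms(5) unfolding Pu_eq[OF that] by (cases "l = k") simp_all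
  then show ?thesis
    unfolding *[OF assms(3)] *[OF assms(4)] by (intro prod.cong refl)
qed

section \<open>One Markov step\<close>

definition kernel_mass :: "nat \<times> nat \<Rightarrow> nat \<times> nat \<Rightarrow> real set \<Rightarrow> real \<Rightarrow> ennreal" where
  "kernel_mass a b E y = (\<integral>\<^sup>+x. indicator E x * ennreal (p (time a - time b) x y) \<partial>\<mu>)"

lemma measurable_kernel_mass:
  assumes "fst b < fst a" "fst a \<le> M" "E \<in> sets \<mu>"
  shows "kernel_mass a b E \<in> borel_measurable \<mu>"
proof -
  note [measurable] = assms(3) measurable_p[OF time_gap[OF assms(1,2)] measurable_snd measurable_fst]
  show ?thesis
    unfolding kernel_mass_def
    by (rule state.borel_measurable_nn_integral) (simp add: case_prod_unfold)
qed

text \<open>The points \<open>I\<close> have been visited before the time of \<open>a\<close>, and \<open>b\<close> is the last one visited by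
  the particle that visits \<open>a\<close>.\<close>

lemma nn_integral_markov_step:
  assumes "finite I" "\<And>i. i \<in> I \<Longrightarrow> \<kappa> i \<in> {1..N} \<and> fst i \<le> M \<and> A i \<in> sets \<mu>"
    and "\<kappa> a \<in> {1..N}" "fst b < fst a" "fst a \<le> M" "E \<in> sets \<mu>"
    and "\<And>i. i \<in> I \<Longrightarrow> \<kappa> i = \<kappa> a \<Longrightarrow> fst i \<le> fst b"
  shows "(\<integral>\<^sup>+\<omega>. (\<Prod>i\<in>I. indicator (A i) (V (time i) (\<omega> (\<kappa> i)))) * indicator E (V (time a) (\<omega> (\<kappa> a))) \<partial>Q) =
    (\<integral>\<^sup>+\<omega>. (\<Prod>i\<in>I. indicator (A i) (V (time i) (\<omega> (\<kappa> i)))) *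
       kernel_mass a b E (V (time b) (\<omega> (\<kappa> a))) \<partial>Q)"
proof -
  let ?k = "\<kappa> a"
  define h :: "nat \<Rightarrow> 'w \<Rightarrow> ennreal" where
    "h l w = (\<Prod>i\<in>{i\<in>I. \<kappa> i = l}. indicator (A i) (V (time i) w))" for l w
  note gap = time_gap[OF assms(4,5)]
  have tb: "time b \<in> TT" and ta: "time a \<in> TT"
    using assms(4,5) by (auto intro: time_in_TT)
  \<comment> \<open>The indicators are sorted by particle, so that independence can be
    applied.\<close>
  have group: "(\<Prod>i\<in>I. indicator (A i) (V (time i) (\<omega> (\<kappa> i)))) = (\<Prod>l\<in>{1..N}. h l (\<omega> l))" for \<omega>
  proof -
    have "(\<Prod>l\<in>{1..N}. h l (\<omega> l)) =
        (\<Prod>l\<in>{1..N}. \<Prod>i\<in>{i\<in>I. \<kappa> i = l}. indicator (A i) (V (time i) (\<omega> (\<kappa> i))))"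
      unfolding h_def by (intro prod.cong) auto
    also have "\<dots> = (\<Prod>i\<in>I. indicator (A i) (V (time i) (\<omega> (\<kappa> i))))"
    proof (rule prod.group[OF assms(1)])
      show "\<kappa> ` I \<subseteq> {1..N}" by (rule image_subsetI) (use assms(2) in blast)
    qed simp
    finally show ?thesis by simp
  qed
  have h: "h l \<in> borel_measurable Om" for l
    unfolding h_def
  proof (intro borel_measurable_prod_ennreal)
    fix i assume "i \<in> {i\<in>I. \<kappa> i = l}"
    then show "(\<lambda>w. indicator (A i) (V (time i) w) :: ennreal) \<in> borel_measurable Om"
      using assms(2)
      by (intro measurable_compose[OF V_measurable_state borel_measurable_indicator] time_in_TT) auto
  qed
  show ?thesis
    unfolding group
  proof (rule nn_integral_replace_factor)
    \<comment> \<open>All points of the particle of \<open>a\<close> are no later than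
      \<open>b\<close>, so its factor is the indicator of an event in its past up to the time of
      \<open>b\<close>.\<close>
    let ?B = "{w \<in> space Om. \<forall>i\<in>I. \<kappa> i = ?k \<longrightarrow> V (time i) w \<in> A i}"
    have "{w \<in> space (\<F> (time b)). \<forall>i\<in>{i\<in>I. \<kappa> i = ?k}. V (time i) w \<in> A i} \<in> sets (\<F> (time b))"
    proof (rule sets.sets_Collect_finite_All)
      fix i assume i: "i \<in> {i\<in>I. \<kappa> i = ?k}"
      then have "fst i \<le> M" "fst i \<le> fst b" using assms(2,7) by blast+
      moreover have "fst b \<le> M" using assms(4,5) by simp
      ultimately have "V (time i) \<in> measurable (\<F> (time b)) \<mu>"
        by (intro V_filtration time_in_TT time_le)
      then have "V (time i) -` A i \<inter> space (\<F> (time b)) \<in> sets (\<F> (time b))"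
        by (rule measurable_sets) (use i assms(2)[of i] in blast)
      then show "{w \<in> space (\<F> (time b)). V (time i) w \<in> A i} \<in> sets (\<F> (time b))"
        by (simp add: vimage_def Int_def conj_commute)
    qed (use assms(1) in simp)
    also have "{w \<in> space (\<F> (time b)). \<forall>i\<in>{i\<in>I. \<kappa> i = ?k}. V (time i) w \<in> A i} = ?B"
      unfolding space_filtration by blast
    finally have B: "?B \<in> sets (\<F> (time b))" .
    have hB: "h ?k w = indicator ?B w" if w: "w \<in> space Om" for w
    proof (cases "w \<in> ?B")
      case True
      then have "(indicator (A i) (V (time i) w) :: ennreal) = 1" if "i \<in> {i\<in>I. \<kappa> i = ?k}" for i
        using that by simp
      then show ?thesis using True unfolding h_def by (simp add: prod.neutral)
    next
      case False
      then obtain i where "i \<in> {i\<in>I. \<kappa> i = ?k}" "V (time i) w \<notin> A i" using w by blast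
      then have "h ?k w = 0"
        unfolding h_def using assms(1) by (intro prod_zero bexI[of _ i]) auto
      then show ?thesis using False by simp
    qed
    have sp: "space (P (u ?k)) = space Om"
      using assms(3) by (intro space_P u_in_S)
    have "(\<integral>\<^sup>+w. h ?k w * indicator E (V (time a) w) \<partial>P (u ?k)) =
        (\<integral>\<^sup>+w. indicator ?B w * indicator E (V (time b + (time a - time b)) w) \<partial>P (u ?k))"
      using hB sp by (intro nn_integral_cong) simp
    also have "\<dots> = (\<integral>\<^sup>+w. indicator ?B w * kernel_mass a b E (V (time b) w) \<partial>P (u ?k))"
      unfolding kernel_mass_def by (rule markov_nn_integral[OF u_in_S[OF assms(3)] tb gap B assms(6)])
    also have "\<dots> = (\<integral>\<^sup>+w. h ?k w * kernel_mass a b E (V (time b) w) \<partial>P (u ?k))"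
      by (intro nn_integral_cong) (simp add: hB sp)
    finally show "(\<integral>\<^sup>+w. h ?k w * indicator E (V (time a) w) \<partial>P (u ?k)) =
        (\<integral>\<^sup>+w. h ?k w * kernel_mass a b E (V (time b) w) \<partial>P (u ?k))" .
    show "(\<lambda>w. indicator E (V (time a) w)) \<in> borel_measurable Om"
      by (rule measurable_compose[OF V_measurable_state[OF ta] borel_measurable_indicator[OF assms(6)]])
    show "(\<lambda>w. kernel_mass a b E (V (time b) w)) \<in> borel_measurable Om"
      by (rule measurable_compose[OF V_measurable_state[OF tb]])
        (rule measurable_kernel_mass[OF assms(4-6)])
  qed (use assms(3) h in blast)+
qed

text \<open>The injectivity clause excludes two points of equal time on one path. There the two
  observed values coincide, while \<open>path_weight (link z)\<close> is 0 and cannot be the density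
  of a probability law.\<close>

definition admissible :: "(nat \<times> nat \<Rightarrow> nat) \<Rightarrow> (nat \<times> nat) list \<Rightarrow> bool" where
  "admissible \<kappa> ys \<longleftrightarrow> distinct ys \<and> sorted_wrt (\<lambda>a b. fst b \<le> fst a) ys \<and>
     (\<forall>a\<in>set ys. 1 \<le> fst a \<and> fst a \<le> M \<and> \<kappa> a \<in> {1..N}) \<and> inj_on (\<lambda>a. (fst a, \<kappa> a)) (set ys)"

lemma admissible_Cons:
  assumes "admissible \<kappa> (a # ys)"
  shows "admissible \<kappa> ys" "a \<notin> set ys" "fst (path_end \<kappa> ys (\<kappa> a)) < fst a"
    "1 \<le> fst a" "fst a \<le> M" "\<kappa> a \<in> {1..N}"
    "\<And>i. i \<in> set ys \<Longrightarrow> \<kappa> i = \<kappa> a \<Longrightarrow> fst i \<le> fst (path_end \<kappa> ys (\<kappa> a))"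
proof -
  show *: "admissible \<kappa> ys" "a \<notin> set ys" "1 \<le> fst a" "fst a \<le> M" "\<kappa> a \<in> {1..N}"
    using assms by (auto simp: admissible_def inj_on_def)
  show "fst i \<le> fst (path_end \<kappa> ys (\<kappa> a))" if "i \<in> set ys" "\<kappa> i = \<kappa> a" for i
    using path_end_latest[of ys i \<kappa>] *(1) that by (simp add: admissible_def)
  show "fst (path_end \<kappa> ys (\<kappa> a)) < fst a"
  proof (cases "path_end \<kappa> ys (\<kappa> a) = (0, \<kappa> a)")
    case True
    then show ?thesis using *(3) by simp
  next
    case False
    then have b: "path_end \<kappa> ys (\<kappa> a) \<in> set ys" "\<kappa> (path_end \<kappa> ys (\<kappa> a)) = \<kappa> a"
      using path_end_cases[of \<kappa> ys "\<kappa> a"] by auto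
    have "fst (path_end \<kappa> ys (\<kappa> a)) \<noteq> fst a"
      using assms b *(2) unfolding admissible_def by (auto simp: inj_on_def)
    moreover have "fst (path_end \<kappa> ys (\<kappa> a)) \<le> fst a"
      using assms b by (auto simp: admissible_def)
    ultimately show ?thesis by simp
  qed
qed

lemma measurable_pos:
  assumes "b = (0, k) \<and> k \<in> {1..N} \<or> b \<in> J \<and> 1 \<le> fst b"
  shows "(\<lambda>z. pos z b) \<in> measurable (PiM J (\<lambda>_. \<mu>)) \<mu>"
  using assms u_in_S by (auto simp: pos_def space_state)

lemma path_weight_link:
  assumes "admissible \<kappa> ys" "set ys \<subseteq> J"
  shows "(\<lambda>z. path_weight (link z) \<kappa> ys) \<in> borel_measurable (PiM J (\<lambda>_. \<mu>)) \<and>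
    (\<forall>z\<in>space (PiM J (\<lambda>_. \<mu>)). 0 \<le> path_weight (link z) \<kappa> ys)"
  using assms
proof (induction ys)
  case (Cons a ys)
  note a = admissible_Cons[OF Cons.prems(1)]
  define b where "b = path_end \<kappa> ys (\<kappa> a)"
  have ys: "b \<in> set ys \<Longrightarrow> 1 \<le> fst b" "set ys \<subseteq> J"
    using a(1) Cons.prems(2) by (auto simp: admissible_def)
  have b: "b = (0, \<kappa> a) \<and> \<kappa> a \<in> {1..N} \<or> b \<in> J \<and> 1 \<le> fst b"
    using path_end_cases[of \<kappa> ys "\<kappa> a"] ys a(6) unfolding b_def[symmetric] by blast
  have "fst b < fst a" using a(3) b_def by simp
  note gap = time_gap[OF this a(5)]
  have link_eq: "link z a b = p (time a - time b) (z a) (pos z b)" for z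
    using \<open>fst b < fst a\<close> by (simp add: link_def)
  note pos = measurable_pos[OF b]
  have za: "(\<lambda>z. z a) \<in> measurable (PiM J (\<lambda>_. \<mu>)) \<mu>"
    using Cons.prems(2) by simp
  have IH: "(\<lambda>z. path_weight (link z) \<kappa> ys) \<in> borel_measurable (PiM J (\<lambda>_. \<mu>))"
      "\<And>z. z \<in> space (PiM J (\<lambda>_. \<mu>)) \<Longrightarrow> 0 \<le> path_weight (link z) \<kappa> ys"
    using Cons.IH[OF a(1) ys(2)] by auto
  have "0 \<le> p (time a - time b) (z a) (pos z b)" if "z \<in> space (PiM J (\<lambda>_. \<mu>))" for z
    using measurable_space[OF za that] measurable_space[OF pos that]
    by (intro p_nonneg gap) (auto simp: space_state)
  then show ?case
    unfolding path_weight.simps b_def[symmetric] link_eq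
    using borel_measurable_times[OF IH(1) measurable_p[OF gap za pos]] IH(2) by auto
qed simp

sublocale states: product_sigma_finite "\<lambda>_ :: nat \<times> nat. \<mu>"
  by unfold_locales

lemma path_weight_link_cong:
  assumes "\<And>i. i \<in> set ys \<Longrightarrow> z i = z' i"
  shows "path_weight (link z) \<kappa> ys = path_weight (link z') \<kappa> ys"
  using assms
proof (induction ys)
  case (Cons a ys)
  have "link z a (path_end \<kappa> ys (\<kappa> a)) = link z' a (path_end \<kappa> ys (\<kappa> a))"
    using path_end_cases[of \<kappa> ys "\<kappa> a"] Cons.prems[of a] Cons.prems[of "path_end \<kappa> ys (\<kappa> a)"]
    by (auto simp: link_def pos_def)
  then show ?case using Cons by simp
qed simp

lemma prod_indicator_PiE:
  assumes "finite I" "z \<in> extensional I"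
  shows "(\<Prod>i\<in>I. indicator (A i) (z i) :: ennreal) = indicator (Pi\<^sub>E I A) z"
proof (cases "z \<in> Pi\<^sub>E I A")
  case True
  then have "(indicator (A i) (z i) :: ennreal) = 1" if "i \<in> I" for i
    using that by (simp add: PiE_mem)
  then show ?thesis using True by (simp add: prod.neutral)
next
  case False
  then obtain i where "i \<in> I" "z i \<notin> A i" using assms(2) by (auto simp: PiE_def Pi_def)
  then have "(\<Prod>i\<in>I. indicator (A i) (z i) :: ennreal) = 0"
    using assms(1) by (intro prod_zero bexI[of _ i]) auto
  then show ?thesis using False by simp
qed

text \<open>Since one of the measures is finite, the constant sequence of the whole space, itself a
  rectangle, serves as the exhausting sequence.\<close>

lemma measure_eqI_rectangles:
  assumes "finite I" "sets M1 = sets (PiM I (\<lambda>_. \<mu>))" "sets M2 = sets (PiM I (\<lambda>_. \<mu>))"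
    and "finite_measure M1"
    and "\<And>A. (\<And>i. i \<in> I \<Longrightarrow> A i \<in> sets \<mu>) \<Longrightarrow> emeasure M1 (Pi\<^sub>E I A) = emeasure M2 (Pi\<^sub>E I A)"
  shows "M1 = M2"
proof (rule measure_eqI_PiM_finite[OF assms(1-3,5)])
  show "range (\<lambda>_ :: nat. space (PiM I (\<lambda>_. \<mu>))) \<subseteq> prod_algebra I (\<lambda>_. \<mu>)"
    using assms(1) by (auto simp: space_PiM intro!: prod_algebraI_finite)
  show "emeasure M1 (space (PiM I (\<lambda>_. \<mu>))) \<noteq> \<infinity>" for i :: nat
    using finite_measure.emeasure_finite[OF assms(4)] by simp
qed auto

lemma emeasure_observe:
  assumes "finite I" "\<And>i. i \<in> I \<Longrightarrow> \<kappa> i \<in> {1..N} \<and> fst i \<le> M \<and> A i \<in> sets \<mu>"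
  shows "emeasure (distr Q (PiM I (\<lambda>_. \<mu>)) (observe \<kappa> I)) (Pi\<^sub>E I A) =
    (\<integral>\<^sup>+\<omega>. (\<Prod>i\<in>I. indicator (A i) (V (time i) (\<omega> (\<kappa> i)))) \<partial>Q)"
proof -
  have m: "observe \<kappa> I \<in> measurable Q (PiM I (\<lambda>_. \<mu>))"
    using assms(2) by (intro measurable_observe) auto
  have A: "Pi\<^sub>E I A \<in> sets (PiM I (\<lambda>_. \<mu>))"
    using assms by (intro sets_PiM_I_finite) auto
  have "emeasure (distr Q (PiM I (\<lambda>_. \<mu>)) (observe \<kappa> I)) (Pi\<^sub>E I A) =
      (\<integral>\<^sup>+z. indicator (Pi\<^sub>E I A) z \<partial>distr Q (PiM I (\<lambda>_. \<mu>)) (observe \<kappa> I))"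
    using A by simp
  also have "\<dots> = (\<integral>\<^sup>+\<omega>. indicator (Pi\<^sub>E I A) (observe \<kappa> I \<omega>) \<partial>Q)"
    using m A by (intro nn_integral_distr) auto
  also have "\<dots> = (\<integral>\<^sup>+\<omega>. (\<Prod>i\<in>I. indicator (A i) (V (time i) (\<omega> (\<kappa> i)))) \<partial>Q)"
  proof (intro nn_integral_cong)
    fix \<omega>
    have "indicator (Pi\<^sub>E I A) (observe \<kappa> I \<omega>) =
        (\<Prod>i\<in>I. indicator (A i) (observe \<kappa> I \<omega> i) :: ennreal)"
      using assms(1) by (intro prod_indicator_PiE[symmetric]) (auto simp: observe_def)
    then show "indicator (Pi\<^sub>E I A) (observe \<kappa> I \<omega>) =
        (\<Prod>i\<in>I. indicator (A i) (V (time i) (\<omega> (\<kappa> i))) :: ennreal)"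
      by (simp add: observe_def)
  qed
  finally show ?thesis .
qed

text \<open>The head of the list is a latest point, so given the other observations it adds a single
  transition density, started at the last point of its own particle. Both sides are compared on
  rectangles, where integrating out the head gives \<open>kernel_mass\<close>.\<close>

proposition law_observe:
  assumes "admissible \<kappa> ys"
  shows "distr Q (PiM (set ys) (\<lambda>_. \<mu>)) (observe \<kappa> (set ys)) =
    density (PiM (set ys) (\<lambda>_. \<mu>)) (\<lambda>z. ennreal (path_weight (link z) \<kappa> ys))"
  using assms
proof (induction ys)
  case Nil
  have m: "observe \<kappa> {} \<in> measurable Q (PiM {} (\<lambda>_. \<mu>))"
    by (rule measurable_observe) simp
  show ?case
    unfolding list.set
  proof (rule measure_eqI_rectangles)
    show "finite_measure (distr Q (PiM {} (\<lambda>_. \<mu>)) (observe \<kappa> {}))"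
      using m by (rule Q.finite_measure_distr)
    show "emeasure (distr Q (PiM {} (\<lambda>_. \<mu>)) (observe \<kappa> {})) (Pi\<^sub>E {} A) =
        emeasure (density (PiM {} (\<lambda>_. \<mu>)) (\<lambda>z. ennreal (path_weight (link z) \<kappa> []))) (Pi\<^sub>E {} A)" for A
      using emeasure_observe[of "{}" \<kappa> A] Q.emeasure_space_1
      by (simp add: density_1 one_ennreal_def[symmetric] PiM_empty)
  qed simp_all
next
  case (Cons a ys)
  note a = admissible_Cons[OF Cons.prems]
  define I where "I = set ys"
  define b where "b = path_end \<kappa> ys (\<kappa> a)"
  have I: "finite I" "a \<notin> I" and J: "set (a # ys) = insert a I"
    using a(2) by (auto simp: I_def)
  have ok: "\<kappa> i \<in> {1..N} \<and> fst i \<le> M \<and> 1 \<le> fst i" if "i \<in> insert a I" for i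
    using that Cons.prems unfolding admissible_def J by auto
  have b_cases: "b = (0, \<kappa> a) \<or> b \<in> I \<and> \<kappa> b = \<kappa> a"
    unfolding b_def I_def by (rule path_end_cases)
  then have b: "b = (0, \<kappa> a) \<and> \<kappa> a \<in> {1..N} \<or> b \<in> I \<and> 1 \<le> fst b"
    using ok[of b] a(6) by auto
  have ba: "fst b < fst a" "b \<noteq> a" using a(3) by (auto simp: b_def)
  note gap = time_gap[OF ba(1) a(5)]
  have mI: "observe \<kappa> I \<in> measurable Q (PiM I (\<lambda>_. \<mu>))"
    and mJ: "observe \<kappa> (insert a I) \<in> measurable Q (PiM (insert a I) (\<lambda>_. \<mu>))"
    using ok by (auto intro!: measurable_observe)
  have mw: "(\<lambda>z. path_weight (link z) \<kappa> ys) \<in> borel_measurable (PiM I (\<lambda>_. \<mu>))"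
    and w_nonneg: "\<And>z. z \<in> space (PiM I (\<lambda>_. \<mu>)) \<Longrightarrow> 0 \<le> path_weight (link z) \<kappa> ys"
    using path_weight_link[OF a(1), of I] by (auto simp: I_def)
  have mwJ: "(\<lambda>z. path_weight (link z) \<kappa> (a # ys)) \<in> borel_measurable (PiM (insert a I) (\<lambda>_. \<mu>))"
    using path_weight_link[OF Cons.prems, of "insert a I"] by (auto simp: I_def)
  have IH: "distr Q (PiM I (\<lambda>_. \<mu>)) (observe \<kappa> I) =
      density (PiM I (\<lambda>_. \<mu>)) (\<lambda>z. ennreal (path_weight (link z) \<kappa> ys))"
    using Cons.IH[OF a(1)] by (simp add: I_def)
  show ?case
    unfolding J
  proof (rule measure_eqI_rectangles)
    show "finite_measure (distr Q (PiM (insert a I) (\<lambda>_. \<mu>)) (observe \<kappa> (insert a I)))"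
      using mJ by (rule Q.finite_measure_distr)
    fix A :: "nat \<times> nat \<Rightarrow> real set" assume A: "\<And>i. i \<in> insert a I \<Longrightarrow> A i \<in> sets \<mu>"
    \<comment> \<open>What remains of the integrand when the coordinate \<open>a\<close> has been
      integrated out; it depends on the earlier observations only.\<close>
    define F where "F z = (\<Prod>i\<in>I. indicator (A i) (z i)) * kernel_mass a b (A a) (pos z b)"
      for z :: "nat \<times> nat \<Rightarrow> real"
    have mind: "(\<lambda>z. indicator (A i) (z i) :: ennreal) \<in> borel_measurable (PiM J (\<lambda>_. \<mu>))"
      if "i \<in> J" "i \<in> insert a I" for i J
      by (rule measurable_compose[OF measurable_component_singleton[OF that(1)]
            borel_measurable_indicator[OF A[OF that(2)]]])
    have mF: "F \<in> borel_measurable (PiM I (\<lambda>_. \<mu>))"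
      unfolding F_def
    proof (intro borel_measurable_times_ennreal borel_measurable_prod_ennreal mind)
      show "(\<lambda>z. kernel_mass a b (A a) (pos z b)) \<in> borel_measurable (PiM I (\<lambda>_. \<mu>))"
        by (rule measurable_compose[OF measurable_pos[OF b] measurable_kernel_mass[OF ba(1) a(5) A]])
          simp
    qed auto
    have "emeasure (distr Q (PiM (insert a I) (\<lambda>_. \<mu>)) (observe \<kappa> (insert a I))) (Pi\<^sub>E (insert a I) A) =
        (\<integral>\<^sup>+\<omega>. (\<Prod>i\<in>insert a I. indicator (A i) (V (time i) (\<omega> (\<kappa> i)))) \<partial>Q)"
      using I ok A by (intro emeasure_observe) auto
    also have "\<dots> = (\<integral>\<^sup>+\<omega>. (\<Prod>i\<in>I. indicator (A i) (V (time i) (\<omega> (\<kappa> i)))) *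
        indicator (A a) (V (time a) (\<omega> (\<kappa> a))) \<partial>Q)"
      using I by (simp add: mult.commute)
    also have "\<dots> = (\<integral>\<^sup>+\<omega>. (\<Prod>i\<in>I. indicator (A i) (V (time i) (\<omega> (\<kappa> i)))) *
        kernel_mass a b (A a) (V (time b) (\<omega> (\<kappa> a))) \<partial>Q)"
    proof (rule nn_integral_markov_step[where \<kappa>=\<kappa> and a=a and b=b and I=I and A=A and E="A a"])
      show "fst i \<le> fst b" if "i \<in> I" "\<kappa> i = \<kappa> a" for i
        using a(7) that by (simp add: I_def b_def)
    qed (use I ok A a ba in auto)
    \<comment> \<open>\<open>pos\<close> gives starting points their nominal position
      \<open>u\<close>, which the process takes only almost surely; hence an equality almost
      everywhere.\<close>
    also have "\<dots> = (\<integral>\<^sup>+\<omega>. F (observe \<kappa> I \<omega>) \<partial>Q)"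
    proof (rule nn_integral_cong_AE)
      show "AE \<omega> in Q. (\<Prod>i\<in>I. indicator (A i) (V (time i) (\<omega> (\<kappa> i)))) *
          kernel_mass a b (A a) (V (time b) (\<omega> (\<kappa> a))) = F (observe \<kappa> I \<omega>)"
        using AE_start
      proof eventually_elim
        fix \<omega> assume start: "\<forall>k\<in>{1..N}. V 0 (\<omega> k) = u k"
        have "pos (observe \<kappa> I \<omega>) b = V (time b) (\<omega> (\<kappa> a))"
          using b_cases
        proof
          assume "b = (0, \<kappa> a)"
          then show ?thesis using start a(6) by (simp add: pos_def time_def)
        next
          assume "b \<in> I \<and> \<kappa> b = \<kappa> a"
          then show ?thesis using ok[of b] by (simp add: pos_def observe_def)
        qed
        then show "(\<Prod>i\<in>I. indicator (A i) (V (time i) (\<omega> (\<kappa> i)))) *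
          kernel_mass a b (A a) (V (time b) (\<omega> (\<kappa> a))) = F (observe \<kappa> I \<omega>)"
          unfolding F_def by (simp add: observe_def)
      qed
    qed
    also have "\<dots> = (\<integral>\<^sup>+z. F z \<partial>distr Q (PiM I (\<lambda>_. \<mu>)) (observe \<kappa> I))"
      using mI mF by (simp add: nn_integral_distr)
    also have "\<dots> = (\<integral>\<^sup>+z. ennreal (path_weight (link z) \<kappa> ys) * F z \<partial>PiM I (\<lambda>_. \<mu>))"
      unfolding IH using mw mF by (intro nn_integral_density) auto
    \<comment> \<open>The integral inside \<open>kernel_mass\<close> becomes the integral over the
      new coordinate, and its density becomes the last factor of the path weight. The weight of
      \<open>ys\<close> does not depend on that coordinate.\<close>
    also have "\<dots> = (\<integral>\<^sup>+z. \<integral>\<^sup>+x. ennreal (path_weight (link (z(a := x))) \<kappa> (a # ys)) *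
        (\<Prod>i\<in>insert a I. indicator (A i) ((z(a := x)) i)) \<partial>\<mu> \<partial>PiM I (\<lambda>_. \<mu>))"
    proof (intro nn_integral_cong)
      fix z assume z: "z \<in> space (PiM I (\<lambda>_. \<mu>))"
      have pz: "pos z b \<in> S"
        using measurable_space[OF measurable_pos[OF b] z] by (simp add: space_state)
      have *: "ennreal (path_weight (link (z(a := x))) \<kappa> (a # ys)) *
          (\<Prod>i\<in>insert a I. indicator (A i) ((z(a := x)) i)) =
          ennreal (path_weight (link z) \<kappa> ys) * (\<Prod>i\<in>I. indicator (A i) (z i)) *
          (indicator (A a) x * ennreal (p (time a - time b) x (pos z b)))" if "x \<in> space \<mu>" for x
      proof -
        have "path_weight (link (z(a := x))) \<kappa> ys = path_weight (link z) \<kappa> ys"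
          using I(2) by (intro path_weight_link_cong) (auto simp: I_def)
        moreover have "link (z(a := x)) a b = p (time a - time b) x (pos z b)"
          using ba by (simp add: link_def pos_def)
        ultimately have "path_weight (link (z(a := x))) \<kappa> (a # ys) =
            path_weight (link z) \<kappa> ys * p (time a - time b) x (pos z b)"
          by (simp add: b_def)
        moreover have "(\<Prod>i\<in>I. indicator (A i) ((z(a := x)) i)) =
            (\<Prod>i\<in>I. indicator (A i) (z i) :: ennreal)"
          using I(2) by (intro prod.cong) auto
        moreover have "0 \<le> p (time a - time b) x (pos z b)"
          using that pz gap by (intro p_nonneg) (auto simp: space_state)
        ultimately show ?thesis
          using I w_nonneg[OF z] by (simp add: ennreal_mult ac_simps)
      qed
      have "(\<integral>\<^sup>+x. ennreal (path_weight (link (z(a := x))) \<kappa> (a # ys)) *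
          (\<Prod>i\<in>insert a I. indicator (A i) ((z(a := x)) i)) \<partial>\<mu>) =
          (\<integral>\<^sup>+x. ennreal (path_weight (link z) \<kappa> ys) * (\<Prod>i\<in>I. indicator (A i) (z i)) *
          (indicator (A a) x * ennreal (p (time a - time b) x (pos z b))) \<partial>\<mu>)"
        by (intro nn_integral_cong *)
      also have "\<dots> = ennreal (path_weight (link z) \<kappa> ys) * F z"
      proof (subst nn_integral_cmult)
        have "(\<lambda>x. p (time a - time b) x (pos z b)) \<in> borel_measurable \<mu>"
          using pz by (intro measurable_p gap) (auto simp: space_state)
        then show "(\<lambda>x. indicator (A a) x * ennreal (p (time a - time b) x (pos z b))) \<in> borel_measurable \<mu>"
          using A[of a] by auto
      qed (simp add: F_def kernel_mass_def mult.assoc)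
      finally show "ennreal (path_weight (link z) \<kappa> ys) * F z =
          (\<integral>\<^sup>+x. ennreal (path_weight (link (z(a := x))) \<kappa> (a # ys)) *
          (\<Prod>i\<in>insert a I. indicator (A i) ((z(a := x)) i)) \<partial>\<mu>)" by simp
    qed
    also have "\<dots> = (\<integral>\<^sup>+z. ennreal (path_weight (link z) \<kappa> (a # ys)) *
        (\<Prod>i\<in>insert a I. indicator (A i) (z i)) \<partial>PiM (insert a I) (\<lambda>_. \<mu>))"
    proof (rule states.product_nn_integral_insert[symmetric, OF I])
      show "(\<lambda>z. ennreal (path_weight (link z) \<kappa> (a # ys)) *
        (\<Prod>i\<in>insert a I. indicator (A i) (z i))) \<in> borel_measurable (PiM (insert a I) (\<lambda>_. \<mu>))"
        by (intro borel_measurable_times_ennreal borel_measurable_prod_ennreal mind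
            measurable_compose[OF mwJ measurable_ennreal])
    qed
    also have "\<dots> = (\<integral>\<^sup>+z. ennreal (path_weight (link z) \<kappa> (a # ys)) *
        indicator (Pi\<^sub>E (insert a I) A) z \<partial>PiM (insert a I) (\<lambda>_. \<mu>))"
      using I by (intro nn_integral_cong) (simp add: prod_indicator_PiE space_PiM PiE_def del: prod.insert)
    also have "\<dots> = emeasure (density (PiM (insert a I) (\<lambda>_. \<mu>))
        (\<lambda>z. ennreal (path_weight (link z) \<kappa> (a # ys)))) (Pi\<^sub>E (insert a I) A)"
      using mwJ A I by (intro emeasure_density[symmetric] sets_PiM_I_finite) auto
    finally show "emeasure (distr Q (PiM (insert a I) (\<lambda>_. \<mu>)) (observe \<kappa> (insert a I)))
        (Pi\<^sub>E (insert a I) A) = emeasure (density (PiM (insert a I) (\<lambda>_. \<mu>))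
        (\<lambda>z. ennreal (path_weight (link z) \<kappa> (a # ys)))) (Pi\<^sub>E (insert a I) A)" .
  qed (use I in simp_all)
qed

end

subsection \<open>Conditional expectation of the determinantal martingale\<close>

text \<open>Lets the indicator of a rectangle, a product over the particles, be absorbed row by
  row.\<close>

lemma det_on_row_scale:
  assumes "finite I"
  shows "det_on I (\<lambda>i j. c i * A i j) = prod c I * det_on I A"
  unfolding det_on_def sum_distrib_left
  by (intro sum.cong refl) (simp add: prod.distrib)

lemma borel_measurable_det_on:
  assumes "\<And>i j. i \<in> I \<Longrightarrow> j \<in> I \<Longrightarrow> (\<lambda>x. A x i j) \<in> borel_measurable B"
  shows "(\<lambda>x. det_on I (A x)) \<in> borel_measurable B"
  unfolding det_on_def
proof (intro borel_measurable_sum borel_measurable_times borel_measurable_const borel_measurable_prod)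
  fix \<sigma> i assume "\<sigma> \<in> {\<sigma>. \<sigma> permutes I}" "i \<in> I"
  then show "(\<lambda>x. A x i (\<sigma> i)) \<in> borel_measurable B"
    using assms[of i "\<sigma> i"] by (simp add: permutes_in_image)
qed

text \<open>Here \<open>mm k\<close> stands for the family at the parameter \<open>u k\<close> and
  \<open>f m\<close> for the test function at \<open>t m\<close>; both are addressed by index, so
  the complex parameter disappears.\<close>

locale martingale_particles = observed_particles TT S Om P V p N M u t
  for TT S :: "real set"
    and Om :: "'w measure"
    and P :: "real \<Rightarrow> 'w measure"
    and V :: "real \<Rightarrow> 'w \<Rightarrow> real"
    and p :: "real \<Rightarrow> real \<Rightarrow> real \<Rightarrow> real"
    and N M :: nat
    and u t :: "nat \<Rightarrow> real" +
  fixes T :: real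
    and mm :: "nat \<Rightarrow> real \<Rightarrow> real \<Rightarrow> real"
    and f :: "nat \<Rightarrow> real \<Rightarrow> real"
  assumes T_in_TT: "T \<in> TT"
    and t_le_T: "m \<in> {1..M} \<Longrightarrow> t m \<le> T"
    and mm_measurable: "r \<in> TT \<Longrightarrow> mm k r \<in> borel_measurable \<mu>"
    and mm_start: "j \<in> {1..N} \<Longrightarrow> k \<in> {1..N} \<Longrightarrow> mm k 0 (u j) = (if j = k then 1 else 0)"
    and mm_martingale: "j \<in> {1..N} \<Longrightarrow> k \<in> {1..N} \<Longrightarrow>
      martingale (P (u j)) \<F> (TT \<inter> {..T}) (\<lambda>r \<omega>. mm k r (V r \<omega>))"
    and f_measurable: "m \<in> {1..M} \<Longrightarrow> f m \<in> borel_measurable \<mu>"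
    and f_integrable: "integrable Q (\<lambda>\<omega>. (\<Prod>m\<in>{1..M}. \<Prod>j\<in>{1..N}. 1 + \<bar>f m (V (t m) (\<omega> j))\<bar>) *
      det_on {1..N} (\<lambda>j k. mm k T (V T (\<omega> j))))"
begin

text \<open>Every particle has its own evaluation time, because after the path expansion particle
  \<open>j\<close> is seen last at the end of its own path.\<close>

definition mm_det :: "(nat \<Rightarrow> real) \<Rightarrow> (nat \<Rightarrow> 'w) \<Rightarrow> real" where
  "mm_det s \<omega> = det_on {1..N} (\<lambda>j k. mm k (s j) (V (s j) (\<omega> j)))"

lemma time_le_T: "fst a \<le> M \<Longrightarrow> time a \<le> T"
  using t_le_T[of "fst a"] time_nonneg[OF T_in_TT] by (auto simp: time_def)

lemma mm_V_filtration:
  assumes "s \<in> TT" "s \<le> r"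
  shows "(\<lambda>w. mm k s (V s w)) \<in> borel_measurable (\<F> r)"
  by (rule measurable_compose[OF V_filtration[OF assms] mm_measurable[OF assms(1)]])

lemma integrable_mm:
  assumes "j \<in> {1..N}" "k \<in> {1..N}" "s \<in> TT" "s \<le> T"
  shows "integrable (P (u j)) (\<lambda>w. mm k s (V s w))"
  using mm_martingale[OF assms(1,2)] assms(3,4) by (auto simp: martingale_def)

lemma set_integral_mm:
  assumes "j \<in> {1..N}" "k \<in> {1..N}" "s \<in> TT" "s \<le> T" "A \<in> sets (\<F> s)"
  shows "(\<integral>w\<in>A. mm k T (V T w) \<partial>P (u j)) = (\<integral>w\<in>A. mm k s (V s w) \<partial>P (u j))"
proof (cases "s = T")
  case False
  then have "s < T" using assms(4) by simp
  interpret finite_measure_subalgebra "P (u j)" "\<F> s"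
    by (rule finite_measure_subalgebra_P) (rule u_in_S[OF assms(1)])
  have A: "A \<in> sets (P (u j))"
    using assms(5) sets_filtration_subset sets_P[OF u_in_S[OF assms(1)]] by blast
  have AE: "AE w in P (u j). real_cond_exp (P (u j)) (\<F> s) (\<lambda>w. mm k T (V T w)) w = mm k s (V s w)"
    using mm_martingale[OF assms(1,2)] assms(3) T_in_TT \<open>s < T\<close> by (auto simp: martingale_def)
  have "(\<integral>w\<in>A. mm k T (V T w) \<partial>P (u j)) =
      (\<integral>w\<in>A. real_cond_exp (P (u j)) (\<F> s) (\<lambda>w. mm k T (V T w)) w \<partial>P (u j))"
    by (rule real_cond_exp_intA[OF integrable_mm[OF assms(1,2) T_in_TT order_refl] assms(5)])
  also have "\<dots> = (\<integral>w\<in>A. mm k s (V s w) \<partial>P (u j))"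
  proof (rule set_lebesgue_integral_cong_AE[OF A])
    show "(\<lambda>w. mm k s (V s w)) \<in> borel_measurable (P (u j))"
      using integrable_mm[OF assms(1-4)] by simp
    show "AE w\<in>A in P (u j). real_cond_exp (P (u j)) (\<F> s) (\<lambda>w. mm k T (V T w)) w = mm k s (V s w)"
      using AE by eventually_elim simp
  qed simp
  finally show ?thesis .
qed simp

text \<open>Row \<open>j\<close> depends on particle \<open>j\<close> alone. Without test functions
  each Leibniz term is a product of independent integrable factors, so the expectation passes into
  the entries.\<close>

lemma det_integral:
  assumes "\<And>j k. j \<in> {1..N} \<Longrightarrow> k \<in> {1..N} \<Longrightarrow> integrable (P (u j)) (g j k)"
  shows "integrable Q (\<lambda>\<omega>. det_on {1..N} (\<lambda>j k. g j k (\<omega> j)))"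
    and "(\<integral>\<omega>. det_on {1..N} (\<lambda>j k. g j k (\<omega> j)) \<partial>Q) = det_on {1..N} (\<lambda>j k. \<integral>w. g j k w \<partial>P (u j))"
proof -
  have g: "integrable (Pu j) (g j (\<sigma> j))" if "\<sigma> permutes {1..N}" "j \<in> {1..N}" for \<sigma> j
    using that assms[of j "\<sigma> j"] permutes_in_image[OF that(1), of j] Pu_eq[OF that(2)] by metis
  have int: "integrable Q (\<lambda>\<omega>. \<Prod>j\<in>{1..N}. g j (\<sigma> j) (\<omega> j))" if "\<sigma> permutes {1..N}" for \<sigma>
    unfolding Q_eq by (rule copies.product_integrable_prod) (use g[OF that] in auto)
  then show "integrable Q (\<lambda>\<omega>. det_on {1..N} (\<lambda>j k. g j k (\<omega> j)))"
    unfolding det_on_def by (auto intro!: Bochner_Integration.integrable_sum)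
  have "(\<integral>\<omega>. (\<Prod>j\<in>{1..N}. g j (\<sigma> j) (\<omega> j)) \<partial>Q) = (\<Prod>j\<in>{1..N}. \<integral>w. g j (\<sigma> j) w \<partial>P (u j))"
    if "\<sigma> permutes {1..N}" for \<sigma>
  proof -
    have "(\<integral>\<omega>. (\<Prod>j\<in>{1..N}. g j (\<sigma> j) (\<omega> j)) \<partial>Q) = (\<Prod>j\<in>{1..N}. \<integral>w. g j (\<sigma> j) w \<partial>Pu j)"
      unfolding Q_eq by (rule copies.product_integral_prod) (use g[OF that] in auto)
    also have "\<dots> = (\<Prod>j\<in>{1..N}. \<integral>w. g j (\<sigma> j) w \<partial>P (u j))"
      by (intro prod.cong refl) (simp only: Pu_eq)
    finally show ?thesis .
  qed
  then show "(\<integral>\<omega>. det_on {1..N} (\<lambda>j k. g j k (\<omega> j)) \<partial>Q) =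
      det_on {1..N} (\<lambda>j k. \<integral>w. g j k w \<partial>P (u j))"
    unfolding det_on_def using int by (subst Bochner_Integration.integral_sum) auto
qed

lemma integrable_mm_det:
  assumes "\<And>j. j \<in> {1..N} \<Longrightarrow> s j \<in> TT \<and> s j \<le> T"
  shows "integrable Q (mm_det s)"
  unfolding mm_det_def using assms by (intro det_integral integrable_mm) auto

text \<open>Particle \<open>j\<close> is remembered up to its own time \<open>s j\<close>. The times
  may differ, so this is a product of sigma-algebras and not the joint past at one time.\<close>

definition past :: "(nat \<Rightarrow> real) \<Rightarrow> (nat \<Rightarrow> 'w) measure" where
  "past s = PiM {1..N} (\<lambda>j. \<F> (s j))"

lemma space_past: "space (past s) = space Q"
  by (simp add: past_def space_Q space_PiM space_filtration)

lemma subalgebra_past: "subalgebra Q (past s)"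
proof -
  have "(\<lambda>\<omega> j. \<omega> j) \<in> measurable Q (past s)"
    unfolding past_def
  proof (rule measurable_PiM_single')
    show "(\<lambda>\<omega>. \<omega> j) \<in> measurable Q (\<F> (s j))" if "j \<in> {1..N}" for j
    proof (rule measurable_coordinate[OF that])
      show "(\<lambda>w. w) \<in> measurable Om (\<F> (s j))"
        using sets_filtration_subset[of "s j"]
        by (intro measurableI) (auto simp: space_filtration Int_absorb2 dest: sets.sets_into_space)
    qed
  qed (auto simp: space_Q space_filtration)
  then have "A \<in> sets Q" if "A \<in> sets (past s)" for A
    using measurable_sets[OF _ that, of "\<lambda>\<omega>. \<omega>" Q] sets.sets_into_space[OF that]
    by (simp add: space_past Int_absorb2)
  then show ?thesis by (auto simp: subalgebra_def space_past)
qed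

text \<open>A Dynkin argument. On a rectangle the indicator is absorbed into the rows and the
  expectation into the entries, where the martingale property of each single particle applies.
  Integrability of both determinants handles complements and disjoint unions.\<close>

lemma set_integral_mm_det:
  assumes s: "\<And>j. j \<in> {1..N} \<Longrightarrow> s j \<in> TT \<and> s j \<le> T" and "A \<in> sets (past s)"
  shows "(\<integral>\<omega>\<in>A. mm_det (\<lambda>_. T) \<omega> \<partial>Q) = (\<integral>\<omega>\<in>A. mm_det s \<omega> \<partial>Q)"
proof -
  let ?G = "prod_algebra {1..N} (\<lambda>j. \<F> (s j))" and ?\<Omega> = "\<Pi>\<^sub>E j\<in>{1..N}. space (\<F> (s j))"
  have G: "sigma_sets ?\<Omega> ?G = sets (past s)" by (simp add: past_def sets_PiM)
  have sQ: "?\<Omega> = space Q" by (simp add: space_Q space_filtration)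
  have int: "integrable Q (mm_det (\<lambda>_. T))" "integrable Q (mm_det s)"
    using s T_in_TT by (auto intro!: integrable_mm_det)
  have in_Q: "B \<in> sets Q" if "B \<in> sets (past s)" for B
    using subalgebra_past[of s] that by (auto simp: subalgebra_def)
  have rect: "(\<integral>\<omega>\<in>Pi\<^sub>E {1..N} X. mm_det (\<lambda>_. T) \<omega> \<partial>Q) = (\<integral>\<omega>\<in>Pi\<^sub>E {1..N} X. mm_det s \<omega> \<partial>Q)"
    if X: "\<And>j. j \<in> {1..N} \<Longrightarrow> X j \<in> sets (\<F> (s j))" for X
  proof -
    \<comment> \<open>The evaluation times \<open>r\<close> are left free, since the formula is used
      for constant \<open>T\<close> and for \<open>s\<close> with the same rectangle.\<close>
    have factor: "(\<integral>\<omega>\<in>Pi\<^sub>E {1..N} X. mm_det r \<omega> \<partial>Q) =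
        det_on {1..N} (\<lambda>j k. \<integral>w\<in>X j. mm k (r j) (V (r j) w) \<partial>P (u j))"
      if r: "\<And>j. j \<in> {1..N} \<Longrightarrow> r j \<in> TT \<and> r j \<le> T" for r
    proof -
      have XP: "X j \<in> sets (P (u j))" if "j \<in> {1..N}" for j
        using X[OF that] sets_filtration_subset sets_P[OF u_in_S[OF that]] by blast
      have "(\<integral>\<omega>\<in>Pi\<^sub>E {1..N} X. mm_det r \<omega> \<partial>Q) =
          (\<integral>\<omega>. det_on {1..N} (\<lambda>j k. indicator (X j) (\<omega> j) * mm k (r j) (V (r j) (\<omega> j))) \<partial>Q)"
        unfolding set_lebesgue_integral_def
      proof (intro Bochner_Integration.integral_cong refl)
        fix \<omega> assume "\<omega> \<in> space Q"
        then have "\<omega> \<in> extensional {1..N}" by (simp add: space_Q PiE_def)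
        then have "indicator (Pi\<^sub>E {1..N} X) \<omega> = (\<Prod>j\<in>{1..N}. indicator (X j) (\<omega> j) :: real)"
          by (auto simp: indicator_def PiE_def Pi_def)
        then show "indicator (Pi\<^sub>E {1..N} X) \<omega> *\<^sub>R mm_det r \<omega> =
            det_on {1..N} (\<lambda>j k. indicator (X j) (\<omega> j) * mm k (r j) (V (r j) (\<omega> j)))"
          by (simp add: det_on_row_scale mm_det_def)
      qed
      also have "\<dots> = det_on {1..N} (\<lambda>j k. \<integral>w. indicator (X j) w * mm k (r j) (V (r j) w) \<partial>P (u j))"
      proof (rule det_integral)
        fix j k assume jk: "j \<in> {1..N}" "k \<in> {1..N}"
        show "integrable (P (u j)) (\<lambda>w. indicator (X j) w * mm k (r j) (V (r j) w))"
          using integrable_mult_indicator[OF XP[OF jk(1)] integrable_mm[OF jk]] r[OF jk(1)] by simp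
      qed
      finally show ?thesis by (simp add: set_lebesgue_integral_def)
    qed
    have "(\<integral>\<omega>\<in>Pi\<^sub>E {1..N} X. mm_det (\<lambda>_. T) \<omega> \<partial>Q) =
        det_on {1..N} (\<lambda>j k. \<integral>w\<in>X j. mm k T (V T w) \<partial>P (u j))"
      using T_in_TT by (intro factor) auto
    also have "\<dots> = det_on {1..N} (\<lambda>j k. \<integral>w\<in>X j. mm k (s j) (V (s j) w) \<partial>P (u j))"
      using s X by (intro det_on_cong set_integral_mm) auto
    also have "\<dots> = (\<integral>\<omega>\<in>Pi\<^sub>E {1..N} X. mm_det s \<omega> \<partial>Q)"
      using s by (intro factor[symmetric]) auto
    finally show ?thesis .
  qed
  \<comment> \<open>The whole space is a rectangle too; complements are handled by subtraction from
    it.\<close>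
  have whole: "(\<integral>\<omega>. mm_det (\<lambda>_. T) \<omega> \<partial>Q) = (\<integral>\<omega>. mm_det s \<omega> \<partial>Q)"
  proof -
    have "(\<integral>\<omega>\<in>space Q. mm_det (\<lambda>_. T) \<omega> \<partial>Q) = (\<integral>\<omega>\<in>space Q. mm_det s \<omega> \<partial>Q)"
      unfolding sQ[symmetric] by (rule rect) simp
    then show ?thesis
      using int by (simp add: set_integral_space)
  qed
  have "A \<in> sigma_sets ?\<Omega> ?G" using assms(2) G by simp
  from Int_stable_prod_algebra prod_algebra_sets_into_space this show ?thesis
  proof (induction rule: sigma_sets_induct_disjoint)
    case (basic A)
    then obtain X where "A = Pi\<^sub>E {1..N} X" "X \<in> (\<Pi> j\<in>{1..N}. sets (\<F> (s j)))"
      unfolding prod_algebra_eq_finite[OF finite_atLeastAtMost] by blast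
    then show ?case using rect[of X] by (simp add: Pi_iff)
  next
    case empty
    show ?case by (simp add: set_lebesgue_integral_def)
  next
    case (compl A)
    have A: "A \<in> sets Q" using compl(1) G in_Q by simp
    have "(\<integral>\<omega>\<in>?\<Omega> - A. g \<omega> \<partial>Q) = (\<integral>\<omega>. g \<omega> \<partial>Q) - (\<integral>\<omega>\<in>A. g \<omega> \<partial>Q)" if "integrable Q g" for g :: "_ \<Rightarrow> real"
    proof -
      have "(\<integral>\<omega>\<in>?\<Omega> - A. g \<omega> \<partial>Q) = (\<integral>\<omega>. g \<omega> - indicator A \<omega> * g \<omega> \<partial>Q)"
        unfolding set_lebesgue_integral_def sQ
        by (intro Bochner_Integration.integral_cong) (auto simp: indicator_def)
      also have "\<dots> = (\<integral>\<omega>. g \<omega> \<partial>Q) - (\<integral>\<omega>\<in>A. g \<omega> \<partial>Q)"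
        using integrable_mult_indicator[OF A that] that
        by (simp add: set_lebesgue_integral_def)
      finally show ?thesis .
    qed
    then show ?case using int compl(2) whole by simp
  next
    case (union A)
    have A: "A i \<in> sets Q" for i using union(2) G in_Q by auto
    have "(\<integral>\<omega>\<in>(\<Union>i. A i). g \<omega> \<partial>Q) = (\<Sum>i. \<integral>\<omega>\<in>A i. g \<omega> \<partial>Q)" if "integrable Q g" for g :: "_ \<Rightarrow> real"
    proof (rule lebesgue_integral_countable_add[OF A])
      show "A i \<inter> A j = {}" if "i \<noteq> j" for i j
        using union(1) that by (auto simp: disjoint_family_on_def)
      show "set_integrable Q (\<Union>i. A i) g"
        unfolding set_integrable_def using A that by (intro integrable_mult_indicator) auto
    qed
    then show ?case using int union(3) by simp
  qed
qed

text \<open>\<open>mm_det s\<close> is a version of the conditional expectation of the determinant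
  at \<open>T\<close> given \<open>past s\<close>. Pulling out \<open>G\<close> asks for
  integrability of the product only, so \<open>G\<close> may be unbounded.\<close>

lemma cond_exp_mm_det:
  assumes "\<And>j. j \<in> {1..N} \<Longrightarrow> s j \<in> TT \<and> s j \<le> T"
    and "G \<in> borel_measurable (past s)" "integrable Q (\<lambda>\<omega>. G \<omega> * mm_det (\<lambda>_. T) \<omega>)"
  shows "integrable Q (\<lambda>\<omega>. G \<omega> * mm_det s \<omega>)"
    and "(\<integral>\<omega>. G \<omega> * mm_det s \<omega> \<partial>Q) = (\<integral>\<omega>. G \<omega> * mm_det (\<lambda>_. T) \<omega> \<partial>Q)"
proof -
  interpret finite_measure_subalgebra Q "past s"
    by unfold_locales (rule subalgebra_past)
  have int: "integrable Q (mm_det (\<lambda>_. T))" "integrable Q (mm_det s)"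
    using assms(1) T_in_TT by (auto intro!: integrable_mm_det)
  have m: "mm_det s \<in> borel_measurable (past s)"
    unfolding mm_det_def
  proof (intro borel_measurable_det_on)
    fix j k assume j: "j \<in> {1..N}"
    have "(\<lambda>\<omega>. \<omega> j) \<in> measurable (past s) (\<F> (s j))"
      unfolding past_def using j by (rule measurable_component_singleton)
    moreover have "(\<lambda>w. mm k (s j) (V (s j) w)) \<in> borel_measurable (\<F> (s j))"
      using assms(1)[OF j] by (intro mm_V_filtration) auto
    ultimately show "(\<lambda>\<omega>. mm k (s j) (V (s j) (\<omega> j))) \<in> borel_measurable (past s)"
      by (rule measurable_compose)
  qed
  have AE: "AE \<omega> in Q. real_cond_exp Q (past s) (mm_det (\<lambda>_. T)) \<omega> = mm_det s \<omega>"
    by (rule real_cond_exp_charact[OF set_integral_mm_det[OF assms(1)] int m])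
  have mQ: "G \<in> borel_measurable Q" "mm_det (\<lambda>_. T) \<in> borel_measurable Q" "mm_det s \<in> borel_measurable Q"
    using measurable_from_subalg[OF subalgebra_past assms(2)] int by auto
  have AE': "AE \<omega> in Q. G \<omega> * real_cond_exp Q (past s) (mm_det (\<lambda>_. T)) \<omega> = G \<omega> * mm_det s \<omega>"
    using AE by eventually_elim simp
  note ce = real_cond_exp_intg[OF assms(3,2) mQ(2)]
  have mc: "(\<lambda>\<omega>. G \<omega> * real_cond_exp Q (past s) (mm_det (\<lambda>_. T)) \<omega>) \<in> borel_measurable Q"
    using ce(1) by simp
  have ms: "(\<lambda>\<omega>. G \<omega> * mm_det s \<omega>) \<in> borel_measurable Q"
    using mQ by simp
  show "integrable Q (\<lambda>\<omega>. G \<omega> * mm_det s \<omega>)"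
    using integrable_cong_AE[OF mc ms AE'] ce(1) by simp
  show "(\<integral>\<omega>. G \<omega> * mm_det s \<omega> \<partial>Q) = (\<integral>\<omega>. G \<omega> * mm_det (\<lambda>_. T) \<omega> \<partial>Q)"
    using integral_cong_AE[OF mc ms AE'] ce(2) by simp
qed

section \<open>Weighted determinants and path integrals\<close>

definition weighted :: "(nat \<times> nat) set \<Rightarrow> (nat \<Rightarrow> 'w) \<Rightarrow> real" where
  "weighted J \<omega> = (\<Prod>(m, k)\<in>J. f m (V (t m) (\<omega> k))) * mm_det (\<lambda>_. T) \<omega>"

text \<open>Each factor is bounded by \<open>1 + \<bar>f\<bar>\<close>, and the factors for pairs
  outside \<open>J\<close> are at least 1 and can be added. The dominating function does not depend
  on \<open>J\<close>.\<close>

lemma integrable_weighted: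
  assumes "J \<subseteq> {1..M} \<times> {1..N}"
  shows "integrable Q (weighted J)"
proof (rule Bochner_Integration.integrable_bound[OF f_integrable])
  have fV: "(\<lambda>\<omega>. f m (V (t m) (\<omega> k))) \<in> borel_measurable Q" if "(m, k) \<in> J" for m k
    using that assms t_in_TT
    by (intro measurable_coordinate measurable_compose[OF V_measurable_state f_measurable]) auto
  have "mm_det (\<lambda>_. T) \<in> borel_measurable Q"
    using integrable_mm_det[of "\<lambda>_. T"] T_in_TT by auto
  then show "weighted J \<in> borel_measurable Q"
    unfolding weighted_def using fV by (intro borel_measurable_times borel_measurable_prod) auto
  show "AE \<omega> in Q. norm (weighted J \<omega>) \<le> norm ((\<Prod>m\<in>{1..M}. \<Prod>j\<in>{1..N}. 1 + \<bar>f m (V (t m) (\<omega> j))\<bar>) *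
      det_on {1..N} (\<lambda>j k. mm k T (V T (\<omega> j))))"
  proof (rule AE_I2)
    fix \<omega> :: "nat \<Rightarrow> 'w"
    let ?h = "\<lambda>(m, j). \<bar>f m (V (t m) (\<omega> j))\<bar>"
    have "\<bar>\<Prod>(m, k)\<in>J. f m (V (t m) (\<omega> k))\<bar> = prod ?h J"
      by (simp add: abs_prod case_prod_unfold)
    also have "\<dots> \<le> (\<Prod>a\<in>J. 1 + ?h a)"
      by (intro prod_mono) auto
    also have "\<dots> \<le> (\<Prod>a\<in>{1..M} \<times> {1..N}. 1 + ?h a)"
      using assms by (intro prod_mono2) auto
    also have "\<dots> = (\<Prod>m\<in>{1..M}. \<Prod>j\<in>{1..N}. 1 + \<bar>f m (V (t m) (\<omega> j))\<bar>)"
      by (simp add: prod.cartesian_product case_prod_unfold)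
    finally have le: "\<bar>\<Prod>(m, k)\<in>J. f m (V (t m) (\<omega> k))\<bar> \<le>
        (\<Prod>m\<in>{1..M}. \<Prod>j\<in>{1..N}. 1 + \<bar>f m (V (t m) (\<omega> j))\<bar>)" .
    then show "norm (weighted J \<omega>) \<le> norm ((\<Prod>m\<in>{1..M}. \<Prod>j\<in>{1..N}. 1 + \<bar>f m (V (t m) (\<omega> j))\<bar>) *
        det_on {1..N} (\<lambda>j k. mm k T (V T (\<omega> j))))"
      unfolding weighted_def mm_det_def real_norm_def abs_mult
      by (intro mult_right_mono order_trans[OF le abs_ge_self]) auto
  qed
qed

definition mm_point :: "(nat \<times> nat \<Rightarrow> real) \<Rightarrow> nat \<Rightarrow> nat \<times> nat \<Rightarrow> real" where
  "mm_point z k b = mm k (time b) (pos z b)"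

definition path_term :: "(nat \<times> nat \<Rightarrow> nat) \<Rightarrow> (nat \<times> nat) list \<Rightarrow> (nat \<times> nat \<Rightarrow> real) \<Rightarrow> real" where
  "path_term \<kappa> ys z = (\<Prod>a\<in>set ys. f (fst a) (z a)) *
     (path_weight (link z) \<kappa> ys * det_on {1..N} (\<lambda>j k. mm_point z k (path_end \<kappa> ys j)))"

text \<open>The path weight is the density of the observed positions, which turns the integral into
  an expectation with each particle evaluated at its path end; conditioning then moves all
  evaluation times to \<open>T\<close>. The result depends on \<kappa> only through the set of
  visited pairs of time and particle.\<close>

proposition path_term_integral:
  assumes "admissible \<kappa> ys"
  shows "integrable (PiM (set ys) (\<lambda>_. \<mu>)) (path_term \<kappa> ys)"
    and "(\<integral>z. path_term \<kappa> ys z \<partial>PiM (set ys) (\<lambda>_. \<mu>)) =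
      (\<integral>\<omega>. weighted ((\<lambda>a. (fst a, \<kappa> a)) ` set ys) \<omega> \<partial>Q)"
proof -
  let ?I = "set ys" and ?PM = "PiM (set ys) (\<lambda>_. \<mu>)" and ?e = "path_end \<kappa> ys"
  define s where "s j = time (?e j)" for j
  define G where "G \<omega> = (\<Prod>a\<in>?I. f (fst a) (V (time a) (\<omega> (\<kappa> a))))" for \<omega>
  define g where "g z = (\<Prod>a\<in>?I. f (fst a) (z a)) * det_on {1..N} (\<lambda>j k. mm_point z k (?e j))" for z
  have ok: "1 \<le> fst a \<and> fst a \<le> M \<and> \<kappa> a \<in> {1..N}" if "a \<in> ?I" for a
    using assms that by (auto simp: admissible_def)
  have sorted: "sorted_wrt (\<lambda>a b. fst b \<le> fst a) ys" and inj: "inj_on (\<lambda>a. (fst a, \<kappa> a)) ?I"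
    using assms by (auto simp: admissible_def)
  have e_cases: "?e j = (0, j) \<or> ?e j \<in> ?I \<and> \<kappa> (?e j) = j" for j
    by (rule path_end_cases)
  have e_le: "fst (?e j) \<le> M" for j
    using e_cases[of j] ok[of "?e j"] by auto
  have s: "s j \<in> TT \<and> s j \<le> T" for j
    unfolding s_def using time_in_TT[OF e_le] time_le_T[OF e_le] by simp
  have mG: "G \<in> borel_measurable (past s)"
    unfolding G_def past_def
  proof (intro borel_measurable_prod)
    fix a assume a: "a \<in> ?I"
    \<comment> \<open>The path of a particle ends at or after each of its points, so every test
      function is measurable with respect to the past of its particle.\<close>
    have "time a \<le> s (\<kappa> a)"
      unfolding s_def using path_end_latest[OF sorted a] e_le by (rule time_le)
    then have "V (time a) \<in> measurable (\<F> (s (\<kappa> a))) \<mu>"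
      using ok[OF a] by (intro V_filtration time_in_TT) auto
    then have "(\<lambda>w. f (fst a) (V (time a) w)) \<in> borel_measurable (\<F> (s (\<kappa> a)))"
      using ok[OF a] by (intro measurable_compose[OF _ f_measurable]) auto
    then show "(\<lambda>\<omega>. f (fst a) (V (time a) (\<omega> (\<kappa> a)))) \<in> borel_measurable (PiM {1..N} (\<lambda>j. \<F> (s j)))"
      using ok[OF a] measurable_compose[OF measurable_component_singleton[of "\<kappa> a" "{1..N}" "\<lambda>j. \<F> (s j)"]]
      by auto
  qed
  have weighted_eq: "weighted ((\<lambda>a. (fst a, \<kappa> a)) ` ?I) \<omega> = G \<omega> * mm_det (\<lambda>_. T) \<omega>" for \<omega>
  proof -
    have "(\<Prod>(m, k)\<in>(\<lambda>a. (fst a, \<kappa> a)) ` ?I. f m (V (t m) (\<omega> k))) =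
        (\<Prod>a\<in>?I. f (fst a) (V (t (fst a)) (\<omega> (\<kappa> a))))"
      by (subst prod.reindex[OF inj]) simp
    also have "\<dots> = G \<omega>"
      unfolding G_def
    proof (intro prod.cong refl)
      fix a assume "a \<in> ?I"
      then show "f (fst a) (V (t (fst a)) (\<omega> (\<kappa> a))) = f (fst a) (V (time a) (\<omega> (\<kappa> a)))"
        using ok[of a] by (simp add: time_def)
    qed
    finally show ?thesis by (simp add: weighted_def)
  qed
  have intGT: "integrable Q (\<lambda>\<omega>. G \<omega> * mm_det (\<lambda>_. T) \<omega>)"
  proof -
    have "integrable Q (weighted ((\<lambda>a. (fst a, \<kappa> a)) ` ?I))"
      using ok by (intro integrable_weighted) auto
    then show ?thesis unfolding weighted_eq[abs_def] .
  qed
  note ce = cond_exp_mm_det[OF s mG intGT]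
  have b: "?e j = (0, j) \<and> j \<in> {1..N} \<or> ?e j \<in> ?I \<and> 1 \<le> fst (?e j)" if "j \<in> {1..N}" for j
    using e_cases[of j] ok[of "?e j"] that by auto
  have mobs: "observe \<kappa> ?I \<in> measurable Q ?PM"
    using ok by (intro measurable_observe) auto
  have AE: "AE \<omega> in Q. G \<omega> * mm_det s \<omega> = g (observe \<kappa> ?I \<omega>)"
    using AE_start
  proof eventually_elim
    fix \<omega> assume start: "\<forall>k\<in>{1..N}. V 0 (\<omega> k) = u k"
    have "pos (observe \<kappa> ?I \<omega>) (?e j) = V (s j) (\<omega> j)" if j: "j \<in> {1..N}" for j
      using e_cases[of j]
    proof
      assume "?e j = (0, j)"
      then show ?thesis using start j by (simp add: pos_def time_def s_def)
    next
      assume "?e j \<in> ?I \<and> \<kappa> (?e j) = j"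
      then show ?thesis using ok[of "?e j"] by (simp add: pos_def observe_def s_def)
    qed
    then have "det_on {1..N} (\<lambda>j k. mm_point (observe \<kappa> ?I \<omega>) k (?e j)) = mm_det s \<omega>"
      unfolding mm_det_def by (intro det_on_cong) (simp add: mm_point_def s_def)
    then show "G \<omega> * mm_det s \<omega> = g (observe \<kappa> ?I \<omega>)"
      by (simp add: g_def G_def observe_def)
  qed
  have mg: "g \<in> borel_measurable ?PM"
    unfolding g_def
  proof (intro borel_measurable_times borel_measurable_prod borel_measurable_det_on)
    show "(\<lambda>z. f (fst a) (z a)) \<in> borel_measurable ?PM" if "a \<in> ?I" for a
      by (rule measurable_compose[OF measurable_component_singleton[OF that] f_measurable])
        (use ok[OF that] in simp)
    show "(\<lambda>z. mm_point z k (?e j)) \<in> borel_measurable ?PM" if "j \<in> {1..N}" for j k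
      unfolding mm_point_def
      by (rule measurable_compose[OF measurable_pos[OF b[OF that]] mm_measurable[OF time_in_TT[OF e_le]]])
  qed
  have mgobs: "(\<lambda>\<omega>. g (observe \<kappa> ?I \<omega>)) \<in> borel_measurable Q"
    by (rule measurable_compose[OF mobs mg])
  have mw: "(\<lambda>z. path_weight (link z) \<kappa> ys) \<in> borel_measurable ?PM"
    and w_nonneg: "AE z in ?PM. 0 \<le> path_weight (link z) \<kappa> ys"
    using path_weight_link[OF assms order_refl] by (auto intro!: AE_I2)
  have mGs: "(\<lambda>\<omega>. G \<omega> * mm_det s \<omega>) \<in> borel_measurable Q" using ce(1) by simp
  have eq: "path_term \<kappa> ys = (\<lambda>z. path_weight (link z) \<kappa> ys *\<^sub>R g z)"
    by (simp add: fun_eq_iff path_term_def g_def)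
  have "integrable Q (\<lambda>\<omega>. g (observe \<kappa> ?I \<omega>))"
    using integrable_cong_AE[OF mGs mgobs AE] ce(1) by simp
  then have "integrable (distr Q ?PM (observe \<kappa> ?I)) g"
    using integrable_distr_eq[OF mobs mg] by simp
  then show "integrable ?PM (path_term \<kappa> ys)"
    unfolding law_observe[OF assms] integrable_density[OF mg mw w_nonneg] eq .
  have "(\<integral>z. path_term \<kappa> ys z \<partial>?PM) = integral\<^sup>L (distr Q ?PM (observe \<kappa> ?I)) g"
    unfolding law_observe[OF assms] integral_density[OF mg mw w_nonneg] eq ..
  also have "\<dots> = (\<integral>\<omega>. g (observe \<kappa> ?I \<omega>) \<partial>Q)"
    by (rule integral_distr[OF mobs mg])
  also have "\<dots> = (\<integral>\<omega>. G \<omega> * mm_det s \<omega> \<partial>Q)"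
    by (rule integral_cong_AE[OF mGs mgobs AE, symmetric])
  also have "\<dots> = (\<integral>\<omega>. weighted ((\<lambda>a. (fst a, \<kappa> a)) ` ?I) \<omega> \<partial>Q)"
    using ce(2) by (simp add: weighted_eq)
  finally show "(\<integral>z. path_term \<kappa> ys z \<partial>?PM) = (\<integral>\<omega>. weighted ((\<lambda>a. (fst a, \<kappa> a)) ` ?I) \<omega> \<partial>Q)" .
qed

end

subsection \<open>Relabelling points of equal time\<close>

text \<open>The product of the symmetric groups of the levels, encoded as permutations of all
  points.\<close>

definition level_perms :: "(nat \<times> nat) set \<Rightarrow> (nat \<times> nat \<Rightarrow> nat \<times> nat) set" where
  "level_perms I = {\<pi>. \<pi> permutes I \<and> (\<forall>a. fst (\<pi> a) = fst a)}"

text \<open>The distributions of points among particles that send distinct points of a level to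
  distinct particles; all others have path weight 0.\<close>

definition labellings :: "(nat \<times> nat) set \<Rightarrow> nat \<Rightarrow> (nat \<times> nat \<Rightarrow> nat) set" where
  "labellings I N = {\<kappa> \<in> I \<rightarrow>\<^sub>E {1..N}. inj_on (\<lambda>a. (fst a, \<kappa> a)) I}"

lemma level_perms_permutes: "\<pi> \<in> level_perms I \<Longrightarrow> \<pi> permutes I"
  and level_perms_fst: "\<pi> \<in> level_perms I \<Longrightarrow> fst (\<pi> a) = fst a"
  unfolding level_perms_def by blast+

lemma finite_level_perms: "finite I \<Longrightarrow> finite (level_perms I)"
  unfolding level_perms_def by (rule finite_subset[OF _ finite_permutations]) auto

lemma card_level_perms_pos: "finite I \<Longrightarrow> 0 < card (level_perms I)"
  using finite_level_perms[of I] by (auto simp: card_gt_0_iff level_perms_def intro!: exI[of _ id] permutes_id)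

lemma finite_labellings: "finite I \<Longrightarrow> finite (labellings I N)"
  unfolding labellings_def by (rule finite_subset[OF _ finite_PiE[of I "\<lambda>_. {1..N}"]]) auto

text \<open>Precomposition lets the level permutations act on the labellings with a given image.
  Injectivity of the labelling makes the action free, and equality of images makes it
  transitive.\<close>

lemma card_labellings_same_image:
  assumes "finite I" "\<kappa> \<in> labellings I N"
  shows "card {\<kappa>' \<in> labellings I N. (\<lambda>a. (fst a, \<kappa>' a)) ` I = (\<lambda>a. (fst a, \<kappa> a)) ` I} =
    card (level_perms I)"
proof (rule bij_betw_same_card[symmetric, of "\<lambda>\<pi>. \<kappa> \<circ> \<pi>"], rule bij_betw_imageI)
  let ?h = "\<lambda>\<kappa> a. (fst a, \<kappa> a)"
  have \<kappa>: "\<kappa> \<in> I \<rightarrow>\<^sub>E {1..N}" "inj_on (?h \<kappa>) I"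
    using assms(2) by (auto simp: labellings_def)
  show "inj_on (\<lambda>\<pi>. \<kappa> \<circ> \<pi>) (level_perms I)"
  proof (rule inj_onI)
    fix \<pi> \<pi>' assume \<pi>: "\<pi> \<in> level_perms I" "\<pi>' \<in> level_perms I" "\<kappa> \<circ> \<pi> = \<kappa> \<circ> \<pi>'"
    show "\<pi> = \<pi>'"
    proof
      fix a
      show "\<pi> a = \<pi>' a"
      proof (cases "a \<in> I")
        case True
        then have "\<pi> a \<in> I" "\<pi>' a \<in> I" using \<pi> by (auto simp: permutes_in_image dest: level_perms_permutes)
        moreover have "?h \<kappa> (\<pi> a) = ?h \<kappa> (\<pi>' a)"
          using fun_cong[OF \<pi>(3), of a] by (simp add: level_perms_fst[OF \<pi>(1)] level_perms_fst[OF \<pi>(2)])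
        ultimately show ?thesis by (rule inj_onD[OF \<kappa>(2), rotated])
      next
        case False
        then show ?thesis using \<pi>(1,2) by (simp add: permutes_not_in[OF level_perms_permutes])
      qed
    qed
  qed
  show "(\<lambda>\<pi>. \<kappa> \<circ> \<pi>) ` level_perms I = {\<kappa>' \<in> labellings I N. ?h \<kappa>' ` I = ?h \<kappa> ` I}"
  proof (intro equalityI subsetI)
    fix \<kappa>' assume "\<kappa>' \<in> (\<lambda>\<pi>. \<kappa> \<circ> \<pi>) ` level_perms I"
    then obtain \<pi> where \<pi>: "\<pi> permutes I" "\<And>a. fst (\<pi> a) = fst a" "\<kappa>' = \<kappa> \<circ> \<pi>"
      using level_perms_permutes level_perms_fst by blast
    have h: "?h \<kappa>' = ?h \<kappa> \<circ> \<pi>" using \<pi>(2,3) by (simp add: comp_def)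
    have "\<kappa>' \<in> I \<rightarrow>\<^sub>E {1..N}"
      using \<kappa>(1) \<pi>(1,3) by (auto simp: PiE_iff permutes_in_image extensional_def permutes_not_in)
    moreover have "inj_on (?h \<kappa>') I"
      unfolding h using \<kappa>(2) permutes_image[OF \<pi>(1)] permutes_inj_on[OF \<pi>(1)]
      by (intro comp_inj_on) auto
    moreover have "?h \<kappa>' ` I = ?h \<kappa> ` I"
      unfolding h image_comp[symmetric] permutes_image[OF \<pi>(1)] ..
    ultimately show "\<kappa>' \<in> {\<kappa>' \<in> labellings I N. ?h \<kappa>' ` I = ?h \<kappa> ` I}"
      by (simp add: labellings_def)
  next
    fix \<kappa>' assume "\<kappa>' \<in> {\<kappa>' \<in> labellings I N. ?h \<kappa>' ` I = ?h \<kappa> ` I}"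
    then have \<kappa>': "\<kappa>' \<in> I \<rightarrow>\<^sub>E {1..N}" "inj_on (?h \<kappa>') I" "?h \<kappa>' ` I = ?h \<kappa> ` I"
      by (auto simp: labellings_def)
    \<comment> \<open>Follow \<kappa>' to a pair and return along \<kappa>. The level is part of the
      pair, so it is preserved.\<close>
    define \<pi> where "\<pi> a = (if a \<in> I then inv_into I (?h \<kappa>) (?h \<kappa>' a) else a)" for a
    have h\<pi>: "?h \<kappa> (\<pi> a) = ?h \<kappa>' a" "\<pi> a \<in> I" if "a \<in> I" for a
    proof -
      have "?h \<kappa>' a \<in> ?h \<kappa> ` I" using that \<kappa>'(3) by blast
      then show "?h \<kappa> (\<pi> a) = ?h \<kappa>' a" "\<pi> a \<in> I"
        unfolding \<pi>_def using that f_inv_into_f[of "?h \<kappa>' a" "?h \<kappa>" I] inv_into_into[of "?h \<kappa>' a" "?h \<kappa>" I]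
        by auto
    qed
    have "inj_on \<pi> I"
    proof (rule inj_onI)
      fix a b assume "a \<in> I" "b \<in> I" "\<pi> a = \<pi> b"
      then have "?h \<kappa>' a = ?h \<kappa>' b" using h\<pi>(1)[of a] h\<pi>(1)[of b] by simp
      then show "a = b" using \<open>a \<in> I\<close> \<open>b \<in> I\<close> by (rule inj_onD[OF \<kappa>'(2)])
    qed
    moreover from this have "\<pi> ` I = I"
      using assms(1) h\<pi>(2) by (intro endo_inj_surj image_subsetI) blast+
    ultimately have "\<pi> permutes I"
      by (intro bij_imp_permutes) (auto simp: bij_betw_def \<pi>_def)
    moreover have "fst (\<pi> a) = fst a" for a
      using h\<pi>(1)[of a] by (cases "a \<in> I") (auto simp: \<pi>_def)
    moreover have "\<kappa>' = \<kappa> \<circ> \<pi>"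
    proof
      fix a
      show "\<kappa>' a = (\<kappa> \<circ> \<pi>) a"
        using h\<pi>(1)[of a] PiE_arb[OF \<kappa>(1), of a] PiE_arb[OF \<kappa>'(1), of a]
        by (cases "a \<in> I") (auto simp: \<pi>_def)
    qed
    ultimately show "\<kappa>' \<in> (\<lambda>\<pi>. \<kappa> \<circ> \<pi>) ` level_perms I"
      unfolding level_perms_def by blast
  qed
qed

lemma labellings_image:
  assumes "\<kappa> \<in> labellings (SIGMA m:{1..M}. {1..n m}) N" "m \<in> {1..M}"
  shows "card {k. (m, k) \<in> (\<lambda>a. (fst a, \<kappa> a)) ` (SIGMA m:{1..M}. {1..n m})} = n m"
proof -
  have "{k. (m, k) \<in> (\<lambda>a. (fst a, \<kappa> a)) ` (SIGMA m:{1..M}. {1..n m})} =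
      (\<lambda>j. \<kappa> (m, j)) ` {1..n m}" (is "?L = ?R")
  proof (intro equalityI subsetI)
    fix k assume "k \<in> ?L"
    then obtain a where a: "a \<in> (SIGMA m:{1..M}. {1..n m})" "m = fst a" "k = \<kappa> a" by blast
    then show "k \<in> ?R" by (intro image_eqI[of _ _ "snd a"]) auto
  next
    fix k assume "k \<in> ?R"
    then obtain j where j: "j \<in> {1..n m}" "k = \<kappa> (m, j)" by blast
    then have "(m, k) \<in> (\<lambda>a. (fst a, \<kappa> a)) ` (SIGMA m:{1..M}. {1..n m})"
      using assms(2) by (intro image_eqI[of _ _ "(m, j)"]) auto
    then show "k \<in> ?L" by simp
  qed
  moreover have "inj_on (\<lambda>j. \<kappa> (m, j)) {1..n m}"
  proof (rule inj_onI)
    fix j j' assume "j \<in> {1..n m}" "j' \<in> {1..n m}" "\<kappa> (m, j) = \<kappa> (m, j')"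
    moreover have "inj_on (\<lambda>a. (fst a, \<kappa> a)) (SIGMA m:{1..M}. {1..n m})"
      using assms(1) unfolding labellings_def by blast
    ultimately show "j = j'"
      using inj_onD[of "\<lambda>a. (fst a, \<kappa> a)" _ "(m, j)" "(m, j')"] assms(2) by simp
  qed
  ultimately show ?thesis by (simp add: card_image)
qed

lemma ex_labelling:
  assumes "J \<subseteq> {1..M} \<times> {1..N}" "\<And>m. m \<in> {1..M} \<Longrightarrow> card {k. (m, k) \<in> J} = n m"
  obtains \<kappa> where "\<kappa> \<in> labellings (SIGMA m:{1..M}. {1..n m}) N"
    "(\<lambda>a. (fst a, \<kappa> a)) ` (SIGMA m:{1..M}. {1..n m}) = J"
proof -
  let ?I = "SIGMA m:{1..M}. {1..n m}"
  have "\<exists>h. bij_betw h {1..n m} {k. (m, k) \<in> J}" if "m \<in> {1..M}" for m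
  proof -
    have "{k. (m, k) \<in> J} \<subseteq> {1..N}" using assms(1) by auto
    then have "finite {k. (m, k) \<in> J}" by (rule finite_subset) simp
    from ex_bij_betw_nat_finite_1[OF this] show ?thesis using assms(2)[OF that] by simp
  qed
  then obtain h where h: "\<And>m. m \<in> {1..M} \<Longrightarrow> bij_betw (h m) {1..n m} {k. (m, k) \<in> J}"
    by metis
  define \<kappa> where "\<kappa> = restrict (\<lambda>a. h (fst a) (snd a)) ?I"
  have \<kappa>: "\<kappa> (m, j) = h m j" if "m \<in> {1..M}" "j \<in> {1..n m}" for m j
    using that by (simp add: \<kappa>_def)
  have mem: "(m, h m j) \<in> J" if "m \<in> {1..M}" "j \<in> {1..n m}" for m j
    using bij_betwE[OF h[OF that(1)]] that(2) by blast
  have "\<kappa> \<in> ?I \<rightarrow>\<^sub>E {1..N}"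
  proof (rule PiE_I)
    fix a assume "a \<in> ?I"
    then obtain m j where a: "a = (m, j)" "m \<in> {1..M}" "j \<in> {1..n m}" by blast
    then show "\<kappa> a \<in> {1..N}" using mem[OF a(2,3)] assms(1) \<kappa>[OF a(2,3)] by auto
  qed (simp add: \<kappa>_def)
  moreover have "inj_on (\<lambda>a. (fst a, \<kappa> a)) ?I"
  proof (rule inj_onI)
    fix a b assume "a \<in> ?I" "b \<in> ?I" and eq: "(fst a, \<kappa> a) = (fst b, \<kappa> b)"
    then obtain m j j' where ab: "a = (m, j)" "b = (m, j')" "m \<in> {1..M}" "j \<in> {1..n m}" "j' \<in> {1..n m}"
      by auto
    then have "h m j = h m j'" using eq \<kappa> by simp
    then have "j = j'" using ab h[of m] by (auto simp: bij_betw_def dest: inj_onD)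
    then show "a = b" using ab by simp
  qed
  moreover have "(\<lambda>a. (fst a, \<kappa> a)) ` ?I = J"
  proof (intro equalityI subsetI)
    fix c assume "c \<in> (\<lambda>a. (fst a, \<kappa> a)) ` ?I"
    then show "c \<in> J" using \<kappa> mem by force
  next
    fix c assume c: "c \<in> J"
    then obtain m k where mk: "c = (m, k)" "m \<in> {1..M}" using assms(1) by blast
    then have "k \<in> h m ` {1..n m}" using c h[of m] by (auto simp: bij_betw_def)
    then obtain j where "j \<in> {1..n m}" "k = h m j" by blast
    then have "c = (fst (m, j), \<kappa> (m, j))" "(m, j) \<in> ?I" using mk \<kappa> by auto
    then show "c \<in> (\<lambda>a. (fst a, \<kappa> a)) ` ?I" by blast
  qed
  ultimately show ?thesis by (intro that[of \<kappa>]) (auto simp: labellings_def)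
qed

text \<open>Grouping by image: the images are precisely the sets \<open>J\<close> with
  \<open>n m\<close> particles at level \<open>m\<close>, and each of them comes from as many
  labellings as there are level permutations.\<close>

lemma sum_labellings:
  fixes H :: "(nat \<times> nat) set \<Rightarrow> real"
  shows "(\<Sum>\<kappa>\<in>labellings (SIGMA m:{1..M}. {1..n m}) N. H ((\<lambda>a. (fst a, \<kappa> a)) ` (SIGMA m:{1..M}. {1..n m}))) =
    card (level_perms (SIGMA m:{1..M}. {1..n m})) *
    (\<Sum>J | J \<subseteq> {1..M} \<times> {1..N} \<and> (\<forall>m\<in>{1..M}. card {k. (m, k) \<in> J} = n m). H J)"
proof -
  let ?I = "SIGMA m:{1..M}. {1..n m}" and ?h = "\<lambda>\<kappa> a. (fst a, \<kappa> a)"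
  let ?JS = "{J. J \<subseteq> {1..M} \<times> {1..N} \<and> (\<forall>m\<in>{1..M}. card {k. (m, k) \<in> J} = n m)}"
  have fin: "finite ?I" "finite ?JS"
    by (auto intro: finite_subset[of _ "Pow ({1..M} \<times> {1..N})"])
  have "(\<Sum>\<kappa>\<in>labellings ?I N. H (?h \<kappa> ` ?I)) =
      (\<Sum>J\<in>?JS. \<Sum>\<kappa> | \<kappa> \<in> labellings ?I N \<and> ?h \<kappa> ` ?I = J. H (?h \<kappa> ` ?I))"
  proof (rule sum.group[symmetric, OF finite_labellings[OF fin(1)] fin(2)])
    show "(\<lambda>\<kappa>. ?h \<kappa> ` ?I) ` labellings ?I N \<subseteq> ?JS"
    proof (rule image_subsetI)
      fix \<kappa> assume \<kappa>: "\<kappa> \<in> labellings ?I N"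
      then have "?h \<kappa> ` ?I \<subseteq> {1..M} \<times> {1..N}" by (auto simp: labellings_def dest: PiE_mem)
      then show "?h \<kappa> ` ?I \<in> ?JS" using labellings_image[OF \<kappa>] by simp
    qed
  qed
  also have "\<dots> = (\<Sum>J\<in>?JS. card (level_perms ?I) * H J)"
  proof (intro sum.cong refl)
    fix J assume "J \<in> ?JS"
    then obtain \<kappa> where \<kappa>: "\<kappa> \<in> labellings ?I N" "?h \<kappa> ` ?I = J"
      using ex_labelling[of J M N n] by blast
    have "(\<Sum>\<kappa> | \<kappa> \<in> labellings ?I N \<and> ?h \<kappa> ` ?I = J. H (?h \<kappa> ` ?I)) =
        (\<Sum>\<kappa> | \<kappa> \<in> labellings ?I N \<and> ?h \<kappa> ` ?I = J. H J)"
      by (intro sum.cong) auto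
    also have "\<dots> = card (level_perms ?I) * H J"
      using card_labellings_same_image[OF fin(1) \<kappa>(1)] \<kappa>(2) by simp
    finally show "(\<Sum>\<kappa> | \<kappa> \<in> labellings ?I N \<and> ?h \<kappa> ` ?I = J. H (?h \<kappa> ` ?I)) =
        card (level_perms ?I) * H J" .
  qed
  finally show ?thesis by (simp add: sum_distrib_left)
qed

section \<open>Sorting the variables of a level\<close>

lemma strict_mono_on_unique:
  fixes g h :: "nat \<Rightarrow> real"
  assumes "strict_mono_on {1..n} g" "strict_mono_on {1..n} h" "g ` {1..n} = h ` {1..n}" "j \<in> {1..n}"
  shows "g j = h j"
proof -
  have *: "sorted (map g [1..<Suc n]) \<and> distinct (map g [1..<Suc n])" if "strict_mono_on {1..n} g"
    for g :: "nat \<Rightarrow> real"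
  proof -
    have "sorted_wrt (<) (map g [1..<Suc n])"
      unfolding sorted_wrt_map
      by (rule sorted_wrt_mono_rel[OF _ sorted_wrt_upt]) (use that in \<open>auto simp: strict_mono_on_def\<close>)
    then show ?thesis using strict_sorted_iff by blast
  qed
  have "map g [1..<Suc n] = map h [1..<Suc n]"
    using *[OF assms(1)] *[OF assms(2)] assms(3)
    by (intro sorted_distinct_set_unique) (auto simp: atLeastLessThanSuc_atLeastAtMost simp del: upt_Suc)
  then show ?thesis using assms(4) by (auto simp: atLeastLessThanSuc_atLeastAtMost simp del: upt_Suc)
qed

lemma ex_strict_mono_enum:
  fixes X :: "real set"
  assumes "finite X"
  obtains h where "strict_mono_on {1..card X} h" "h ` {1..card X} = X"
proof -
  let ?l = "sorted_list_of_set X"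
  have len: "length ?l = card X" by simp
  have set: "set ?l = X" using assms by simp
  \<comment> \<open>Lists are indexed from 0, the variables of a level from 1.\<close>
  show ?thesis
  proof (rule that[of "\<lambda>j. ?l ! (j - 1)"])
    show "strict_mono_on {1..card X} (\<lambda>j. ?l ! (j - 1))"
    proof (rule strict_mono_onI)
      fix r s assume "r \<in> {1..card X}" "s \<in> {1..card X}" "r < s"
      then show "?l ! (r - 1) < ?l ! (s - 1)"
        by (intro sorted_wrt_nth_less[OF strict_sorted_list_of_set]) (auto simp: len)
    qed
    have "(\<lambda>j. ?l ! (j - 1)) ` {1..card X} = (!) ?l ` ((\<lambda>j. j - 1) ` {1..card X})"
      by (simp add: image_image)
    also have "(\<lambda>j. j - 1) ` {1..card X} = {..<length ?l}"
      unfolding len by (force simp: image_iff intro!: bexI[of _ "Suc _"])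
    also have "(!) ?l ` {..<length ?l} = X"
      using set by (simp add: set_conv_nth image_def) blast
    finally show "(\<lambda>j. ?l ! (j - 1)) ` {1..card X} = X" .
  qed
qed

lemma level_perms_image:
  assumes "\<pi> \<in> level_perms (SIGMA m:{1..M}. {1..n m})" "m \<in> {1..M}"
  shows "(\<lambda>j. \<pi> (m, j)) ` {1..n m} = Pair m ` {1..n m}"
proof (intro equalityI subsetI)
  let ?I = "SIGMA m:{1..M}. {1..n m}"
  note \<pi> = level_perms_permutes[OF assms(1)] level_perms_fst[OF assms(1)]
  fix c
  {
    assume "c \<in> (\<lambda>j. \<pi> (m, j)) ` {1..n m}"
    then obtain j where j: "j \<in> {1..n m}" "c = \<pi> (m, j)" by blast
    then have "c \<in> ?I" using assms(2) permutes_in_image[OF \<pi>(1), of "(m, j)"] by simp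
    moreover have "fst c = m" using \<pi>(2)[of "(m, j)"] j by simp
    ultimately show "c \<in> Pair m ` {1..n m}" by (intro image_eqI[of _ _ "snd c"]) auto
  next
    assume "c \<in> Pair m ` {1..n m}"
    then have "c \<in> ?I" "fst c = m" using assms(2) by auto
    then obtain b where b: "b \<in> ?I" "c = \<pi> b" using permutes_image[OF \<pi>(1)] by blast
    then have "fst b = m" using \<pi>(2)[of b] \<open>fst c = m\<close> by simp
    then show "c \<in> (\<lambda>j. \<pi> (m, j)) ` {1..n m}"
      using b by (intro image_eqI[of _ _ "snd b"]) auto
  }
qed

text \<open>Both existence and uniqueness come from the increasing enumeration of the values on each
  level. Absence of coincidences is what determines the permutation from the sorted values.\<close>

lemma ex1_sorting:
  fixes z :: "nat \<times> nat \<Rightarrow> real" and n :: "nat \<Rightarrow> nat" and M :: nat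
  defines "I \<equiv> SIGMA m:{1..M}. {1..n m}"
  assumes inj: "\<And>m. m \<in> {1..M} \<Longrightarrow> inj_on (\<lambda>j. z (m, j)) {1..n m}"
  shows "\<exists>!\<pi>. \<pi> \<in> level_perms I \<and> (\<forall>m\<in>{1..M}. strict_mono_on {1..n m} (\<lambda>j. z (\<pi> (m, j))))"
proof (rule ex_ex1I)
  have "\<exists>h. strict_mono_on {1..n m} h \<and> h ` {1..n m} = (\<lambda>j. z (m, j)) ` {1..n m}"
    if m: "m \<in> {1..M}" for m
  proof -
    have "card ((\<lambda>j. z (m, j)) ` {1..n m}) = n m" using inj[OF m] by (simp add: card_image)
    then show ?thesis
      using ex_strict_mono_enum[of "(\<lambda>j. z (m, j)) ` {1..n m}"] by (metis finite_atLeastAtMost finite_imageI)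
  qed
  then obtain h where h: "\<And>m. m \<in> {1..M} \<Longrightarrow> strict_mono_on {1..n m} (h m)"
    "\<And>m. m \<in> {1..M} \<Longrightarrow> h m ` {1..n m} = (\<lambda>j. z (m, j)) ` {1..n m}"
    by metis
  \<comment> \<open>The index at which the \<open>j\<close>-th smallest value of level
    \<open>m\<close> originally stands.\<close>
  define \<sigma> where "\<sigma> m j = inv_into {1..n m} (\<lambda>j. z (m, j)) (h m j)" for m j
  have \<sigma>: "\<sigma> m j \<in> {1..n m}" "z (m, \<sigma> m j) = h m j" if "m \<in> {1..M}" "j \<in> {1..n m}" for m j
  proof -
    have *: "h m j \<in> (\<lambda>j. z (m, j)) ` {1..n m}" using h(2)[OF that(1)] that(2) by blast
    show "\<sigma> m j \<in> {1..n m}" unfolding \<sigma>_def using * by (rule inv_into_into)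
    show "z (m, \<sigma> m j) = h m j" unfolding \<sigma>_def using f_inv_into_f[OF *] .
  qed
  define \<pi> where "\<pi> a = (if a \<in> I then (fst a, \<sigma> (fst a) (snd a)) else a)" for a
  have \<pi>I: "\<pi> (m, j) = (m, \<sigma> m j)" if "m \<in> {1..M}" "j \<in> {1..n m}" for m j
    using that by (simp add: \<pi>_def I_def)
  have "inj_on \<pi> I"
  proof (rule inj_onI)
    fix a b assume "a \<in> I" "b \<in> I" and eq: "\<pi> a = \<pi> b"
    then obtain m j m' j' where ab: "a = (m, j)" "b = (m', j')" "m \<in> {1..M}" "j \<in> {1..n m}"
      "m' \<in> {1..M}" "j' \<in> {1..n m'}" unfolding I_def by blast
    then have "m = m'" "\<sigma> m j = \<sigma> m j'" using eq \<pi>I by auto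
    then have "h m j = h m j'" using \<sigma>(2) ab by metis
    then have "j = j'"
      using strict_mono_on_imp_inj_on[OF h(1)[OF ab(3)]] ab \<open>m = m'\<close> by (auto dest: inj_onD)
    then show "a = b" using ab \<open>m = m'\<close> by simp
  qed
  moreover have "finite I" by (simp add: I_def)
  moreover have "\<pi> ` I \<subseteq> I"
  proof (rule image_subsetI)
    fix a assume "a \<in> I"
    then obtain m j where "a = (m, j)" "m \<in> {1..M}" "j \<in> {1..n m}" unfolding I_def by blast
    then show "\<pi> a \<in> I" using \<sigma>(1)[of m j] by (simp add: \<pi>I I_def)
  qed
  ultimately have "bij_betw \<pi> I I" by (auto simp: bij_betw_def endo_inj_surj)
  then have "\<pi> permutes I" by (rule bij_imp_permutes) (simp add: \<pi>_def)
  moreover have "fst (\<pi> a) = fst a" for a by (simp add: \<pi>_def)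
  ultimately have "\<pi> \<in> level_perms I" unfolding level_perms_def by blast
  moreover have "strict_mono_on {1..n m} (\<lambda>j. z (\<pi> (m, j)))" if "m \<in> {1..M}" for m
    using h(1)[OF that] that by (simp add: strict_mono_on_def \<pi>I \<sigma>(2))
  ultimately show "\<exists>\<pi>. \<pi> \<in> level_perms I \<and> (\<forall>m\<in>{1..M}. strict_mono_on {1..n m} (\<lambda>j. z (\<pi> (m, j))))"
    by blast
next
  fix \<pi> \<pi>'
  assume "\<pi> \<in> level_perms I \<and> (\<forall>m\<in>{1..M}. strict_mono_on {1..n m} (\<lambda>j. z (\<pi> (m, j))))"
    and "\<pi>' \<in> level_perms I \<and> (\<forall>m\<in>{1..M}. strict_mono_on {1..n m} (\<lambda>j. z (\<pi>' (m, j))))"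
  then have \<pi>: "\<pi> \<in> level_perms I" "\<pi>' \<in> level_perms I"
    and mono: "\<And>m. m \<in> {1..M} \<Longrightarrow> strict_mono_on {1..n m} (\<lambda>j. z (\<pi> (m, j)))"
      "\<And>m. m \<in> {1..M} \<Longrightarrow> strict_mono_on {1..n m} (\<lambda>j. z (\<pi>' (m, j)))"
    by blast+
  show "\<pi> = \<pi>'"
  proof
    fix a
    show "\<pi> a = \<pi>' a"
    proof (cases "a \<in> I")
      case True
      then obtain m j where a: "a = (m, j)" "m \<in> {1..M}" "j \<in> {1..n m}" unfolding I_def by blast
      have im: "(\<lambda>j. \<rho> (m, j)) ` {1..n m} = Pair m ` {1..n m}" if "\<rho> \<in> level_perms I" for \<rho>
        using level_perms_image[of \<rho> M n m] that a(2) unfolding I_def by blast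
      have "z ` ((\<lambda>j. \<pi> (m, j)) ` {1..n m}) = z ` ((\<lambda>j. \<pi>' (m, j)) ` {1..n m})"
        unfolding im[OF \<pi>(1)] im[OF \<pi>(2)] ..
      then have zeq: "z (\<pi> (m, j)) = z (\<pi>' (m, j))"
        using strict_mono_on_unique[OF mono(1)[OF a(2)] mono(2)[OF a(2)] _ a(3)]
        by (simp add: image_image)
      have "\<pi> (m, j) \<in> Pair m ` {1..n m}" "\<pi>' (m, j) \<in> Pair m ` {1..n m}"
        using im[OF \<pi>(1)] im[OF \<pi>(2)] a(3) by blast+
      then obtain i i' where i: "\<pi> (m, j) = (m, i)" "\<pi>' (m, j) = (m, i')" "i \<in> {1..n m}" "i' \<in> {1..n m}"
        by blast
      then have "i = i'" using zeq inj_onD[OF inj[OF a(2)], of i i'] by simp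
      then show ?thesis using i a by simp
    next
      case False
      then show ?thesis
        using permutes_not_in[OF level_perms_permutes[OF \<pi>(1)]]
          permutes_not_in[OF level_perms_permutes[OF \<pi>(2)]] by simp
    qed
  qed
qed

subsection \<open>Flattening and reindexing product measures\<close>

text \<open>The Fredholm series integrates over a nested product, the paths live on points
  \<open>(m, j)\<close>. Rectangles pull back to nested rectangles of the same mass, which
  identifies the measures.\<close>

lemma distr_PiM_flatten:
  fixes \<mu> :: "'a measure" and n :: "nat \<Rightarrow> nat" and M :: nat
  assumes "sigma_finite_measure \<mu>"
  defines "I \<equiv> SIGMA m:{1..M}. {1..n m}"
  defines "F \<equiv> \<lambda>x. \<lambda>a\<in>I. x (fst a) (snd a)"
  shows "F \<in> measurable (\<Pi>\<^sub>M m\<in>{1..M}. \<Pi>\<^sub>M j\<in>{1..n m}. \<mu>) (PiM I (\<lambda>_. \<mu>))"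
    and "distr (\<Pi>\<^sub>M m\<in>{1..M}. \<Pi>\<^sub>M j\<in>{1..n m}. \<mu>) (PiM I (\<lambda>_. \<mu>)) F = PiM I (\<lambda>_. \<mu>)"
proof -
  interpret flat: product_sigma_finite "\<lambda>_ :: nat \<times> nat. \<mu>"
    using assms(1) by (simp add: product_sigma_finite_def)
  interpret inner: product_sigma_finite "\<lambda>_ :: nat. \<mu>"
    using assms(1) by (simp add: product_sigma_finite_def)
  interpret outer: product_sigma_finite "\<lambda>m. \<Pi>\<^sub>M j\<in>{1..n m}. \<mu>"
    by (simp add: product_sigma_finite_def inner.sigma_finite)
  let ?N = "\<Pi>\<^sub>M m\<in>{1..M}. \<Pi>\<^sub>M j\<in>{1..n m}. \<mu>"
  show mF: "F \<in> measurable ?N (PiM I (\<lambda>_. \<mu>))"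
    unfolding F_def
  proof (rule measurable_restrict)
    fix a assume "a \<in> I"
    then have "fst a \<in> {1..M}" "snd a \<in> {1..n (fst a)}" by (auto simp: I_def)
    then show "(\<lambda>x. x (fst a) (snd a)) \<in> measurable ?N \<mu>"
      by (intro measurable_compose[OF measurable_component_singleton[of "fst a" "{1..M}"]
            measurable_component_singleton[of "snd a"]])
  qed
  show "distr ?N (PiM I (\<lambda>_. \<mu>)) F = PiM I (\<lambda>_. \<mu>)"
  proof (rule flat.PiM_eqI)
    show "finite I" by (simp add: I_def)
    fix A :: "nat \<times> nat \<Rightarrow> 'a set" assume A: "\<And>a. a \<in> I \<Longrightarrow> A a \<in> sets \<mu>"
    have A': "A (m, j) \<in> sets \<mu>" if "m \<in> {1..M}" "j \<in> {1..n m}" for m j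
      using A[of "(m, j)"] that by (simp add: I_def)
    have "F -` Pi\<^sub>E I A \<inter> space ?N = (\<Pi>\<^sub>E m\<in>{1..M}. \<Pi>\<^sub>E j\<in>{1..n m}. A (m, j))"
    proof (intro equalityI subsetI)
      fix x assume x: "x \<in> F -` Pi\<^sub>E I A \<inter> space ?N"
      have "x m \<in> (\<Pi>\<^sub>E j\<in>{1..n m}. A (m, j))" if m: "m \<in> {1..M}" for m
      proof (rule PiE_I)
        fix j assume "j \<in> {1..n m}"
        then have "(m, j) \<in> I" using m by (simp add: I_def)
        moreover from this have "F x (m, j) \<in> A (m, j)" using x by (blast dest: PiE_mem)
        ultimately show "x m j \<in> A (m, j)" by (simp add: F_def)
      next
        fix j assume "j \<notin> {1..n m}"
        moreover have "x m \<in> space (\<Pi>\<^sub>M j\<in>{1..n m}. \<mu>)" using x m by (auto simp: space_PiM dest: PiE_mem)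
        ultimately show "x m j = undefined" by (auto simp: space_PiM dest: PiE_arb)
      qed
      moreover have "x \<in> extensional {1..M}" using x by (auto simp: space_PiM PiE_def)
      ultimately show "x \<in> (\<Pi>\<^sub>E m\<in>{1..M}. \<Pi>\<^sub>E j\<in>{1..n m}. A (m, j))" by (simp add: PiE_iff)
    next
      fix x assume x: "x \<in> (\<Pi>\<^sub>E m\<in>{1..M}. \<Pi>\<^sub>E j\<in>{1..n m}. A (m, j))"
      have xA: "x m j \<in> A (m, j)" if "m \<in> {1..M}" "j \<in> {1..n m}" for m j
        using PiE_mem[OF PiE_mem[OF x that(1)] that(2)] .
      have "F x \<in> Pi\<^sub>E I A"
        unfolding F_def using xA by (auto simp: I_def)
      moreover have "(\<Pi>\<^sub>E m\<in>{1..M}. \<Pi>\<^sub>E j\<in>{1..n m}. A (m, j)) \<subseteq>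
          (\<Pi>\<^sub>E m\<in>{1..M}. \<Pi>\<^sub>E j\<in>{1..n m}. space \<mu>)"
        by (intro PiE_mono sets.sets_into_space A')
      then have "x \<in> space ?N"
        using x by (simp only: space_PiM) blast
      ultimately show "x \<in> F -` Pi\<^sub>E I A \<inter> space ?N" by simp
    qed
    then have "emeasure (distr ?N (PiM I (\<lambda>_. \<mu>)) F) (Pi\<^sub>E I A) =
        emeasure ?N (\<Pi>\<^sub>E m\<in>{1..M}. \<Pi>\<^sub>E j\<in>{1..n m}. A (m, j))"
      using mF A by (subst emeasure_distr) (auto intro!: sets_PiM_I_finite simp: I_def)
    also have "\<dots> = (\<Prod>m\<in>{1..M}. emeasure (\<Pi>\<^sub>M j\<in>{1..n m}. \<mu>) (\<Pi>\<^sub>E j\<in>{1..n m}. A (m, j)))"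
      using A' by (intro outer.emeasure_PiM sets_PiM_I_finite) auto
    also have "\<dots> = (\<Prod>m\<in>{1..M}. \<Prod>j\<in>{1..n m}. emeasure \<mu> (A (m, j)))"
      using A' by (intro prod.cong refl inner.emeasure_PiM) auto
    also have "\<dots> = (\<Prod>a\<in>I. emeasure \<mu> (A a))"
      unfolding I_def by (subst prod.Sigma) (auto simp: case_prod_unfold)
    finally show "emeasure (distr ?N (PiM I (\<lambda>_. \<mu>)) F) (Pi\<^sub>E I A) = (\<Prod>a\<in>I. emeasure \<mu> (A a))" .
  qed simp
qed

text \<open>The preimage of a rectangle is the rectangle with permuted sides, and its mass is the
  same product in another order.\<close>

lemma distr_PiM_permute:
  fixes \<mu> :: "'a measure"
  assumes "sigma_finite_measure \<mu>" "finite I" "\<pi> permutes I"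
  shows "(\<lambda>z. \<lambda>a\<in>I. z (\<pi> a)) \<in> measurable (PiM I (\<lambda>_. \<mu>)) (PiM I (\<lambda>_. \<mu>))"
    and "distr (PiM I (\<lambda>_. \<mu>)) (PiM I (\<lambda>_. \<mu>)) (\<lambda>z. \<lambda>a\<in>I. z (\<pi> a)) = PiM I (\<lambda>_. \<mu>)"
proof -
  interpret product_sigma_finite "\<lambda>_ :: 'b. \<mu>"
    using assms(1) by (simp add: product_sigma_finite_def)
  let ?F = "\<lambda>z. \<lambda>a\<in>I. z (\<pi> a)" and ?PM = "PiM I (\<lambda>_. \<mu>)"
  show mF: "?F \<in> measurable ?PM ?PM"
    using permutes_in_image[OF assms(3)] by (intro measurable_restrict measurable_component_singleton) simp
  show "distr ?PM ?PM ?F = ?PM"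
  proof (rule PiM_eqI[OF assms(2)])
    fix A :: "'b \<Rightarrow> 'a set" assume A: "\<And>a. a \<in> I \<Longrightarrow> A a \<in> sets \<mu>"
    have inv: "inv \<pi> b \<in> I \<longleftrightarrow> b \<in> I" for b
      using permutes_in_image[OF permutes_inv[OF assms(3)]] .
    have A': "A (inv \<pi> b) \<in> sets \<mu>" if "b \<in> I" for b using A that inv by blast
    have "?F -` Pi\<^sub>E I A \<inter> space ?PM = (\<Pi>\<^sub>E b\<in>I. A (inv \<pi> b))"
    proof (intro equalityI subsetI)
      fix z assume z: "z \<in> ?F -` Pi\<^sub>E I A \<inter> space ?PM"
      show "z \<in> (\<Pi>\<^sub>E b\<in>I. A (inv \<pi> b))"
      proof (rule PiE_I)
        fix b assume "b \<in> I"
        then have "?F z (inv \<pi> b) \<in> A (inv \<pi> b)" using z inv by (auto dest: PiE_mem)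
        then show "z b \<in> A (inv \<pi> b)" using inv \<open>b \<in> I\<close> permutes_inverses(1)[OF assms(3)] by simp
      qed (use z in \<open>auto simp: space_PiM dest: PiE_arb\<close>)
    next
      fix z assume z: "z \<in> (\<Pi>\<^sub>E b\<in>I. A (inv \<pi> b))"
      have "z (\<pi> a) \<in> A a" if "a \<in> I" for a
        using PiE_mem[OF z, of "\<pi> a"] that permutes_in_image[OF assms(3)] permutes_inverses(2)[OF assms(3)]
        by simp
      then have "?F z \<in> Pi\<^sub>E I A" by auto
      moreover have "(\<Pi>\<^sub>E b\<in>I. A (inv \<pi> b)) \<subseteq> space ?PM"
        unfolding space_PiM using sets.sets_into_space[OF A'] by (intro PiE_mono) auto
      ultimately show "z \<in> ?F -` Pi\<^sub>E I A \<inter> space ?PM" using z by blast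
    qed
    then have "emeasure (distr ?PM ?PM ?F) (Pi\<^sub>E I A) = emeasure ?PM (\<Pi>\<^sub>E b\<in>I. A (inv \<pi> b))"
      using mF A assms(2) by (subst emeasure_distr) (auto intro!: sets_PiM_I_finite)
    also have "\<dots> = (\<Prod>b\<in>I. emeasure \<mu> (A (inv \<pi> b)))"
      using A' assms(2) by (intro emeasure_PiM) auto
    also have "\<dots> = (\<Prod>a\<in>I. emeasure \<mu> (A a))"
      using prod.reindex_bij_betw[OF permutes_imp_bij[OF permutes_inv[OF assms(3)]]] .
    finally show "emeasure (distr ?PM ?PM ?F) (Pi\<^sub>E I A) = (\<Prod>a\<in>I. emeasure \<mu> (A a))" .
  qed simp
qed

subsection \<open>The Fredholm expansion\<close>

context martingale_particles
begin

definition points :: "(nat \<Rightarrow> nat) \<Rightarrow> (nat \<times> nat) set" where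
  "points n = (SIGMA m:{1..M}. {1..n m})"

abbreviation "states_measure n \<equiv> PiM (points n) (\<lambda>_. \<mu>)"

text \<open>The correlation kernel at points, in the Schur complement form required by
  \<open>det_on_paths\<close>.\<close>

definition kernel :: "(nat \<times> nat \<Rightarrow> real) \<Rightarrow> nat \<times> nat \<Rightarrow> nat \<times> nat \<Rightarrow> real" where
  "kernel z a b = (\<Sum>k\<in>{1..N}. link z a (0, k) * mm_point z k b) - link z a b"

definition integrand :: "(nat \<Rightarrow> nat) \<Rightarrow> (nat \<times> nat \<Rightarrow> real) \<Rightarrow> real" where
  "integrand n z = (\<Prod>a\<in>points n. f (fst a) (z a)) * det_on (points n) (kernel z)"

text \<open>Only the order of the values is recorded; membership in \<open>S\<close> and
  extensionality come from the space of \<open>states_measure n\<close>.\<close>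

definition chamber :: "(nat \<Rightarrow> nat) \<Rightarrow> (nat \<times> nat \<Rightarrow> real) set" where
  "chamber n = {z. \<forall>m\<in>{1..M}. strict_mono_on {1..n m} (\<lambda>j. z (m, j))}"

lemma finite_points: "finite (points n)"
  by (simp add: points_def)

lemma fst_points: "a \<in> points n \<Longrightarrow> 1 \<le> fst a \<and> fst a \<le> M"
  by (auto simp: points_def)

section \<open>Integrating the path expansion\<close>

lemma ex_time_ordered_list:
  obtains ys where "set ys = points n" "distinct ys" "sorted_wrt (\<lambda>a b. fst b \<le> fst a) ys"
proof -
  obtain xs where xs: "set xs = points n" "distinct xs"
    using finite_distinct_list[OF finite_points] by blast
  have "sorted_wrt (\<lambda>a b. fst a \<le> fst b) (sort_key fst xs)"
    using sorted_sort_key[of fst xs] by (simp add: sorted_map)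
  then show ?thesis
    using xs by (intro that[of "rev (sort_key fst xs)"]) (auto simp: sorted_wrt_rev)
qed

text \<open>The path expansion with \<open>mm_start\<close> as the identity block. Maps that are not
  labellings drop out because some particle would be at two points of one level.\<close>

lemma integrand_paths:
  assumes "set ys = points n" "distinct ys" "sorted_wrt (\<lambda>a b. fst b \<le> fst a) ys"
  shows "integrand n z = (\<Sum>\<kappa>\<in>labellings (points n) N. path_term \<kappa> ys z)"
proof -
  have pos: "0 < fst a" if "a \<in> set ys" for a
    using fst_points[of a n] that assms(1) by simp
  have link0: "link z a b = 0" if "fst a \<le> fst b" for a b
    using that by (simp add: link_def)
  have start: "mm_point z k (0, k') = (if k = k' then 1 else 0)" if "k \<in> {1..N}" "k' \<in> {1..N}" for k k'
    using mm_start[OF that(2,1)] by (auto simp: mm_point_def pos_def time_def)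
  have "det_on (points n) (kernel z) =
      (\<Sum>\<kappa>\<in>points n \<rightarrow>\<^sub>E {1..N}. path_weight (link z) \<kappa> ys *
        det_on {1..N} (\<lambda>j k. mm_point z k (path_end \<kappa> ys j)))"
    using det_on_paths[OF assms(2,3) pos link0 start] unfolding assms(1) kernel_def[abs_def] .
  also have "\<dots> = (\<Sum>\<kappa>\<in>labellings (points n) N. path_weight (link z) \<kappa> ys *
        det_on {1..N} (\<lambda>j k. mm_point z k (path_end \<kappa> ys j)))"
  proof (rule sum.mono_neutral_right)
    show "finite (points n \<rightarrow>\<^sub>E {1..N})" by (intro finite_PiE finite_points) simp
    show "labellings (points n) N \<subseteq> points n \<rightarrow>\<^sub>E {1..N}" unfolding labellings_def by blast
    show "\<forall>\<kappa>\<in>(points n \<rightarrow>\<^sub>E {1..N}) - labellings (points n) N. path_weight (link z) \<kappa> ys *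
        det_on {1..N} (\<lambda>j k. mm_point z k (path_end \<kappa> ys j)) = 0"
    proof
      fix \<kappa> assume "\<kappa> \<in> (points n \<rightarrow>\<^sub>E {1..N}) - labellings (points n) N"
      then have "\<not> inj_on (\<lambda>a. (fst a, \<kappa> a)) (points n)" unfolding labellings_def by blast
      then obtain a b where "a \<in> points n" "b \<in> points n" "a \<noteq> b" "(fst a, \<kappa> a) = (fst b, \<kappa> b)"
        unfolding inj_on_def by blast
      then have "path_weight (link z) \<kappa> ys = 0"
        using assms link0 by (intro path_weight_eq_0[of ys "link z" a b]) simp_all
      then show "path_weight (link z) \<kappa> ys *
        det_on {1..N} (\<lambda>j k. mm_point z k (path_end \<kappa> ys j)) = 0" by simp
    qed
  qed
  finally show ?thesis
    unfolding integrand_def path_term_def assms(1) by (simp only: sum_distrib_left)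
qed

text \<open>Integrability holds because the integrand is a finite sum of integrable path terms.
  Their integrals see only the image of the labelling, so equal ones are counted together.\<close>

lemma integrand_integral:
  shows "integrable (states_measure n) (integrand n)"
    and "(\<integral>z. integrand n z \<partial>states_measure n) = card (level_perms (points n)) *
      (\<Sum>J | J \<subseteq> {1..M} \<times> {1..N} \<and> (\<forall>m\<in>{1..M}. card {k. (m, k) \<in> J} = n m). \<integral>\<omega>. weighted J \<omega> \<partial>Q)"
proof -
  obtain ys where ys: "set ys = points n" "distinct ys" "sorted_wrt (\<lambda>a b. fst b \<le> fst a) ys"
    by (rule ex_time_ordered_list)
  note eq = integrand_paths[OF ys]
  have adm: "admissible \<kappa> ys" if "\<kappa> \<in> labellings (points n) N" for \<kappa>
    unfolding admissible_def
  proof (intro conjI ballI)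
    show "distinct ys" "sorted_wrt (\<lambda>a b. fst b \<le> fst a) ys" by fact+
    show "inj_on (\<lambda>a. (fst a, \<kappa> a)) (set ys)" using that ys(1) by (simp add: labellings_def)
    show "1 \<le> fst a" "fst a \<le> M" "\<kappa> a \<in> {1..N}" if "a \<in> set ys" for a
      using that ys(1) fst_points[of a n] \<open>\<kappa> \<in> labellings (points n) N\<close>
      unfolding labellings_def by (blast dest: PiE_mem)+
  qed
  note paths = path_term_integral[OF adm, unfolded ys(1)]
  show "integrable (states_measure n) (integrand n)"
    unfolding eq[abs_def] using paths(1) by (intro Bochner_Integration.integrable_sum) auto
  have "(\<integral>z. integrand n z \<partial>states_measure n) =
      (\<Sum>\<kappa>\<in>labellings (points n) N. \<integral>z. path_term \<kappa> ys z \<partial>states_measure n)"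
    unfolding eq by (rule Bochner_Integration.integral_sum) (rule paths(1))
  also have "\<dots> = (\<Sum>\<kappa>\<in>labellings (points n) N. \<integral>\<omega>. weighted ((\<lambda>a. (fst a, \<kappa> a)) ` points n) \<omega> \<partial>Q)"
    by (intro sum.cong refl paths(2))
  also have "\<dots> = card (level_perms (points n)) *
      (\<Sum>J | J \<subseteq> {1..M} \<times> {1..N} \<and> (\<forall>m\<in>{1..M}. card {k. (m, k) \<in> J} = n m). \<integral>\<omega>. weighted J \<omega> \<partial>Q)"
    unfolding points_def by (rule sum_labellings)
  finally show "(\<integral>z. integrand n z \<partial>states_measure n) = card (level_perms (points n)) *
      (\<Sum>J | J \<subseteq> {1..M} \<times> {1..N} \<and> (\<forall>m\<in>{1..M}. card {k. (m, k) \<in> J} = n m). \<integral>\<omega>. weighted J \<omega> \<partial>Q)" .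
qed

section \<open>Symmetry and reduction to the chamber\<close>

lemma integrand_coincidence:
  assumes "a \<in> points n" "b \<in> points n" "a \<noteq> b" "fst a = fst b" "z a = z b"
  shows "integrand n z = 0"
proof -
  \<comment> \<open>A point enters its row of the kernel only through its links, which depend on its
    level and its value; so two rows agree.\<close>
  have link: "link z a c = link z b c" for c
    using assms(4,5) by (simp add: link_def time_def)
  have "det_on (points n) (kernel z) = 0"
    by (rule det_on_identical_rows[OF finite_points assms(1-3)]) (simp add: kernel_def link)
  then show ?thesis by (simp add: integrand_def)
qed

text \<open>Relabelling within levels keeps all times, so it applies one permutation to rows and
  columns of the kernel matrix alike and leaves the determinant unchanged.\<close>

lemma integrand_permute:
  assumes "\<pi> \<in> level_perms (points n)"
  shows "integrand n (\<lambda>a\<in>points n. z (\<pi> a)) = integrand n z"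
proof -
  note \<pi> = level_perms_permutes[OF assms] level_perms_fst[OF assms]
  let ?I = "points n" and ?z = "\<lambda>a\<in>points n. z (\<pi> a)"
  have \<pi>I: "\<pi> a \<in> ?I \<longleftrightarrow> a \<in> ?I" for a by (rule permutes_in_image[OF \<pi>(1)])
  have time: "time (\<pi> a) = time a" for a by (simp add: time_def \<pi>(2))
  have link: "link ?z a b = link z (\<pi> a) (\<pi> b)" if "a \<in> ?I" "b \<in> ?I" for a b
    using that fst_points[of b n] by (simp add: link_def pos_def time \<pi>(2))
  have link0: "link ?z a (0, k) = link z (\<pi> a) (0, k)" if "a \<in> ?I" for a k
    using that by (simp add: link_def pos_def time \<pi>(2))
  have point: "mm_point ?z k b = mm_point z k (\<pi> b)" if "b \<in> ?I" for k b
    using that fst_points[of b n] by (simp add: mm_point_def pos_def time \<pi>(2))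
  have "det_on ?I (kernel ?z) = det_on ?I (\<lambda>a b. kernel z (\<pi> a) (\<pi> b))"
    by (rule det_on_cong) (simp add: kernel_def link link0 point)
  also have "\<dots> = det_on (\<pi> ` ?I) (kernel z)"
    by (rule det_on_reindex[symmetric, OF finite_points permutes_inj_on[OF \<pi>(1)]])
  finally have det: "det_on ?I (kernel ?z) = det_on ?I (kernel z)"
    by (simp only: permutes_image[OF \<pi>(1)])
  have "(\<Prod>a\<in>?I. f (fst a) (?z a)) = (\<Prod>a\<in>?I. f (fst (\<pi> a)) (z (\<pi> a)))"
    by (rule prod.cong) (simp_all add: \<pi>(2))
  also have "\<dots> = (\<Prod>a\<in>?I. f (fst a) (z a))"
    by (rule prod.reindex_bij_betw[OF permutes_imp_bij[OF \<pi>(1)]])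
  finally show ?thesis by (simp add: integrand_def det)
qed

lemma chamber_measurable: "chamber n \<inter> space (states_measure n) \<in> sets (states_measure n)"
proof -
  have "{z \<in> space (states_measure n). \<forall>m\<in>{1..M}. \<forall>j\<in>{1..n m}. \<forall>j'\<in>{1..n m}. j < j' \<longrightarrow> z (m, j) < z (m, j')}
      \<in> sets (states_measure n)"
  proof (intro sets.sets_Collect_finite_All sets.sets_Collect_imp sets.sets_Collect_const)
    fix m j j' assume *: "m \<in> {1..M}" "j \<in> {1..n m}" "j' \<in> {1..n m}"
    have "(\<lambda>z. z (m, i)) \<in> borel_measurable (states_measure n)" if "i \<in> {1..n m}" for i
    proof -
      have "(m, i) \<in> points n" using that *(1) by (simp add: points_def)
      then have "(\<lambda>z. z (m, i)) \<in> measurable (states_measure n) \<mu>"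
        by (rule measurable_component_singleton)
      from measurable_compose[OF this measurable_id_state] show ?thesis .
    qed
    then show "{z \<in> space (states_measure n). z (m, j) < z (m, j')} \<in> sets (states_measure n)"
      using *(2,3) by (intro borel_measurable_less) auto
  qed auto
  also have "{z \<in> space (states_measure n). \<forall>m\<in>{1..M}. \<forall>j\<in>{1..n m}. \<forall>j'\<in>{1..n m}. j < j' \<longrightarrow> z (m, j) < z (m, j')}
      = chamber n \<inter> space (states_measure n)"
    by (auto simp: chamber_def strict_mono_on_def)
  finally show ?thesis .
qed

text \<open>The integrand is symmetric in the variables of equal time and vanishes when two of them
  coincide, so its integral is a multiple of the integral over the chamber.\<close>

lemma chamber_integral:
  "card (level_perms (points n)) * (\<integral>z. indicator (chamber n) z * integrand n z \<partial>states_measure n) =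
    (\<integral>z. integrand n z \<partial>states_measure n)"
proof -
  let ?I = "points n" and ?S = "states_measure n" and ?\<Pi> = "level_perms (points n)"
  define move :: "(nat \<times> nat \<Rightarrow> nat \<times> nat) \<Rightarrow> (nat \<times> nat \<Rightarrow> real) \<Rightarrow> nat \<times> nat \<Rightarrow> real"
    where "move \<pi> = (\<lambda>z. \<lambda>a\<in>?I. z (\<pi> a))" for \<pi>
  define h where "h z = indicator (chamber n) z * integrand n z" for z
  have int: "integrable ?S h"
  proof -
    have "integrable ?S (\<lambda>z. indicator (chamber n \<inter> space ?S) z *\<^sub>R integrand n z)"
      by (rule integrable_mult_indicator[OF chamber_measurable integrand_integral(1)])
    then show ?thesis
      by (rule Bochner_Integration.integrable_cong[THEN iffD1, OF refl, rotated])
        (simp add: h_def indicator_def)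
  qed
  have invariant: "integrable ?S (\<lambda>z. h (move \<pi> z))" "(\<integral>z. h (move \<pi> z) \<partial>?S) = (\<integral>z. h z \<partial>?S)"
    if "\<pi> \<in> ?\<Pi>" for \<pi>
  proof -
    note perm = distr_PiM_permute[OF state.sigma_finite_measure_axioms finite_points
        level_perms_permutes[OF that], folded move_def]
    have mh: "h \<in> borel_measurable ?S" using int by simp
    have "integrable (distr ?S ?S (move \<pi>)) h" using int perm(2) by simp
    then show "integrable ?S (\<lambda>z. h (move \<pi> z))" by (rule integrable_distr[OF perm(1)])
    have "(\<integral>z. h (move \<pi> z) \<partial>?S) = integral\<^sup>L (distr ?S ?S (move \<pi>)) h"
      by (rule integral_distr[OF perm(1) mh, symmetric])
    then show "(\<integral>z. h (move \<pi> z) \<partial>?S) = (\<integral>z. h z \<partial>?S)" using perm(2) by simp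
  qed
  \<comment> \<open>Without coincidences exactly one relabelling sorts the configuration, so exactly
    one summand survives; with a coincidence both sides are 0.\<close>
  have sum_eq: "integrand n z = (\<Sum>\<pi>\<in>?\<Pi>. h (move \<pi> z))" for z
  proof -
    have "(\<Sum>\<pi>\<in>?\<Pi>. h (move \<pi> z)) = (\<Sum>\<pi>\<in>?\<Pi>. indicator (chamber n) (move \<pi> z)) * integrand n z"
      unfolding sum_distrib_right
      by (intro sum.cong refl) (simp add: h_def move_def integrand_permute)
    also have "\<dots> = integrand n z"
    proof (cases "\<forall>m\<in>{1..M}. inj_on (\<lambda>j. z (m, j)) {1..n m}")
      case True
      have in_chamber: "move \<pi> z \<in> chamber n \<longleftrightarrow> (\<forall>m\<in>{1..M}. strict_mono_on {1..n m} (\<lambda>j. z (\<pi> (m, j))))" for \<pi>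
        by (auto simp: chamber_def move_def points_def strict_mono_on_def)
      have "\<exists>!\<pi>. \<pi> \<in> ?\<Pi> \<and> move \<pi> z \<in> chamber n"
        unfolding in_chamber points_def by (rule ex1_sorting) (rule True[rule_format])
      then obtain \<pi> where \<pi>: "\<pi> \<in> ?\<Pi> \<and> move \<pi> z \<in> chamber n"
        "\<forall>\<pi>'. \<pi>' \<in> ?\<Pi> \<and> move \<pi>' z \<in> chamber n \<longrightarrow> \<pi>' = \<pi>"
        by (rule ex1E)
      have "indicator (chamber n) (move \<pi>' z) = (if \<pi>' = \<pi> then 1 else 0 :: real)"
        if "\<pi>' \<in> ?\<Pi>" for \<pi>'
      proof (cases "\<pi>' = \<pi>")
        case False
        then have "move \<pi>' z \<notin> chamber n" using \<pi>(2) that by blast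
        then show ?thesis using False by simp
      qed (use \<pi>(1) in simp)
      then have "(\<Sum>\<pi>'\<in>?\<Pi>. indicator (chamber n) (move \<pi>' z) :: real) =
          (\<Sum>\<pi>'\<in>?\<Pi>. if \<pi>' = \<pi> then 1 else 0)"
        by (intro sum.cong refl)
      also have "\<dots> = 1"
        using \<pi>(1) finite_level_perms[OF finite_points] by simp
      finally show ?thesis by simp
    next
      case False
      then obtain m j j' where "m \<in> {1..M}" "j \<in> {1..n m}" "j' \<in> {1..n m}" "j \<noteq> j'" "z (m, j) = z (m, j')"
        unfolding inj_on_def by blast
      then have "integrand n z = 0"
        by (intro integrand_coincidence[of "(m, j)" n "(m, j')"]) (auto simp: points_def)
      then show ?thesis by simp
    qed
    finally show ?thesis by simp
  qed
  \<comment> \<open>Relabellings preserve the measure, so every summand has the same integral as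
    \<open>h\<close>.\<close>
  have "(\<integral>z. integrand n z \<partial>?S) = (\<Sum>\<pi>\<in>?\<Pi>. \<integral>z. h (move \<pi> z) \<partial>?S)"
    unfolding sum_eq by (rule Bochner_Integration.integral_sum) (rule invariant(1))
  also have "\<dots> = (\<Sum>\<pi>\<in>?\<Pi>. \<integral>z. h z \<partial>?S)"
    by (intro sum.cong refl invariant(2))
  finally show ?thesis by (simp add: h_def)
qed

section \<open>Terms and sum of the Fredholm series\<close>

lemma fredholm_term:
  fixes K :: "real \<Rightarrow> real \<Rightarrow> real \<Rightarrow> real \<Rightarrow> real" and \<phi> :: "real \<Rightarrow> real \<Rightarrow> real"
  assumes K: "\<And>m m' x y. m \<in> {1..M} \<Longrightarrow> m' \<in> {1..M} \<Longrightarrow>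
      K (t m) x (t m') y = (\<Sum>k\<in>{1..N}. p (t m) x (u k) * mm k (t m') y) -
        (if m' < m then p (t m - t m') x y else 0)"
    and \<phi>: "\<And>m. m \<in> {1..M} \<Longrightarrow> \<phi> (t m) = f m"
  shows "set_lebesgue_integral (\<Pi>\<^sub>M m\<in>{1..M}. \<Pi>\<^sub>M j\<in>{1..n m}. \<mu>) (\<Pi>\<^sub>E m\<in>{1..M}. weyl S (n m))
      (\<lambda>x. (\<Prod>m\<in>{1..M}. \<Prod>j\<in>{1..n m}. \<phi> (t m) (x m j)) *
         det_on (SIGMA m:{1..M}. {1..n m}) (\<lambda>(m, j) (m', k). K (t m) (x m j) (t m') (x m' k))) =
    (\<Sum>J | J \<subseteq> {1..M} \<times> {1..N} \<and> (\<forall>m\<in>{1..M}. card {k. (m, k) \<in> J} = n m). \<integral>\<omega>. weighted J \<omega> \<partial>Q)"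
proof -
  let ?N = "\<Pi>\<^sub>M m\<in>{1..M}. \<Pi>\<^sub>M j\<in>{1..n m}. \<mu>" and ?S = "states_measure n"
  define F :: "(nat \<Rightarrow> nat \<Rightarrow> real) \<Rightarrow> nat \<times> nat \<Rightarrow> real"
    where "F = (\<lambda>x. \<lambda>a\<in>points n. x (fst a) (snd a))"
  note flat = distr_PiM_flatten[OF state.sigma_finite_measure_axioms,
      where n=n and M=M, folded points_def, folded F_def]
  define h where "h z = indicator (chamber n) z * integrand n z" for z
  have Fx: "F x (m, j) = x m j" if "m \<in> {1..M}" "j \<in> {1..n m}" for x m j
    using that by (simp add: F_def points_def)
  have mh: "h \<in> borel_measurable ?S"
  proof -
    have "(\<lambda>z. indicator (chamber n \<inter> space ?S) z *\<^sub>R integrand n z) \<in> borel_measurable ?S"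
      using chamber_measurable integrand_integral(1) by (intro borel_measurable_scaleR) auto
    then show ?thesis
      by (rule measurable_cong[THEN iffD1, rotated]) (simp add: h_def indicator_def)
  qed
  have "set_lebesgue_integral ?N (\<Pi>\<^sub>E m\<in>{1..M}. weyl S (n m))
      (\<lambda>x. (\<Prod>m\<in>{1..M}. \<Prod>j\<in>{1..n m}. \<phi> (t m) (x m j)) *
         det_on (SIGMA m:{1..M}. {1..n m}) (\<lambda>(m, j) (m', k). K (t m) (x m j) (t m') (x m' k))) =
      (\<integral>x. h (F x) \<partial>?N)"
    unfolding set_lebesgue_integral_def
  proof (intro Bochner_Integration.integral_cong refl)
    fix x assume x: "x \<in> space ?N"
    have xm: "x m \<in> {1..n m} \<rightarrow>\<^sub>E S" if "m \<in> {1..M}" for m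
      using x that by (auto simp: space_PiM space_state dest: PiE_mem)
    have "x \<in> (\<Pi>\<^sub>E m\<in>{1..M}. weyl S (n m)) \<longleftrightarrow> (\<forall>m\<in>{1..M}. strict_mono_on {1..n m} (x m))"
      using x xm by (auto simp: PiE_iff weyl_def space_PiM)
    also have "\<dots> \<longleftrightarrow> F x \<in> chamber n"
      by (simp add: chamber_def strict_mono_on_def Fx)
    finally have ind: "indicator (\<Pi>\<^sub>E m\<in>{1..M}. weyl S (n m)) x = (indicator (chamber n) (F x) :: real)"
      by (simp add: indicator_def)
    have "(\<Prod>m\<in>{1..M}. \<Prod>j\<in>{1..n m}. \<phi> (t m) (x m j)) = (\<Prod>m\<in>{1..M}. \<Prod>j\<in>{1..n m}. f m (F x (m, j)))"
      by (intro prod.cong refl) (simp add: \<phi> Fx)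
    also have "\<dots> = (\<Prod>a\<in>points n. f (fst a) (F x a))"
      unfolding points_def by (subst prod.Sigma) (auto simp: case_prod_unfold)
    finally have prods: "(\<Prod>m\<in>{1..M}. \<Prod>j\<in>{1..n m}. \<phi> (t m) (x m j)) = (\<Prod>a\<in>points n. f (fst a) (F x a))" .
    have "det_on (SIGMA m:{1..M}. {1..n m}) (\<lambda>(m, j) (m', k). K (t m) (x m j) (t m') (x m' k)) =
        det_on (points n) (kernel (F x))"
      unfolding points_def
    proof (rule det_on_cong)
      fix a b assume "a \<in> (SIGMA m:{1..M}. {1..n m})" "b \<in> (SIGMA m:{1..M}. {1..n m})"
      then obtain m j m' k where ab: "a = (m, j)" "b = (m', k)" "m \<in> {1..M}" "j \<in> {1..n m}"
        "m' \<in> {1..M}" "k \<in> {1..n m'}" by blast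
      then show "(case a of (m, j) \<Rightarrow> \<lambda>(m', k). K (t m) (x m j) (t m') (x m' k)) b = kernel (F x) a b"
        by (simp add: K kernel_def link_def mm_point_def time_def pos_def Fx)
    qed
    then show "indicator (\<Pi>\<^sub>E m\<in>{1..M}. weyl S (n m)) x *\<^sub>R
      ((\<Prod>m\<in>{1..M}. \<Prod>j\<in>{1..n m}. \<phi> (t m) (x m j)) *
         det_on (SIGMA m:{1..M}. {1..n m}) (\<lambda>(m, j) (m', k). K (t m) (x m j) (t m') (x m' k))) = h (F x)"
      by (simp only: ind prods h_def integrand_def real_scaleR_def)
  qed
  also have "\<dots> = integral\<^sup>L (distr ?N ?S F) h"
    by (rule integral_distr[OF flat(1) mh, symmetric])
  also have "\<dots> = (\<integral>z. h z \<partial>?S)"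
    by (simp only: flat(2))
  also have "\<dots> = (\<Sum>J | J \<subseteq> {1..M} \<times> {1..N} \<and> (\<forall>m\<in>{1..M}. card {k. (m, k) \<in> J} = n m).
      \<integral>\<omega>. weighted J \<omega> \<partial>Q)" (is "_ = ?W")
  \<comment> \<open>The number of level permutations occurs twice: in passing from the chamber to
    the full product, and in counting labellings with a given image. The two occurrences
    cancel.\<close>
  proof (rule mult_left_cancel[THEN iffD1])
    show "real (card (level_perms (points n))) \<noteq> 0"
      using card_level_perms_pos[OF finite_points, of n] by simp
    show "real (card (level_perms (points n))) * (\<integral>z. h z \<partial>?S) = card (level_perms (points n)) * ?W"
      unfolding h_def chamber_integral integrand_integral(2) ..
  qed
  finally show ?thesis .
qed

lemma expectation_expansion:
  "(\<integral>\<omega>. (\<Prod>m\<in>{1..M}. \<Prod>j\<in>{1..N}. 1 + f m (V (t m) (\<omega> j))) *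
      det_on {1..N} (\<lambda>j k. mm k T (V T (\<omega> j))) \<partial>Q) =
    (\<Sum>J\<in>Pow ({1..M} \<times> {1..N}). \<integral>\<omega>. weighted J \<omega> \<partial>Q)"
proof -
  have "(\<Prod>m\<in>{1..M}. \<Prod>j\<in>{1..N}. 1 + f m (V (t m) (\<omega> j))) * det_on {1..N} (\<lambda>j k. mm k T (V T (\<omega> j))) =
      (\<Sum>J\<in>Pow ({1..M} \<times> {1..N}). weighted J \<omega>)" for \<omega>
  proof -
    have "(\<Prod>m\<in>{1..M}. \<Prod>j\<in>{1..N}. 1 + f m (V (t m) (\<omega> j))) =
        (\<Prod>(m, j)\<in>{1..M} \<times> {1..N}. f m (V (t m) (\<omega> j)) + 1)"
      by (simp add: prod.cartesian_product add.commute)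
    also have "\<dots> = (\<Sum>J\<in>Pow ({1..M} \<times> {1..N}). \<Prod>(m, k)\<in>J. f m (V (t m) (\<omega> k)))"
      by (simp add: case_prod_unfold prod_add)
    finally show ?thesis by (simp add: weighted_def mm_det_def sum_distrib_right)
  qed
  then show ?thesis
    by (simp only:) (rule Bochner_Integration.integral_sum; use integrable_weighted in blast)
qed

text \<open>The series has finite support: at most \<open>N\<close> particles can be chosen at each
  time, so a term with some \<open>n m\<close> above \<open>N\<close> is an empty sum. The remaining
  terms sort the subsets in the expansion of the expectation by the number of particles at each
  time.\<close>

proposition expectation_eq_fredholm_det:
  assumes "\<And>m m' x y. m \<in> {1..M} \<Longrightarrow> m' \<in> {1..M} \<Longrightarrow>
      K (t m) x (t m') y = (\<Sum>k\<in>{1..N}. p (t m) x (u k) * mm k (t m') y) -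
        (if m' < m then p (t m - t m') x y else 0)"
    and "\<And>m. m \<in> {1..M} \<Longrightarrow> \<phi> (t m) = f m"
  shows "(\<integral>\<omega>. (\<Prod>m\<in>{1..M}. \<Prod>j\<in>{1..N}. 1 + f m (V (t m) (\<omega> j))) *
      det_on {1..N} (\<lambda>j k. mm k T (V T (\<omega> j))) \<partial>Q) = fredholm_det \<mu> S M t \<phi> K"
proof -
  let ?X = "Pow ({1..M} \<times> {1..N})" and ?B = "{1..M} \<rightarrow>\<^sub>E {0..N}"
  \<comment> \<open>Restricted to \<open>{1..M}\<close> so that it belongs to the extensional index
    set of the Fredholm series.\<close>
  define profile where "profile J = (\<lambda>m\<in>{1..M}. card {k. (m, k) \<in> J})" for J :: "(nat \<times> nat) set"
  define W where "W n = (\<Sum>J | J \<in> ?X \<and> profile J = n. \<integral>\<omega>. weighted J \<omega> \<partial>Q)" for n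
  have profile: "profile J \<in> ?B" if "J \<in> ?X" for J
  proof (rule PiE_I)
    fix m assume "m \<in> {1..M}"
    moreover have "{k. (m, k) \<in> J} \<subseteq> {1..N}" using that by auto
    then have "card {k. (m, k) \<in> J} \<le> N" using card_mono[of "{1..N}"] by fastforce
    ultimately show "profile J m \<in> {0..N}" by (simp add: profile_def)
  qed (auto simp: profile_def)
  have term_eq: "(\<Sum>J | J \<subseteq> {1..M} \<times> {1..N} \<and> (\<forall>m\<in>{1..M}. card {k. (m, k) \<in> J} = n m).
      \<integral>\<omega>. weighted J \<omega> \<partial>Q) = W n" if "n \<in> {1..M} \<rightarrow>\<^sub>E UNIV" for n
  proof -
    have "profile J = n \<longleftrightarrow> (\<forall>m\<in>{1..M}. card {k. (m, k) \<in> J} = n m)" for J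
    proof
      assume *: "\<forall>m\<in>{1..M}. card {k. (m, k) \<in> J} = n m"
      show "profile J = n"
      proof
        show "profile J m = n m" for m
          using * PiE_arb[OF that, of m] by (cases "m \<in> {1..M}") (auto simp: profile_def)
      qed
    qed (auto simp: profile_def)
    then show ?thesis by (simp only: W_def Pow_iff)
  qed
  have "fredholm_det \<mu> S M t \<phi> K = (\<Sum>\<^sub>\<infinity>n\<in>({1..M} \<rightarrow>\<^sub>E UNIV). W n)"
    unfolding fredholm_det_def by (intro infsum_cong trans[OF fredholm_term[OF assms] term_eq])
  also have "\<dots> = (\<Sum>\<^sub>\<infinity>n\<in>?B. W n)"
  proof (rule infsum_cong_neutral)
    fix n assume "n \<in> ({1..M} \<rightarrow>\<^sub>E UNIV) - ?B"
    then have "{J. J \<in> ?X \<and> profile J = n} = {}" using profile by blast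
    then show "W n = 0" unfolding W_def by (simp only: sum.empty)
  qed auto
  also have "\<dots> = (\<Sum>n\<in>?B. W n)"
    by (rule infsum_finite) (simp add: finite_PiE)
  also have "\<dots> = (\<Sum>J\<in>?X. \<integral>\<omega>. weighted J \<omega> \<partial>Q)"
    unfolding W_def
  proof (rule sum.group)
    show "profile ` ?X \<subseteq> ?B" using profile by blast
  qed (simp_all add: finite_PiE)
  finally show ?thesis using expectation_expansion by simp
qed

end

text \<open>A local martingale need not have constant expectation, so the passage from the path ends
  to \<open>T\<close> rests on \<open>true_martingale\<close>. \<open>absolutely_convergent\<close>
  dominates every term of the expansion of the product, which may then be integrated term by
  term.\<close>

theorem lemma1p2:
  fixes TT S :: "real set"
    and Om :: "'w measure"
    and P :: "real \<Rightarrow> 'w measure"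
    and V :: "real \<Rightarrow> 'w \<Rightarrow> real"
    and p :: "real \<Rightarrow> real \<Rightarrow> real \<Rightarrow> real"
    and N M :: nat
    and u t :: "nat \<Rightarrow> real"
    and T :: real
    and \<M> :: "complex \<Rightarrow> real \<Rightarrow> real \<Rightarrow> real"
    and \<phi> :: "real \<Rightarrow> real \<Rightarrow> real"
  assumes markov: "markov_process TT S Om P V p"
    and N: "1 \<le> N"
    and u: "u \<in> weyl S N"
    and measurable_maps: "\<And>v r. r \<in> TT \<Longrightarrow> \<M> v r \<in> borel_measurable (restrict_space borel S)"
    and i: "\<And>v j. j \<in> {1..N} \<Longrightarrow>
      local_martingale (P (u j)) (natural_filtration TT Om V) TT (\<lambda>r \<omega>. \<M> v r (V r \<omega>))"
    and ii: "\<And>r. r \<in> TT \<Longrightarrow>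
      linearly_independent_family {1..N} (\<lambda>k x. \<M> (complex_of_real (u k)) r x)"
    and iii: "\<And>j k. j \<in> {1..N} \<Longrightarrow> k \<in> {1..N} \<Longrightarrow>
      \<M> (complex_of_real (u k)) 0 (u j) = (if j = k then 1 else 0)"
    and M: "1 \<le> M"
    and T: "T \<in> TT"
    and times: "strict_mono_on {1..M} t" "\<And>m. m \<in> {1..M} \<Longrightarrow> t m \<in> TT \<and> 0 < t m \<and> t m \<le> T"
    and test_functions: "\<And>m. m \<in> {1..M} \<Longrightarrow> \<phi> (t m) \<in> borel_measurable (restrict_space borel S)"
    and true_martingale: "\<And>j k. j \<in> {1..N} \<Longrightarrow> k \<in> {1..N} \<Longrightarrow>
      martingale (P (u j)) (natural_filtration TT Om V) (TT \<inter> {..T})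
        (\<lambda>r \<omega>. \<M> (complex_of_real (u k)) r (V r \<omega>))"
    and absolutely_convergent: "integrable (indep_copies P N u)
      (\<lambda>\<omega>. (\<Prod>m\<in>{1..M}. \<Prod>j\<in>{1..N}. 1 + \<bar>\<phi> (t m) (V (t m) (\<omega> j))\<bar>) *
        det_on {1..N} (\<lambda>j k. \<M> (complex_of_real (u k)) T (V T (\<omega> j))))"
  shows "(\<integral>\<omega>. (\<Prod>m\<in>{1..M}. \<Prod>j\<in>{1..N}. 1 + \<phi> (t m) (V (t m) (\<omega> j))) *
            det_on {1..N} (\<lambda>j k. \<M> (complex_of_real (u k)) T (V T (\<omega> j)))
          \<partial>indep_copies P N u)
       = fredholm_det (state_measure TT S) S M t \<phi> (corr_kernel p (config S N u) \<M>)"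
proof -
  define mm where "mm k = \<M> (complex_of_real (u k))" for k
  define f where "f m = \<phi> (t m)" for m
  interpret markov_process TT S Om P V p by (rule markov)
  have u_in_S: "u k \<in> S" if "k \<in> {1..N}" for k
    using u that by (auto simp: weyl_def)
  interpret martingale_particles TT S Om P V p N M u t T mm f
  proof
    show "mm k r \<in> borel_measurable (state_measure TT S)" if "r \<in> TT" for k r
      using measurable_maps[OF that] by (simp add: mm_def measurable_state)
    show "f m \<in> borel_measurable (state_measure TT S)" if "m \<in> {1..M}" for m
      using test_functions[OF that] by (simp add: f_def measurable_state)
  qed (use N u_in_S times T iii true_martingale absolutely_convergent in \<open>simp_all add: mm_def f_def\<close>)
  \<comment> \<open>Integration against the configuration becomes a finite sum over its atoms, and
    strict monotonicity of \<open>t\<close> turns the comparison of times into one of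
    indices.\<close>
  have "corr_kernel p (config S N u) \<M> (t m) x (t m') y =
      (\<Sum>k\<in>{1..N}. p (t m) x (u k) * mm k (t m') y) - (if m' < m then p (t m - t m') x y else 0)"
    if "m \<in> {1..M}" "m' \<in> {1..M}" for m m' x y
  proof -
    have "(\<integral>v. p (t m) x v * \<M> (complex_of_real v) (t m') y \<partial>config S N u) =
        (\<integral>k. p (t m) x (u k) * mm k (t m') y \<partial>count_space {1..N})"
      unfolding config_def mm_def using u_in_S by (intro integral_distr) auto
    moreover have "t m' < t m \<longleftrightarrow> m' < m"
      using that times(1) strict_mono_on_less by blast
    ultimately show ?thesis
      by (simp add: corr_kernel_def lebesgue_integral_count_space_finite)
  qed
  then show ?thesis
    using expectation_eq_fredholm_det[of "corr_kernel p (config S N u) \<M>" \<phi>]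
    by (simp add: f_def mm_def)
qed

end
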